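(* The operators $$L_{l,k}:=\sum_{p,s=0}^{\infty}\frac{l^p(k\log q)^s}{p!\,s!}\,\frac{W_s^{(p+1)}}{p+1},\qquad l,k\ge0,$$ constitute a quantum torus algebra by acting on the space of tau functions of the KP hierarchy, i.e. $$[L_{n,m},L_{l,k}]=(q^{ml}-q^{nk})\,L_{n+l,m+k},\qquad n,m,l,k\ge 0.$$
   Context: $q$ is a parameter, and infinite sums are understood formally. Tau functions $\tau(t)$, $t=(t_1,t_2,\dots)$, of the KP hierarchy are those for which $\phi(t,\lambda)=\frac{e^{\eta}\tau}{\tau}e^{\sum_{k\ge1}t_k\lambda^k}$, $\eta=-\sum_{i\ge1}\frac{\lambda^{-i}}{i}\frac{\partial}{\partial t_i}$, is a KP wave function: $L\phi=\lambda\phi$ and $\partial\phi/\partial t_n=(L^n)_+\phi$ for a pseudo-differential operator $L=\partial+u_{-1}\partial^{-1}+u_{-2}\partial^{-2}+\cdots$ in $\partial=\partial/\partial x$ ($x=t_1$), where $(\cdot)_+$ denotes the differential-operator part. $W_s^{(p+1)}$, $p,s\ge0$, are the generators of the $W_\infty$ algebra of Adler–Shiota–van Moerbeke acting on tau functions, with $W_s^{(p+1)}$ corresponding to $M^pL^s$, where $M$ is the Orlov–Shulman operator ($M=S(\sum_{i\ge1} it_i\partial^{i-1})S^{-1}$ with $L=S\partial S^{-1}$, $S=1+\sum_{k\ge 1}\omega_k\partial^{-k}$). Explicitly, expand the vertex operator $$X(\lambda,\mu)=\exp\Big(\sum_{i\ge1}t_i(\mu^i-\lambda^i)\Big)\exp\Big(\sum_{i\ge1}\frac{\lambda^{-i}-\mu^{-i}}{i}\frac{\partial}{\partial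 t_i}\Big)=\sum_{k\ge0}\frac{(\mu-\lambda)^k}{k!}\sum_{j\in\mathbb Z}\lambda^{-j-k}\,\widehat W_j^{(k)};$$ then $W_s^{(p+1)}:=\widehat W_{s-p}^{(p+1)}$. With this numbering, $\partial_{t_{p,s}}\log\phi=(e^{\eta}-1)\frac{\frac1{p+1}W_s^{(p+1)}(\tau)}{\tau}$, where $\partial_{t_{p,s}}S=-(M^pL^s)_-S$, $(\cdot)_-$ denotes the part with negative powers of $\partial$, and $\phi=Se^{\sum_{k\ge1} t_k\lambda^k}$. *)

theory Defs
  imports
    "HOL-Library.Poly_Mapping"
    "HOL-Computational_Algebra.Formal_Laurent_Series"
    "HOL-Computational_Algebra.Fraction_Field"
begin

section \<open>Formal power series in the time variables\<close>

text \<open>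
  The times are numbered from 1 in the mathematics and from 0 here: key \<open>i\<close> of an exponent
  belongs to $t_{i+1}$. The order \<open>\<le>\<close> that the library puts on exponents is lexicographic,
  not divisibility of monomials, and is never used.
\<close>

type_synonym expo = "nat \<Rightarrow>\<^sub>0 nat"

abbreviation (input) "keys \<equiv> Poly_Mapping.keys"
abbreviation (input) "lookup \<equiv> Poly_Mapping.lookup"

definition weight :: "expo \<Rightarrow> nat" where
  "weight \<alpha> = (\<Sum>i\<in>keys \<alpha>. Suc i * lookup \<alpha> i)"

typedef 'a tps = "UNIV :: (expo \<Rightarrow> 'a) set"
  morphisms tcoeff Abs_tps ..

lemma tps_eqI: "(\<And>\<gamma>. tcoeff f \<gamma> = tcoeff g \<gamma>) \<Longrightarrow> f = g"
  by (metis ext tcoeff_inverse)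

lemma tcoeff_Abs_tps [simp]: "tcoeff (Abs_tps h) = h"
  by (simp add: Abs_tps_inverse)

lemma weight_superset:
  assumes "finite A" "keys \<alpha> \<subseteq> A"
  shows "weight \<alpha> = (\<Sum>i\<in>A. Suc i * lookup \<alpha> i)"
  unfolding weight_def
  by (rule sum.mono_neutral_left) (use assms in \<open>auto simp: in_keys_iff\<close>)

lemma weight_zero [simp]: "weight 0 = 0"
  by (simp add: weight_def)

lemma weight_add: "weight (\<alpha> + \<beta>) = weight \<alpha> + weight \<beta>"
proof -
  let ?A = "keys \<alpha> \<union> keys \<beta>"
  have "weight (\<alpha> + \<beta>) = (\<Sum>i\<in>?A. Suc i * lookup (\<alpha> + \<beta>) i)"
    by (rule weight_superset) (auto simp: in_keys_iff lookup_add)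
  also have "\<dots> = (\<Sum>i\<in>?A. Suc i * lookup \<alpha> i) + (\<Sum>i\<in>?A. Suc i * lookup \<beta> i)"
    by (simp add: lookup_add algebra_simps sum.distrib)
  also have "\<dots> = weight \<alpha> + weight \<beta>"
    by (simp add: weight_superset[of ?A])
  finally show ?thesis .
qed

lemma weight_ge: "Suc i * lookup \<alpha> i \<le> weight \<alpha>"
proof (cases "i \<in> keys \<alpha>")
  case True
  then show ?thesis unfolding weight_def
    by (intro member_le_sum[where f = "\<lambda>i. Suc i * lookup \<alpha> i"]) auto
qed (simp add: in_keys_iff)

lemma finite_weight_le: "finite {\<alpha>. weight \<alpha> \<le> d}"
proof -
  let ?S = "{f. \<forall>i. (i \<in> {..d} \<longrightarrow> f i \<in> {..d}) \<and> (i \<notin> {..d} \<longrightarrow> f i = (0::nat))}"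
  have "finite ?S"
    by (rule finite_set_of_finite_funs) auto
  moreover have "lookup ` {\<alpha>. weight \<alpha> \<le> d} \<subseteq> ?S"
  proof (rule image_subsetI, rule CollectI, intro allI conjI impI)
    fix \<alpha> i assume "\<alpha> \<in> {\<alpha>. weight \<alpha> \<le> d}"
    then have *: "weight \<alpha> \<le> d" by simp
    have "lookup \<alpha> i \<le> weight \<alpha>" using weight_ge[of i \<alpha>] by simp
    with * show "lookup \<alpha> i \<in> {..d}" by simp
    show "lookup \<alpha> i = 0" if "i \<notin> {..d}"
    proof (rule ccontr)
      assume "lookup \<alpha> i \<noteq> 0"
      then have "Suc i \<le> Suc i * lookup \<alpha> i" by (cases "lookup \<alpha> i") auto
      also have "\<dots> \<le> weight \<alpha>" by (rule weight_ge)
      finally have "Suc i \<le> weight \<alpha>" .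
      with * that show False by simp
    qed
  qed
  ultimately have "finite (lookup ` {\<alpha>. weight \<alpha> \<le> d})" by (rule rev_finite_subset)
  then show ?thesis
    by (rule finite_imageD) (simp add: inj_on_def)
qed

lemma finite_antidiagonal: "finite {(\<alpha>, \<beta>). \<alpha> + \<beta> = (\<gamma> :: expo)}"
  by (rule finite_subset[of _ "{\<alpha>. weight \<alpha> \<le> weight \<gamma>} \<times> {\<alpha>. weight \<alpha> \<le> weight \<gamma>}"])
     (auto simp: weight_add intro: finite_weight_le)

instantiation tps :: (comm_ring_1) "{zero,one,plus,minus,uminus,times}"
begin
definition "0 = Abs_tps (\<lambda>\<gamma>. 0)"
definition "1 = Abs_tps (\<lambda>\<gamma>. if \<gamma> = 0 then 1 else 0)"
definition "f + g = Abs_tps (\<lambda>\<gamma>. tcoeff f \<gamma> + tcoeff g \<gamma>)"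
definition "f - g = Abs_tps (\<lambda>\<gamma>. tcoeff f \<gamma> - tcoeff g \<gamma>)"
definition "- f = Abs_tps (\<lambda>\<gamma>. - tcoeff f \<gamma>)"
definition "f * g = Abs_tps (\<lambda>\<gamma>. \<Sum>(\<alpha>, \<beta>) | \<alpha> + \<beta> = \<gamma>. tcoeff f \<alpha> * tcoeff g \<beta>)"
instance ..
end

lemmas tcoeff_simps =
  zero_tps_def one_tps_def plus_tps_def minus_tps_def uminus_tps_def times_tps_def

text \<open>
  The ring laws are pulled back along the injection that collects the homogeneous components
  of a series (for the grading in which $t_i$ has degree $i$; they are polynomials) into a power
  series with polynomial coefficients.
\<close>

definition graded :: "'a::comm_ring_1 tps \<Rightarrow> (expo \<Rightarrow>\<^sub>0 'a) fps" where
  "graded f = Abs_fps (\<lambda>d. Abs_poly_mapping (\<lambda>\<alpha>. tcoeff f \<alpha> when weight \<alpha> = d))"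

lemma lookup_graded: "lookup (fps_nth (graded f) d) \<alpha> = (tcoeff f \<alpha> when weight \<alpha> = d)"
proof -
  have "finite {\<alpha>. (tcoeff f \<alpha> when weight \<alpha> = d) \<noteq> 0}"
    by (rule finite_subset[OF _ finite_weight_le[of d]]) (auto simp: when_def)
  then show ?thesis by (simp add: graded_def)
qed

lemma graded_inject: "graded f = graded g \<longleftrightarrow> f = g"
proof
  assume eq: "graded f = graded g"
  show "f = g"
  proof (rule tps_eqI)
    fix \<gamma>
    show "tcoeff f \<gamma> = tcoeff g \<gamma>"
      using lookup_graded[of f "weight \<gamma>" \<gamma>] lookup_graded[of g "weight \<gamma>" \<gamma>] eq by simp
  qed
qed simp

lemma lookup_mult_pairs:
  fixes p q :: "expo \<Rightarrow>\<^sub>0 'a::comm_ring_1"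
  shows "lookup (p * q) \<gamma> = (\<Sum>(\<alpha>, \<beta>) | \<alpha> + \<beta> = \<gamma>. lookup p \<alpha> * lookup q \<beta>)"
proof -
  have "lookup (p * q) \<gamma> = Sum_any (\<lambda>(\<alpha>, \<beta>). lookup p \<alpha> * lookup q \<beta> when \<gamma> = \<alpha> + \<beta>)"
    unfolding times_poly_mapping.rep_eq by (rule prod_fun_unfold_prod) auto
  also have "\<dots> = (\<Sum>(\<alpha>, \<beta>) | \<alpha> + \<beta> = \<gamma>. lookup p \<alpha> * lookup q \<beta> when \<gamma> = \<alpha> + \<beta>)"
    by (rule Sum_any.expand_superset) (auto simp: finite_antidiagonal)
  also have "\<dots> = (\<Sum>(\<alpha>, \<beta>) | \<alpha> + \<beta> = \<gamma>. lookup p \<alpha> * lookup q \<beta>)"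
    by (rule sum.cong) auto
  finally show ?thesis .
qed

lemma graded_mult: "graded (f * g) = graded f * graded g"
proof (rule fps_ext, rule poly_mapping_eqI)
  fix d and \<gamma> :: expo
  let ?P = "{(\<alpha>, \<beta>). \<alpha> + \<beta> = \<gamma>}"
  have "lookup (fps_nth (graded f * graded g) d) \<gamma> =
     (\<Sum>i=0..d. \<Sum>(\<alpha>, \<beta>)\<in>?P.
        (tcoeff f \<alpha> when weight \<alpha> = i) * (tcoeff g \<beta> when weight \<beta> = d - i))"
    by (simp add: fps_mult_nth lookup_sum lookup_mult_pairs lookup_graded)
  also have "\<dots> = (\<Sum>(\<alpha>, \<beta>)\<in>?P. \<Sum>i=0..d.
        (tcoeff f \<alpha> when weight \<alpha> = i) * (tcoeff g \<beta> when weight \<beta> = d - i))"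
    unfolding case_prod_unfold by (rule sum.swap)
  also have "\<dots> = (\<Sum>(\<alpha>, \<beta>)\<in>?P. tcoeff f \<alpha> * tcoeff g \<beta> when weight \<gamma> = d)"
  proof (rule sum.cong, rule refl, clarify)
    fix \<alpha> \<beta> :: expo
    have "(\<Sum>i=0..d. (tcoeff f \<alpha> when weight \<alpha> = i) * (tcoeff g \<beta> when weight \<beta> = d - i)) =
          (\<Sum>i=0..d. if i = weight \<alpha>
             then tcoeff f \<alpha> * (tcoeff g \<beta> when weight \<beta> = d - weight \<alpha>) else 0)"
      by (rule sum.cong) (simp_all add: when_def)
    also have "\<dots> = (tcoeff f \<alpha> * tcoeff g \<beta> when weight (\<alpha> + \<beta>) = d)"
      by (auto simp: when_def weight_add)
    finally show "(\<Sum>i=0..d. (tcoeff f \<alpha> when weight \<alpha> = i) *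
        (tcoeff g \<beta> when weight \<beta> = d - i)) = (tcoeff f \<alpha> * tcoeff g \<beta> when weight (\<alpha> + \<beta>) = d)" .
  qed
  also have "\<dots> = lookup (fps_nth (graded (f * g)) d) \<gamma>"
    by (cases "weight \<gamma> = d") (simp_all add: lookup_graded times_tps_def case_prod_unfold)
  finally show "lookup (fps_nth (graded (f * g)) d) \<gamma> = lookup (fps_nth (graded f * graded g) d) \<gamma>" ..
qed

lemma graded_hom:
  "graded 0 = 0" "graded 1 = 1" "graded (f + g) = graded f + graded g"
  "graded (f - g) = graded f - graded g" "graded (- f) = - graded f"
  by (rule fps_ext, rule poly_mapping_eqI,
      simp add: lookup_graded tcoeff_simps lookup_add lookup_minus lookup_one when_def; fail)+

instance tps :: (comm_ring_1) comm_ring_1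
  by standard
    (unfold graded_inject[symmetric] graded_hom graded_mult, auto simp: algebra_simps)

instance tps :: (idom) idom
  by standard (unfold graded_inject[symmetric] graded_hom graded_mult, auto)

definition tconst :: "'a::comm_ring_1 \<Rightarrow> 'a tps" where
  "tconst c = Abs_tps (\<lambda>\<gamma>. if \<gamma> = 0 then c else 0)"

definition tmono :: "expo \<Rightarrow> 'a::comm_ring_1 tps" where
  "tmono \<alpha> = Abs_tps (\<lambda>\<gamma>. if \<gamma> = \<alpha> then 1 else 0)"

definition tderiv :: "nat \<Rightarrow> 'a::comm_ring_1 tps \<Rightarrow> 'a tps" where
  "tderiv i f = Abs_tps (\<lambda>\<gamma>. of_nat (Suc (lookup \<gamma> i)) * tcoeff f (\<gamma> + Poly_Mapping.single i 1))"

lemma tderiv_mult: "tderiv i (f * g) = tderiv i f * g + f * tderiv i g"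
proof (rule tps_eqI)
  fix \<gamma> :: expo
  let ?e = "Poly_Mapping.single i (1::nat)"
  let ?P = "\<lambda>\<gamma>. {(\<alpha>, \<beta>). \<alpha> + \<beta> = (\<gamma> :: expo)}"
  have split: "\<exists>\<alpha>'. \<alpha> = \<alpha>' + ?e" if "lookup \<alpha> i \<noteq> 0" for \<alpha> :: expo
    by (rule exI[of _ "\<alpha> - ?e"], rule poly_mapping_eqI)
       (use that in \<open>auto simp: lookup_add lookup_minus lookup_single when_def\<close>)
  have *: "(\<Sum>(\<alpha>, \<beta>)\<in>?P (\<gamma> + ?e). of_nat (lookup \<alpha> i) * h \<alpha> \<beta>) =
      (\<Sum>(\<alpha>, \<beta>)\<in>?P \<gamma>. of_nat (Suc (lookup \<alpha> i)) * h (\<alpha> + ?e) \<beta>)" (is "?l = ?r")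
    for h :: "expo \<Rightarrow> expo \<Rightarrow> 'a"
  proof -
    have "?l = (\<Sum>(\<alpha>, \<beta>)\<in>(\<lambda>(\<alpha>, \<beta>). (\<alpha> + ?e, \<beta>)) ` ?P \<gamma>. of_nat (lookup \<alpha> i) * h \<alpha> \<beta>)"
    proof (rule sum.mono_neutral_right[OF finite_antidiagonal])
      show "(\<lambda>(\<alpha>, \<beta>). (\<alpha> + ?e, \<beta>)) ` ?P \<gamma> \<subseteq> ?P (\<gamma> + ?e)"
        by (auto simp: algebra_simps)
      show "\<forall>x\<in>?P (\<gamma> + ?e) - (\<lambda>(\<alpha>, \<beta>). (\<alpha> + ?e, \<beta>)) ` ?P \<gamma>.
          (case x of (\<alpha>, \<beta>) \<Rightarrow> of_nat (lookup \<alpha> i) * h \<alpha> \<beta>) = 0"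
      proof clarify
        fix \<alpha> \<beta> assume ab: "\<alpha> + \<beta> = \<gamma> + ?e" "(\<alpha>, \<beta>) \<notin> (\<lambda>(\<alpha>, \<beta>). (\<alpha> + ?e, \<beta>)) ` ?P \<gamma>"
        have "lookup \<alpha> i = 0"
        proof (rule ccontr)
          assume "lookup \<alpha> i \<noteq> 0"
          then obtain \<alpha>' where a: "\<alpha> = \<alpha>' + ?e" using split by blast
          with ab(1) have "(\<alpha>' + \<beta>) + ?e = \<gamma> + ?e" by (simp add: ac_simps)
          then have "\<alpha>' + \<beta> = \<gamma>" by (rule add_right_imp_eq)
          with ab(2) a show False by (auto simp: image_iff)
        qed
        then show "of_nat (lookup \<alpha> i) * h \<alpha> \<beta> = 0" by simp
      qed
    qed
    also have "\<dots> = ?r"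
      by (subst sum.reindex) (auto simp: inj_on_def lookup_add intro!: sum.cong)
    finally show ?thesis .
  qed
  have swap: "(\<Sum>(\<alpha>, \<beta>)\<in>?P \<delta>. h \<alpha> \<beta>) = (\<Sum>(\<alpha>, \<beta>)\<in>?P \<delta>. h \<beta> \<alpha>)"
    for \<delta> and h :: "expo \<Rightarrow> expo \<Rightarrow> 'a"
    by (rule sum.reindex_bij_witness[of _ prod.swap prod.swap]) (auto simp: add.commute)
  have "tcoeff (tderiv i (f * g)) \<gamma> =
      (\<Sum>(\<alpha>, \<beta>)\<in>?P (\<gamma> + ?e). of_nat (lookup (\<gamma> + ?e) i) * (tcoeff f \<alpha> * tcoeff g \<beta>))"
    by (simp add: tderiv_def times_tps_def lookup_add sum_distrib_left case_prod_unfold)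
  also have "\<dots> = (\<Sum>(\<alpha>, \<beta>)\<in>?P (\<gamma> + ?e). of_nat (lookup \<alpha> i) * (tcoeff f \<alpha> * tcoeff g \<beta>)) +
      (\<Sum>(\<alpha>, \<beta>)\<in>?P (\<gamma> + ?e). of_nat (lookup \<beta> i) * (tcoeff f \<alpha> * tcoeff g \<beta>))"
    unfolding sum.distrib[symmetric]
  proof (rule sum.cong[OF refl], clarify)
    fix \<alpha> \<beta> assume "\<alpha> + \<beta> = \<gamma> + ?e"
    then have "lookup (\<gamma> + ?e) i = lookup \<alpha> i + lookup \<beta> i" by (metis lookup_add)
    then show "of_nat (lookup (\<gamma> + ?e) i) * (tcoeff f \<alpha> * tcoeff g \<beta>) =
      of_nat (lookup \<alpha> i) * (tcoeff f \<alpha> * tcoeff g \<beta>) +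
      of_nat (lookup \<beta> i) * (tcoeff f \<alpha> * tcoeff g \<beta>)" by (simp add: distrib_right)
  qed
  also have "(\<Sum>(\<alpha>, \<beta>)\<in>?P (\<gamma> + ?e). of_nat (lookup \<alpha> i) * (tcoeff f \<alpha> * tcoeff g \<beta>)) =
      tcoeff (tderiv i f * g) \<gamma>"
    unfolding * by (simp add: tderiv_def times_tps_def mult.assoc)
  also have "(\<Sum>(\<alpha>, \<beta>)\<in>?P (\<gamma> + ?e). of_nat (lookup \<beta> i) * (tcoeff f \<alpha> * tcoeff g \<beta>)) =
      tcoeff (f * tderiv i g) \<gamma>"
    apply (subst swap)
    unfolding * apply (subst swap)
    by (simp add: tderiv_def times_tps_def mult.left_commute)
  finally show "tcoeff (tderiv i (f * g)) \<gamma> = tcoeff (tderiv i f * g + f * tderiv i g) \<gamma>"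
    by (simp add: plus_tps_def)
qed

definition tderivs :: "expo \<Rightarrow> 'a::comm_ring_1 tps \<Rightarrow> 'a tps" where
  "tderivs \<beta> f = Abs_tps (\<lambda>\<gamma>.
     of_nat (\<Prod>i\<in>keys \<beta>. pochhammer (Suc (lookup \<gamma> i)) (lookup \<beta> i)) * tcoeff f (\<gamma> + \<beta>))"

lemma tderivs_zero: "tderivs 0 f = f"
  by (rule tps_eqI) (simp add: tderivs_def)

lemma tderivs_step: "tderivs (Poly_Mapping.single i 1 + \<beta>) f = tderiv i (tderivs \<beta> f)"
proof (rule tps_eqI)
  fix \<gamma> :: expo
  let ?e = "Poly_Mapping.single i (1::nat)"
  let ?A = "insert i (keys \<beta>)"
  let ?p = "\<lambda>\<gamma> \<beta> j. pochhammer (Suc (lookup \<gamma> j)) (lookup \<beta> j)"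
  have sup: "(\<Prod>j\<in>keys \<delta>. ?p \<gamma>' \<delta> j) = (\<Prod>j\<in>?A. ?p \<gamma>' \<delta> j)"
    if "keys \<delta> \<subseteq> ?A" for \<delta> \<gamma>' :: expo
    by (rule prod.mono_neutral_left) (use that in \<open>auto simp: in_keys_iff\<close>)
  have "(\<Prod>j\<in>keys (?e + \<beta>). ?p \<gamma> (?e + \<beta>) j) = (\<Prod>j\<in>?A. ?p \<gamma> (?e + \<beta>) j)"
    by (rule sup) (auto simp: in_keys_iff lookup_add lookup_single when_def split: if_splits)
  also have "\<dots> = ?p \<gamma> (?e + \<beta>) i * (\<Prod>j\<in>?A - {i}. ?p \<gamma> (?e + \<beta>) j)"
    by (subst prod.remove[of _ i]) auto
  also have "?p \<gamma> (?e + \<beta>) i = Suc (lookup \<gamma> i) * ?p (\<gamma> + ?e) \<beta> i"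
    by (simp add: lookup_add pochhammer_rec)
  also have "(\<Prod>j\<in>?A - {i}. ?p \<gamma> (?e + \<beta>) j) = (\<Prod>j\<in>?A - {i}. ?p (\<gamma> + ?e) \<beta> j)"
    by (rule prod.cong) (auto simp: lookup_add lookup_single)
  also have "Suc (lookup \<gamma> i) * ?p (\<gamma> + ?e) \<beta> i * \<dots> = Suc (lookup \<gamma> i) * (\<Prod>j\<in>?A. ?p (\<gamma> + ?e) \<beta> j)"
    by (subst (2) prod.remove[of _ i]) (auto simp: algebra_simps)
  also have "(\<Prod>j\<in>?A. ?p (\<gamma> + ?e) \<beta> j) = (\<Prod>j\<in>keys \<beta>. ?p (\<gamma> + ?e) \<beta> j)"
    by (rule sup[symmetric]) auto
  finally have "(\<Prod>j\<in>keys (?e + \<beta>). ?p \<gamma> (?e + \<beta>) j) =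
      Suc (lookup \<gamma> i) * (\<Prod>j\<in>keys \<beta>. ?p (\<gamma> + ?e) \<beta> j)" .
  then show "tcoeff (tderivs (?e + \<beta>) f) \<gamma> = tcoeff (tderiv i (tderivs \<beta> f)) \<gamma>"
    by (simp only: tderivs_def tderiv_def tcoeff_Abs_tps of_nat_mult add.assoc mult.assoc)
qed


section \<open>The scalars\<close>

text \<open>
  The parameter $q$ enters through $\log q$, which is a formal variable; the scalars are
  the series in it, and $q = \exp(\log q)$. For a number $q$ the composites of the
  operators below would involve genuinely infinite sums of scalars.
\<close>

type_synonym scal = "complex fps"
type_synonym funs = "scal tps"

definition log_q :: scal where "log_q = fps_X"
definition q :: scal where "q = fps_exp 1"

text \<open>
  Formal infinite sums: coefficientwise in $t$ and in $\log q$. Each coefficient has to receive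
  only finitely many contributions, since \<^const>\<open>Sum_any\<close> is 0 otherwise; for the families
  used below this is the case (lemmas \<open>W_hat_summable\<close>, \<open>L_op_summable\<close>, \<open>shift_summable\<close>).
\<close>

definition fsummable :: "('i \<Rightarrow> funs) \<Rightarrow> bool" where
  "fsummable F \<longleftrightarrow> (\<forall>\<gamma> N. finite {i. fps_nth (tcoeff (F i) \<gamma>) N \<noteq> 0})"

definition fsum :: "('i \<Rightarrow> funs) \<Rightarrow> funs" where
  "fsum F = Abs_tps (\<lambda>\<gamma>. Abs_fps (\<lambda>N. Sum_any (\<lambda>i. fps_nth (tcoeff (F i) \<gamma>) N)))"

definition cscale :: "complex \<Rightarrow> funs \<Rightarrow> funs" where
  "cscale c f = tconst (fps_const c) * f"

text \<open>
  $\exp(\sum_i a_i x_i) = \sum_\alpha$ \<open>exp_coeff a \<alpha>\<close> $x^\alpha$ for commuting $x_i$, which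
  will be the times or the derivations.
\<close>

definition exp_coeff :: "(nat \<Rightarrow> 'r::{comm_ring_1,inverse}) \<Rightarrow> expo \<Rightarrow> 'r" where
  "exp_coeff a \<alpha> = (\<Prod>i\<in>keys \<alpha>. a i ^ lookup \<alpha> i * inverse (of_nat (fact (lookup \<alpha> i))))"


section \<open>The vertex operator and the W generators\<close>

text \<open>
  Expansion of functions of $\lambda, \mu$ in powers of $\mu - \lambda$ with coefficients in
  Laurent series in $\lambda$: the outer power series variable is $\mu - \lambda$.
\<close>

definition lam :: "complex fls fps" where "lam = fps_const fls_X"
definition mu :: "complex fls fps" where "mu = lam + fps_X"

text \<open>
  $X(\lambda,\mu) = \sum_{\alpha,\beta}$ \<open>X_coeff \<alpha> \<beta>\<close> $t^\alpha \partial^\beta$.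
\<close>

definition X_coeff :: "expo \<Rightarrow> expo \<Rightarrow> complex fls fps" where
  "X_coeff \<alpha> \<beta> =
     exp_coeff (\<lambda>i. mu ^ Suc i - lam ^ Suc i) \<alpha> *
     exp_coeff (\<lambda>i. (inverse lam ^ Suc i - inverse mu ^ Suc i) * inverse (of_nat (Suc i))) \<beta>"

definition W_hat_coeff :: "nat \<Rightarrow> int \<Rightarrow> expo \<Rightarrow> expo \<Rightarrow> complex" where
  "W_hat_coeff k j \<alpha> \<beta> = fact k * fls_nth (fps_nth (X_coeff \<alpha> \<beta>) k) (- j - int k)"

definition W_hat :: "nat \<Rightarrow> int \<Rightarrow> funs \<Rightarrow> funs" where
  "W_hat k j f = fsum (\<lambda>(\<alpha>, \<beta>). cscale (W_hat_coeff k j \<alpha> \<beta>) (tmono \<alpha> * tderivs \<beta> f))"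

text \<open>\<open>W_gen p s\<close> is $W_s^{(p+1)}$.\<close>

definition W_gen :: "nat \<Rightarrow> nat \<Rightarrow> funs \<Rightarrow> funs" where
  "W_gen p s = W_hat (Suc p) (int s - int p)"

definition L_term :: "nat \<Rightarrow> nat \<Rightarrow> nat \<Rightarrow> nat \<Rightarrow> funs \<Rightarrow> funs" where
  "L_term l k p s f =
     tconst (of_nat l ^ p * (of_nat k * log_q) ^ s * fps_const (1 / (fact p * fact s))) *
     cscale (1 / of_nat (p + 1)) (W_gen p s f)"

definition L_op :: "nat \<Rightarrow> nat \<Rightarrow> funs \<Rightarrow> funs" where
  "L_op l k f = fsum (\<lambda>(p, s). L_term l k p s f)"

definition commutator :: "(funs \<Rightarrow> funs) \<Rightarrow> (funs \<Rightarrow> funs) \<Rightarrow> funs \<Rightarrow> funs" where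
  "commutator A B f = A (B f) - B (A f)"


subsection \<open>Summability\<close>

lemma tcoeff_tconst_mult: "tcoeff (tconst c * f) \<gamma> = c * tcoeff f \<gamma>"
proof -
  have "tcoeff (tconst c * f) \<gamma> =
      (\<Sum>x\<in>{(\<alpha>, \<beta>). \<alpha> + \<beta> = \<gamma>}. if x = (0, \<gamma>) then c * tcoeff f \<gamma> else 0)"
    by (auto simp: times_tps_def tconst_def intro!: sum.cong)
  also have "\<dots> = c * tcoeff f \<gamma>"
    by (subst sum.delta[OF finite_antidiagonal]) auto
  finally show ?thesis .
qed

lemma tcoeff_tmono_mult_nonzero:
  assumes "tcoeff (tmono \<alpha> * f) \<gamma> \<noteq> 0"
  shows "weight \<alpha> \<le> weight \<gamma>"
proof -
  from assms obtain x where "fst x + snd x = \<gamma>" "tcoeff (tmono \<alpha> :: 'a tps) (fst x) \<noteq> 0"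
    unfolding times_tps_def
    by (auto elim!: sum.not_neutral_contains_not_neutral split: prod.splits) fastforce
  then have "\<alpha> + snd x = \<gamma>" by (auto simp: tmono_def split: if_splits)
  then show ?thesis using weight_add[of \<alpha> "snd x"] by auto
qed

lemma exp_coeff_homogeneous:
  fixes H :: "int \<Rightarrow> 'r::{comm_ring_1,inverse} \<Rightarrow> bool"
  assumes one: "H 0 1" and mult: "\<And>c d x y. H c x \<Longrightarrow> H d y \<Longrightarrow> H (c + d) (x * y)"
    and const: "\<And>n. n > 0 \<Longrightarrow> H 0 (inverse (of_nat n))" and a: "\<And>i. H (e * int (Suc i)) (a i)"
  shows "H (e * int (weight \<alpha>)) (exp_coeff a \<alpha>)"
proof -
  have pow: "H (e * int (Suc i) * int n) (a i ^ n)" for i n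
  proof (induction n)
    case (Suc n)
    from mult[OF a[of i] this] show ?case by (simp add: algebra_simps)
  qed (use one in simp)
  have "H (\<Sum>i\<in>A. e * int (Suc i) * int (lookup \<alpha> i))
      (\<Prod>i\<in>A. a i ^ lookup \<alpha> i * inverse (of_nat (fact (lookup \<alpha> i))))" if "finite A" for A
    using that
  proof (induction A)
    case (insert i A)
    have "H (e * int (Suc i) * int (lookup \<alpha> i) + 0)
        (a i ^ lookup \<alpha> i * inverse (of_nat (fact (lookup \<alpha> i))))"
      by (intro mult pow const) simp
    from mult[OF this insert.IH] insert.hyps show ?case by simp
  qed (use one in simp)
  from this[of "keys \<alpha>"] show ?thesis
    unfolding exp_coeff_def weight_def by (simp add: sum_distrib_left algebra_simps)
qed

definition homog :: "int \<Rightarrow> complex fls fps \<Rightarrow> bool" where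
  "homog d F \<longleftrightarrow> (\<forall>k r. fls_nth (fps_nth F k) r \<noteq> 0 \<longrightarrow> r = d - int k)"

definition homog_fls :: "int \<Rightarrow> complex fls \<Rightarrow> bool" where
  "homog_fls d F \<longleftrightarrow> (\<forall>r. fls_nth F r \<noteq> 0 \<longrightarrow> r = d)"

lemma homog_alt: "homog d F \<longleftrightarrow> (\<forall>k. homog_fls (d - int k) (fps_nth F k))"
  by (auto simp: homog_def homog_fls_def)

lemma homog_fls_mult:
  assumes "homog_fls c x" "homog_fls d y"
  shows "homog_fls (c + d) (x * y)"
  unfolding homog_fls_def
proof (intro allI impI)
  fix r assume "fls_nth (x * y) r \<noteq> 0"
  then obtain a where "fls_nth x (a - fls_subdegree y) * fls_nth y (fls_subdegree y + r - a) \<noteq> 0"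
    unfolding fls_times_nth(1) by (rule sum.not_neutral_contains_not_neutral)
  with assms show "r = c + d" by (auto simp: homog_fls_def)
qed

lemma homog_fls_sum: "(\<And>i. i \<in> A \<Longrightarrow> homog_fls d (f i)) \<Longrightarrow> homog_fls d (sum f A)"
  by (induction A rule: infinite_finite_induct) (auto simp: homog_fls_def, metis add_0)

lemma homog_fls_const: "homog_fls 0 (fls_const c)"
  by (auto simp: homog_fls_def)

lemma homog_fls_inverse_of_nat: "homog_fls 0 (inverse (of_nat n))"
  by (metis fls_inverse_const fls_of_nat homog_fls_const)

lemma homog_fls_one: "homog_fls 0 1"
  by (metis fls_const_1 homog_fls_const)

lemma homog_mult:
  assumes "homog c x" "homog d y"
  shows "homog (c + d) (x * y)"
  unfolding homog_alt
proof
  fix k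
  have "homog_fls (c + d - int k) (fps_nth x i * fps_nth y (k - i))" if "i \<in> {0..k}" for i
  proof -
    have "homog_fls ((c - int i) + (d - int (k - i))) (fps_nth x i * fps_nth y (k - i))"
      using assms by (intro homog_fls_mult) (auto simp: homog_alt)
    then show ?thesis using that by (simp add: of_nat_diff algebra_simps)
  qed
  then show "homog_fls (c + d - int k) (fps_nth (x * y) k)"
    unfolding fps_mult_nth by (rule homog_fls_sum)
qed

lemma homog_fps_const: "homog_fls d c \<Longrightarrow> homog d (fps_const c)"
  by (auto simp: homog_def homog_fls_def)

lemma homog_one: "homog 0 1"
  by (metis fps_const_1_eq_1 homog_fls_one homog_fps_const)

lemma homog_inverse_of_nat: "n > 0 \<Longrightarrow> homog 0 (inverse (of_nat n))"
  by (metis fps_const_inverse fps_of_nat homog_fls_inverse_of_nat homog_fps_const)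

lemma homog_diff: "homog d x \<Longrightarrow> homog d y \<Longrightarrow> homog d (x - y)"
  by (auto simp: homog_def) (metis diff_zero)

lemma homog_power: "homog d x \<Longrightarrow> homog (d * int n) (x ^ n)"
proof (induction n)
  case (Suc n)
  then show ?case using homog_mult[of d x "d * int n" "x ^ n"] by (simp add: algebra_simps)
qed (simp add: homog_one)

lemma homog_lam: "homog 1 lam"
  by (auto simp: lam_def homog_fls_def intro!: homog_fps_const split: if_splits)

lemma homog_mu: "homog 1 mu"
  by (auto simp: homog_def mu_def lam_def fps_X_def split: if_splits)

lemma homog_inverse_lam: "homog (-1) (inverse lam)"
proof -
  have "inverse lam = fps_const fls_X_inv"
    by (simp add: lam_def fps_const_inverse fls_inverse_X)
  then show ?thesis
    by (auto simp: homog_fls_def intro!: homog_fps_const split: if_splits)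
qed

lemma homog_inverse_mu: "homog (-1) (inverse mu)"
proof -
  define G where "G = Abs_fps (\<lambda>k. (-1) ^ k * fls_X_intpow (- 1 - int k) :: complex fls)"
  have "mu * G = 1"
  proof (rule fps_ext)
    fix k show "fps_nth (mu * G) k = fps_nth 1 k"
      by (cases k) (simp_all add: mu_def lam_def G_def distrib_right
          fls_X_conv_shift_1 fls_shifted_times_simps algebra_simps)
  qed
  then have "inverse mu = G" by (simp add: fps_inverse_unique)
  moreover have "homog (-1) G"
    unfolding homog_alt
  proof
    fix k
    have "homog_fls (0 + (- 1 - int k)) (fls_const ((-1) ^ k) * fls_X_intpow (- 1 - int k))"
      by (rule homog_fls_mult[OF homog_fls_const]) (auto simp: homog_fls_def)
    moreover have "fls_const ((-1) ^ k) = ((-1) ^ k :: complex fls)"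
      by (cases "even k") (simp_all add: fls_const_uminus[symmetric])
    ultimately show "homog_fls (- 1 - int k) (fps_nth G k)"
      by (simp add: G_def)
  qed
  ultimately show ?thesis by simp
qed

lemma homog_X_coeff: "homog (int (weight \<alpha>) - int (weight \<beta>)) (X_coeff \<alpha> \<beta>)"
proof -
  have 1: "homog (1 * int (weight \<alpha>)) (exp_coeff (\<lambda>i. mu ^ Suc i - lam ^ Suc i) \<alpha>)"
  proof (rule exp_coeff_homogeneous)
    show "homog (1 * int (Suc i)) (mu ^ Suc i - lam ^ Suc i)" for i
      by (intro homog_diff homog_power homog_mu homog_lam)
  qed (auto intro: homog_one homog_mult homog_inverse_of_nat)
  have 2: "homog ((-1) * int (weight \<beta>)) (exp_coeff
      (\<lambda>i. (inverse lam ^ Suc i - inverse mu ^ Suc i) * inverse (of_nat (Suc i))) \<beta>)"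
  proof (rule exp_coeff_homogeneous)
    fix i
    have "homog ((-1) * int (Suc i) + 0)
        ((inverse lam ^ Suc i - inverse mu ^ Suc i) * inverse (of_nat (Suc i)))"
      by (intro homog_mult homog_diff homog_power homog_inverse_lam homog_inverse_mu
          homog_inverse_of_nat) simp
    then show "homog ((-1) * int (Suc i))
        ((inverse lam ^ Suc i - inverse mu ^ Suc i) * inverse (of_nat (Suc i)))"
      by (simp del: power_Suc of_nat_Suc)
  qed (auto intro: homog_one homog_mult homog_inverse_of_nat)
  from homog_mult[OF 1 2] show ?thesis by (simp add: X_coeff_def)
qed

lemma W_hat_coeff_nonzero:
  "W_hat_coeff k j \<alpha> \<beta> \<noteq> 0 \<Longrightarrow> int (weight \<beta>) = int (weight \<alpha>) + j"
  using homog_X_coeff[of \<alpha> \<beta>] by (fastforce simp: W_hat_coeff_def homog_def)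

lemma W_hat_term_nonzero:
  assumes "tcoeff (cscale (W_hat_coeff k j \<alpha> \<beta>) (tmono \<alpha> * tderivs \<beta> f)) \<gamma> \<noteq> 0"
  shows "weight \<alpha> \<le> weight \<gamma>" "int (weight \<beta>) = int (weight \<alpha>) + j"
  using assms
  by (auto simp: cscale_def tcoeff_tconst_mult intro: tcoeff_tmono_mult_nonzero W_hat_coeff_nonzero)

lemma W_hat_summable:
  "fsummable (\<lambda>(\<alpha>, \<beta>). cscale (W_hat_coeff k j \<alpha> \<beta>) (tmono \<alpha> * tderivs \<beta> f))"
  unfolding fsummable_def
proof (intro allI, rule finite_subset)
  fix \<gamma> N
  show "finite ({\<alpha>. weight \<alpha> \<le> weight \<gamma>} \<times> {\<alpha>. weight \<alpha> \<le> weight \<gamma> + nat \<bar>j\<bar>})"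
    by (intro finite_cartesian_product finite_weight_le)
  show "{i. fps_nth (tcoeff (case i of (\<alpha>, \<beta>) \<Rightarrow>
      cscale (W_hat_coeff k j \<alpha> \<beta>) (tmono \<alpha> * tderivs \<beta> f)) \<gamma>) N \<noteq> 0}
      \<subseteq> {\<alpha>. weight \<alpha> \<le> weight \<gamma>} \<times> {\<alpha>. weight \<alpha> \<le> weight \<gamma> + nat \<bar>j\<bar>}"
  proof clarify
    fix \<alpha> \<beta> assume "fps_nth (tcoeff (cscale (W_hat_coeff k j \<alpha> \<beta>) (tmono \<alpha> * tderivs \<beta> f)) \<gamma>) N \<noteq> 0"
    then have "tcoeff (cscale (W_hat_coeff k j \<alpha> \<beta>) (tmono \<alpha> * tderivs \<beta> f)) \<gamma> \<noteq> 0" by auto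
    from W_hat_term_nonzero[OF this]
    show "\<alpha> \<in> {\<alpha>. weight \<alpha> \<le> weight \<gamma>} \<and> \<beta> \<in> {\<alpha>. weight \<alpha> \<le> weight \<gamma> + nat \<bar>j\<bar>}"
      by auto
  qed
qed

lemma W_gen_nonzero:
  assumes "tcoeff (W_gen p s f) \<gamma> \<noteq> 0"
  shows "p \<le> s + weight \<gamma>"
proof (rule ccontr)
  assume "\<not> ?thesis"
  then have "tcoeff (cscale (W_hat_coeff (Suc p) (int s - int p) \<alpha> \<beta>) (tmono \<alpha> * tderivs \<beta> f)) \<gamma> = 0"
    for \<alpha> \<beta>
    using W_hat_term_nonzero[of "Suc p" "int s - int p" \<alpha> \<beta> f \<gamma>] by linarith
  then have "tcoeff (W_gen p s f) \<gamma> = 0"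
    by (auto simp: W_gen_def W_hat_def fsum_def case_prod_unfold intro!: fps_ext)
  with assms show False by simp
qed

lemma L_op_summable: "fsummable (\<lambda>(p, s). L_term l k p s f)"
  unfolding fsummable_def
proof (intro allI, rule finite_subset)
  fix \<gamma> N
  show "finite ({..N + weight \<gamma>} \<times> {..N})" by simp
  show "{i. fps_nth (tcoeff (case i of (p, s) \<Rightarrow> L_term l k p s f) \<gamma>) N \<noteq> 0}
      \<subseteq> {..N + weight \<gamma>} \<times> {..N}"
  proof clarify
    fix p s assume nz: "fps_nth (tcoeff (L_term l k p s f) \<gamma>) N \<noteq> 0"
    have "tcoeff (L_term l k p s f) \<gamma> = fps_X ^ s * (of_nat l ^ p * of_nat k ^ s *
        fps_const (1 / (fact p * fact s)) * fps_const (1 / of_nat (p + 1)) * tcoeff (W_gen p s f) \<gamma>)"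
      unfolding L_term_def cscale_def tcoeff_tconst_mult
      by (simp add: log_q_def power_mult_distrib mult_ac)
    with nz have "s \<le> N" and "tcoeff (W_gen p s f) \<gamma> \<noteq> 0"
      by (auto simp: fps_X_power_mult_nth not_less split: if_splits)
    with W_gen_nonzero[of p s f \<gamma>] show "p \<in> {..N + weight \<gamma>} \<and> s \<in> {..N}" by auto
  qed
qed


section \<open>Tau functions of the KP hierarchy\<close>

type_synonym ratfuns = "funs fract"

definition rderiv :: "nat \<Rightarrow> ratfuns \<Rightarrow> ratfuns" where
  "rderiv i x = (THE y. \<exists>a b. b \<noteq> 0 \<and> x = Fract a b \<and>
     y = Fract (tderiv i a * b - a * tderiv i b) (b * b))"

lemma rderiv_Fract:
  assumes "b \<noteq> 0"
  shows "rderiv i (Fract a b) = Fract (tderiv i a * b - a * tderiv i b) (b * b)"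
  unfolding rderiv_def
proof (rule the_equality)
  fix y assume "\<exists>a' b'. b' \<noteq> 0 \<and> Fract a b = Fract a' b' \<and>
     y = Fract (tderiv i a' * b' - a' * tderiv i b') (b' * b')"
  then obtain a' b' where b': "b' \<noteq> 0" and eq: "a * b' = a' * b"
    and y: "y = Fract (tderiv i a' * b' - a' * tderiv i b') (b' * b')"
    using assms by (auto simp: eq_fract)
  have d: "tderiv i a * b' + a * tderiv i b' = tderiv i a' * b + a' * tderiv i b"
    using arg_cong[OF eq, of "tderiv i"] by (simp add: tderiv_mult)
  have "(tderiv i a' * b' - a' * tderiv i b') * (b * b) =
        (tderiv i a * b - a * tderiv i b) * (b' * b')"
    using d eq by algebra
  then show "y = Fract (tderiv i a * b - a * tderiv i b) (b * b)"
    using assms b' by (simp add: y eq_fract)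
qed (use assms in blast)

text \<open>
  A function of type \<^typ>\<open>int \<Rightarrow> ratfuns\<close> that vanishes at all large integers encodes
  two things: a pseudo-differential operator $\sum_r A_r \partial^r$, where
  $\partial = \partial/\partial t_1$, and a formal wave function
  $(\sum_r w_r \lambda^r)\, e^{\sum_k t_k \lambda^k}$. As
  $\partial^m (b \lambda^r e^{\sum_k t_k \lambda^k}) =
   \sum_{j \ge 0} {m \choose j} \partial^j(b)\, \lambda^{m+r-j} e^{\sum_k t_k \lambda^k}$
  and $\partial^m b \partial^r = \sum_{j \ge 0} {m \choose j} \partial^j(b)\, \partial^{m+r-j}$
  for all integers $m$, the product of two operators and the action of an operator on a
  wave function are given by the same formula.
\<close>

definition psd_mult :: "(int \<Rightarrow> ratfuns) \<Rightarrow> (int \<Rightarrow> ratfuns) \<Rightarrow> int \<Rightarrow> ratfuns" where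
  "psd_mult A B r = Sum_any (\<lambda>(m :: int, j :: nat).
     Fract (tconst (fps_const (of_int m gchoose j))) 1 * A m * (rderiv 0 ^^ j) (B (r - m + int j)))"

primrec psd_power :: "(int \<Rightarrow> ratfuns) \<Rightarrow> nat \<Rightarrow> int \<Rightarrow> ratfuns" where
  "psd_power A 0 = (\<lambda>r. if r = 0 then 1 else 0)"
| "psd_power A (Suc n) = psd_mult A (psd_power A n)"

definition psd_plus :: "(int \<Rightarrow> ratfuns) \<Rightarrow> int \<Rightarrow> ratfuns" where
  "psd_plus A r = (if r \<ge> 0 then A r else 0)"

text \<open>Multiplication by $\lambda$ and $\partial/\partial t_{i+1}$ on wave functions.\<close>

definition wave_lambda :: "(int \<Rightarrow> ratfuns) \<Rightarrow> int \<Rightarrow> ratfuns" where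
  "wave_lambda w r = w (r - 1)"

definition wave_deriv :: "nat \<Rightarrow> (int \<Rightarrow> ratfuns) \<Rightarrow> int \<Rightarrow> ratfuns" where
  "wave_deriv i w r = rderiv i (w r) + w (r - int (Suc i))"

definition KP_wave :: "(int \<Rightarrow> ratfuns) \<Rightarrow> bool" where
  "KP_wave w \<longleftrightarrow> (\<exists>L. L 1 = 1 \<and> L 0 = 0 \<and> (\<forall>r>1. L r = 0) \<and>
     psd_mult L w = wave_lambda w \<and>
     (\<forall>i. wave_deriv i w = psd_mult (psd_plus (psd_power L (Suc i))) w))"

text \<open>The coefficient of $\lambda^r$ in $e^\eta f$.\<close>

definition shift_coeff :: "int \<Rightarrow> expo \<Rightarrow> complex" where
  "shift_coeff r \<beta> =
     fls_nth (exp_coeff (\<lambda>i. - (inverse fls_X ^ Suc i) * inverse (of_nat (Suc i))) \<beta>) r"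

definition exp_eta :: "funs \<Rightarrow> int \<Rightarrow> funs" where
  "exp_eta f r = fsum (\<lambda>\<beta>. cscale (shift_coeff r \<beta>) (tderivs \<beta> f))"

lemma shift_coeff_nonzero:
  assumes "shift_coeff r \<beta> \<noteq> 0"
  shows "r = - int (weight \<beta>)"
proof -
  have X: "homog_fls ((-1) * int n) (inverse fls_X ^ n)" for n
  proof (induction n)
    case (Suc n)
    have "homog_fls (-1) (inverse fls_X)"
      by (auto simp: homog_fls_def fls_inverse_X split: if_splits)
    from homog_fls_mult[OF this Suc] show ?case by simp
  qed (simp add: homog_fls_one)
  have "homog_fls ((-1) * int (weight \<beta>))
      (exp_coeff (\<lambda>i. - (inverse fls_X ^ Suc i) * inverse (of_nat (Suc i))) \<beta>)"
  proof (rule exp_coeff_homogeneous)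
    fix i
    have "homog_fls ((-1) * int (Suc i)) (- (inverse fls_X ^ Suc i))"
      using X[of "Suc i"] by (simp add: homog_fls_def del: power_Suc)
    from homog_fls_mult[OF this homog_fls_inverse_of_nat[of "Suc i"]]
    show "homog_fls ((-1) * int (Suc i)) (- (inverse fls_X ^ Suc i) * inverse (of_nat (Suc i)))"
      by (simp del: power_Suc of_nat_Suc)
  qed (auto intro: homog_fls_one homog_fls_mult homog_fls_inverse_of_nat)
  with assms show ?thesis by (auto simp: homog_fls_def shift_coeff_def simp del: power_Suc of_nat_Suc)
qed

lemma shift_summable: "fsummable (\<lambda>\<beta>. cscale (shift_coeff r \<beta>) (tderivs \<beta> f))"
  unfolding fsummable_def
proof (intro allI, rule finite_subset)
  show "finite {\<beta>. weight \<beta> \<le> nat (- r)}" by (rule finite_weight_le)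
  show "{\<beta>. fps_nth (tcoeff (cscale (shift_coeff r \<beta>) (tderivs \<beta> f)) \<gamma>) N \<noteq> 0}
      \<subseteq> {\<beta>. weight \<beta> \<le> nat (- r)}" for \<gamma> N
    using shift_coeff_nonzero[of r] by (force simp: cscale_def tcoeff_tconst_mult)
qed

definition KP_tau :: "funs \<Rightarrow> bool" where
  "KP_tau \<tau> \<longleftrightarrow> \<tau> \<noteq> 0 \<and> KP_wave (\<lambda>r. Fract (exp_eta \<tau> r) \<tau>)"

lemma KP_tau_one: "KP_tau 1"
proof -
  define w :: "int \<Rightarrow> ratfuns" where "w = (\<lambda>r. if r = 0 then 1 else 0)"
  define L :: "int \<Rightarrow> ratfuns" where "L = (\<lambda>r. if r = 1 then 1 else 0)"
  have pos: "\<beta> = 0" if "\<gamma> + \<beta> = 0" for \<gamma> \<beta> :: expo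
  proof (rule poly_mapping_eqI)
    fix i
    show "lookup \<beta> i = lookup 0 i"
      using arg_cong[OF that, of "\<lambda>\<delta>. lookup \<delta> i"] by (simp add: lookup_add)
  qed
  have t01: "tconst 1 = (1 :: funs)" "tconst 0 = (0 :: funs)"
    by (simp_all add: tconst_def one_tps_def zero_tps_def)
  have "tcoeff (exp_eta 1 r) \<gamma> = tcoeff (if r = 0 then 1 else 0) \<gamma>" for r \<gamma>
  proof (rule fps_ext)
    fix N
    let ?g = "\<lambda>\<beta>. fps_nth (tcoeff (cscale (shift_coeff r \<beta>) (tderivs \<beta> 1)) \<gamma>) N"
    have "{\<beta>. ?g \<beta> \<noteq> 0} \<subseteq> {0}"
      using pos by (auto simp: cscale_def tcoeff_tconst_mult tderivs_def one_tps_def)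
    then have "Sum_any ?g = ?g 0"
      by (subst Sum_any.expand_superset[of "{0}"]) auto
    then show "fps_nth (tcoeff (exp_eta 1 r) \<gamma>) N = fps_nth (tcoeff (if r = 0 then 1 else 0) \<gamma>) N"
      by (simp add: exp_eta_def fsum_def cscale_def tcoeff_tconst_mult tderivs_zero
          shift_coeff_def exp_coeff_def t01)
  qed
  then have "(\<lambda>r. Fract (exp_eta 1 r) 1) = w"
    by (auto simp: w_def One_fract_def Zero_fract_def fun_eq_iff intro!: arg_cong2[of _ _ _ _ Fract] tps_eqI)
  moreover have d: "rderiv i 0 = 0" "rderiv i 1 = 0" for i
  proof -
    have "\<gamma> + Poly_Mapping.single i 1 \<noteq> 0" for \<gamma> :: expo
    proof
      assume "\<gamma> + Poly_Mapping.single i 1 = 0"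
      then have "lookup (\<gamma> + Poly_Mapping.single i 1) i = 0" by simp
      then show False by (simp add: lookup_add)
    qed
    then have "tderiv i 0 = (0 :: funs)" "tderiv i 1 = (0 :: funs)"
      by (auto intro!: tps_eqI simp: tderiv_def zero_tps_def one_tps_def)
    then show "rderiv i 0 = 0" "rderiv i 1 = 0"
      by (simp_all add: rderiv_Fract Zero_fract_def One_fract_def)
  qed
  have mult_L: "psd_mult (\<lambda>r. if r = int n then 1 else 0) (\<lambda>r. if r = c then 1 else 0) =
      (\<lambda>r. if r = c + int n then 1 else 0)" for n c
  proof
    fix r
    let ?B = "\<lambda>r. if r = c then 1 else (0 :: ratfuns)"
    let ?g = "\<lambda>(m :: int, j :: nat). Fract (tconst (fps_const (of_int m gchoose j))) 1 *
      (if m = int n then 1 else 0) * (rderiv 0 ^^ j) (?B (r - m + int j))"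
    have z: "(rderiv 0 ^^ j) x = 0" if "j > 0" "x = 0 \<or> x = 1" for j x
      using that
    proof (induction j)
      case (Suc j)
      then show ?case by (cases j) (auto simp: d)
    qed simp
    have "{x. ?g x \<noteq> 0} \<subseteq> {(int n, 0)}"
    proof clarify
      fix m j assume nz: "Fract (tconst (fps_const (of_int m gchoose j))) 1 *
        (if m = int n then 1 else 0) * (rderiv 0 ^^ j) (?B (r - m + int j)) \<noteq> 0"
      have "j = 0"
      proof (rule ccontr)
        assume "j \<noteq> 0"
        then have "(rderiv 0 ^^ j) (?B (r - m + int j)) = 0" by (intro z) auto
        with nz show False by simp
      qed
      with nz show "m = int n \<and> j = 0" by (auto split: if_splits)
    qed
    then have "Sum_any ?g = ?g (int n, 0)"
      by (subst Sum_any.expand_superset[of "{(int n, 0)}"]) auto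
    then show "psd_mult (\<lambda>r. if r = int n then 1 else 0) ?B r = (if r = c + int n then 1 else 0)"
      by (auto simp: psd_mult_def t01 One_fract_def[symmetric])
  qed
  have power: "psd_power L n = (\<lambda>r. if r = int n then 1 else 0)" for n
  proof (induction n)
    case (Suc n)
    then show ?case using mult_L[of 1 "int n"] by (simp add: L_def add.commute)
  qed simp
  have "KP_wave w"
    unfolding KP_wave_def
  proof (intro exI[of _ L] conjI allI impI)
    show "psd_mult L w = wave_lambda w"
      using mult_L[of 1 0] by (auto simp: L_def w_def wave_lambda_def)
    fix i
    have "psd_plus (psd_power L (Suc i)) = (\<lambda>r. if r = int (Suc i) then 1 else 0)"
      unfolding power by (auto simp: psd_plus_def)
    then show "wave_deriv i w = psd_mult (psd_plus (psd_power L (Suc i))) w"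
      using mult_L[of "Suc i" 0] by (auto simp: w_def wave_deriv_def d)
  qed (auto simp: L_def)
  ultimately show ?thesis by (simp add: KP_tau_def)
qed

end

(*
  Operators that are linear over the scalars and continuous are determined by their values on the
  exponentials E = exp (sum_i t_i (x_1^i + ... + x_N^i - y_1^i - ... - y_N^i)), since polynomials in
  a point are determined by infinitely many values, and complete homogeneous symmetric functions
  generate all polynomials in the times.

  On E the vertex operator X(lambda, lambda + l) acts by a rational function of lambda with simple
  poles times another such exponential. Taking residues, L_{l,k} sends E to a finite sum over its
  points: x_a is replaced by x_a + l with the factor q^(k x_a), or y_a by y_a - l with the factor
  -q^(k (y_a - l)), both times a quotient of Cauchy determinants. So, up to conjugation by a
  Cauchy determinant, L_{l,k} is a sum of one-particle operators: in the commutator the terms that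
  move two different points cancel, and those that move one point twice give the relation.
*)

theory Submission
  imports Defs
begin

subsection \<open>Coefficients and constants\<close>

text \<open>The operators are infinite series of differential operators of unbounded order, so
  composing them directly would mean reordering infinitely many terms. On an exponential every
  derivation acts as a scalar; the obstacle is then to take residues without analysis. This is done
  with power series in u = 1/lambda. The factor l^p turns the expansion in mu - lambda into its
  value at mu = lambda + l. Homogeneity ties the power of u to the weights of the exponents, so the
  sum over all \<beta> becomes the value, at times 1, of an exponential of series in u: a product of
  linear factors in u and inverses of such. Multiplied by 1 / (1 - d u), a polynomial in u ends up
  with coefficients growing like d^s, and with (k log q)^s / s! these add up to q^(k d). As log q is
  a formal variable, continuity means respecting one filtration, by weight in the times plus order
  in log q. Modulo each of its steps an exponential depends polynomially on each of its
  points.\<close>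

lemma tcoeff_zero [simp]: "tcoeff 0 \<gamma> = 0"
  and tcoeff_add [simp]: "tcoeff (f + g) \<gamma> = tcoeff f \<gamma> + tcoeff g \<gamma>"
  and tcoeff_diff [simp]: "tcoeff (f - g) \<gamma> = tcoeff f \<gamma> - tcoeff g \<gamma>"
  by (simp_all add: zero_tps_def plus_tps_def minus_tps_def)

lemma tcoeff_one: "tcoeff 1 \<gamma> = (if \<gamma> = 0 then 1 else 0)"
  by (simp add: one_tps_def)

lemma tcoeff_sum [simp]: "tcoeff (sum F A) \<gamma> = (\<Sum>i\<in>A. tcoeff (F i) \<gamma>)"
  by (induction A rule: infinite_finite_induct) auto

lemma tcoeff_mult: "tcoeff (f * g) \<gamma> = (\<Sum>(\<alpha>, \<beta>) | \<alpha> + \<beta> = \<gamma>. tcoeff f \<alpha> * tcoeff g \<beta>)"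
  by (simp add: times_tps_def)

lemma tcoeff_tconst: "tcoeff (tconst c) \<gamma> = (if \<gamma> = 0 then c else 0)"
  by (simp add: tconst_def)

lemma tconst_simps:
  "tconst 0 = 0" "tconst 1 = 1" "tconst (a + b) = tconst a + tconst b"
  "tconst (a - b) = tconst a - tconst b" "tconst (a * b) = tconst a * tconst b"
  by (rule tps_eqI; simp add: tcoeff_tconst tcoeff_one tcoeff_tconst_mult)+

lemma expo_add_eq_0: "\<alpha> + \<beta> = 0 \<longleftrightarrow> \<alpha> = 0 \<and> \<beta> = (0 :: expo)"
proof
  assume "\<alpha> + \<beta> = 0"
  then have "lookup \<alpha> i + lookup \<beta> i = 0" for i by (metis lookup_add lookup_zero)
  then show "\<alpha> = 0 \<and> \<beta> = 0" by (auto intro!: poly_mapping_eqI)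
qed simp

lemma weight_eq_0: "weight \<alpha> = 0 \<longleftrightarrow> \<alpha> = 0"
proof
  assume "weight \<alpha> = 0"
  then have "lookup \<alpha> i = 0" for i using weight_ge[of i \<alpha>] by simp
  then show "\<alpha> = 0" by (auto intro!: poly_mapping_eqI)
qed simp

lemma weight_single: "weight (Poly_Mapping.single i n) = Suc i * n"
  by (subst weight_superset[of "{i}"]) auto

lemma expo_induct [case_names zero step]:
  fixes \<alpha> :: expo
  assumes "P 0" "\<And>\<alpha> i. P \<alpha> \<Longrightarrow> P (Poly_Mapping.single i 1 + \<alpha>)"
  shows "P \<alpha>"
proof (induction "weight \<alpha>" arbitrary: \<alpha> rule: less_induct)
  case less
  show ?case
  proof (cases "\<alpha> = 0")
    case False
    then obtain i where i: "lookup \<alpha> i \<noteq> 0"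
      by (metis lookup_zero poly_mapping_eqI)
    define \<beta> where "\<beta> = \<alpha> - Poly_Mapping.single i 1"
    have \<alpha>: "\<alpha> = Poly_Mapping.single i 1 + \<beta>"
      using i by (intro poly_mapping_eqI)
        (auto simp: \<beta>_def lookup_add lookup_minus lookup_single when_def)
    then have "weight \<beta> < weight \<alpha>" by (simp add: weight_add weight_single)
    with less have "P \<beta>" by simp
    then show ?thesis unfolding \<alpha> by (rule assms)
  qed (simp add: assms)
qed

lemma tcoeff_zero_mult: "tcoeff (f * g) 0 = tcoeff f 0 * tcoeff g 0"
proof -
  have "{(\<alpha>, \<beta>). \<alpha> + \<beta> = (0 :: expo)} = {(0, 0)}" by (auto simp: expo_add_eq_0)
  then show ?thesis by (simp add: tcoeff_mult)
qed

subsection \<open>Exponentials of linear forms\<close>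

lemma exp_coeff_superset_fps:
  assumes "finite A" "keys \<alpha> \<subseteq> A"
  shows "exp_coeff a \<alpha> =
    (\<Prod>i\<in>A. a i ^ lookup \<alpha> i * inverse (of_nat (fact (lookup \<alpha> i)) :: 'r::field fps))"
  unfolding exp_coeff_def
  by (rule prod.mono_neutral_left) (use assms in \<open>auto simp: in_keys_iff\<close>)

lemma inverse_of_nat_scal: "inverse (of_nat n :: scal) = fps_const (inverse (of_nat n))"
  by (metis fps_const_inverse fps_of_nat)

lemma exp_coeff_zero [simp]: "exp_coeff a 0 = 1"
  by (simp add: exp_coeff_def)

text \<open>For scalars, the eigenvalue of \<open>tderivs \<beta>\<close> on the exponential
  \<open>expT a\<close>; unlike \<open>exp_coeff\<close> it carries no factorials.\<close>

definition mpow :: "(nat \<Rightarrow> 'r::comm_ring_1) \<Rightarrow> expo \<Rightarrow> 'r" where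
  "mpow a \<beta> = (\<Prod>i\<in>keys \<beta>. a i ^ lookup \<beta> i)"

lemma mpow_superset:
  assumes "finite A" "keys \<alpha> \<subseteq> A"
  shows "mpow a \<alpha> = (\<Prod>i\<in>A. a i ^ lookup \<alpha> i)"
  unfolding mpow_def
  by (rule prod.mono_neutral_left) (use assms in \<open>auto simp: in_keys_iff\<close>)

lemma mpow_zero [simp]: "mpow a 0 = 1"
  by (simp add: mpow_def)

lemma keys_step: "keys (Poly_Mapping.single i 1 + \<beta>) \<subseteq> insert i (keys (\<beta> :: expo))"
  by (auto simp: in_keys_iff lookup_add lookup_single when_def split: if_splits)

lemma mpow_step: "mpow a (Poly_Mapping.single i 1 + \<beta>) = a i * mpow a \<beta>"
proof -
  let ?A = "insert i (keys \<beta>)"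
  have "mpow a (Poly_Mapping.single i 1 + \<beta>) =
      (\<Prod>j\<in>?A. a j ^ lookup (Poly_Mapping.single i 1 + \<beta>) j)"
    by (rule mpow_superset) (use keys_step[of i \<beta>] in auto)
  also have "\<dots> = (\<Prod>j\<in>?A. a j ^ lookup (Poly_Mapping.single i 1) j) *
      (\<Prod>j\<in>?A. a j ^ lookup \<beta> j)"
    by (simp only: lookup_add power_add prod.distrib)
  also have "(\<Prod>j\<in>?A. a j ^ lookup (Poly_Mapping.single i 1) j) = (\<Prod>j\<in>?A. if j = i then a j else 1)"
    by (rule prod.cong) (auto simp: lookup_single when_def)
  also have "\<dots> = a i" by simp
  also have "(\<Prod>j\<in>?A. a j ^ lookup \<beta> j) = mpow a \<beta>"
    by (rule mpow_superset[symmetric]) auto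
  finally show ?thesis .
qed

lemma exp_coeff_mult: "exp_coeff (\<lambda>i. a i * b i) \<beta> = mpow a \<beta> * exp_coeff b \<beta>"
  by (simp add: exp_coeff_def mpow_def power_mult_distrib prod.distrib mult.assoc)

text \<open>The differential equation of the exponential, read off at one coefficient. Keeping the
  integer factor on the left avoids division of power series. The recursion drives
  \<open>expT_unique\<close>, \<open>exp_coeff_small\<close> and the count of cycle types.\<close>

lemma exp_coeff_step:
  "of_nat (Suc (lookup \<gamma> i)) * exp_coeff y (Poly_Mapping.single i 1 + \<gamma>) = y i * (exp_coeff y \<gamma> :: scal)"
proof -
  let ?A = "insert i (keys \<gamma>)" and ?\<delta> = "Poly_Mapping.single i 1 + \<gamma>"
  let ?t = "\<lambda>\<gamma> j. y j ^ lookup \<gamma> j * inverse (of_nat (fact (lookup \<gamma> j)))"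
  have "exp_coeff y ?\<delta> = (\<Prod>j\<in>?A. ?t ?\<delta> j)"
    by (rule exp_coeff_superset_fps) (use keys_step[of i \<gamma>] in auto)
  also have "\<dots> = ?t ?\<delta> i * (\<Prod>j\<in>?A - {i}. ?t ?\<delta> j)"
    by (subst prod.remove[of _ i]) auto
  also have "(\<Prod>j\<in>?A - {i}. ?t ?\<delta> j) = (\<Prod>j\<in>?A - {i}. ?t \<gamma> j)"
    by (rule prod.cong) (auto simp: lookup_add lookup_single)
  finally have 1: "exp_coeff y ?\<delta> = ?t ?\<delta> i * (\<Prod>j\<in>?A - {i}. ?t \<gamma> j)" .
  have "exp_coeff y \<gamma> = (\<Prod>j\<in>?A. ?t \<gamma> j)"
    by (rule exp_coeff_superset_fps) auto
  also have "\<dots> = ?t \<gamma> i * (\<Prod>j\<in>?A - {i}. ?t \<gamma> j)"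
    by (subst prod.remove[of _ i]) auto
  finally have 2: "exp_coeff y \<gamma> = ?t \<gamma> i * (\<Prod>j\<in>?A - {i}. ?t \<gamma> j)" .
  have "of_nat (Suc n) * inverse (of_nat (fact (Suc n)) :: scal) = inverse (of_nat (fact n))" for n
  proof -
    have "(of_nat (Suc n) :: complex) * inverse (of_nat (fact (Suc n))) = inverse (of_nat (fact n))"
      by (simp only: fact_Suc of_nat_mult of_nat_id inverse_mult_distrib) (simp del: of_nat_Suc)
    then show ?thesis
      by (metis fps_of_nat fps_const_mult inverse_of_nat_scal)
  qed
  then have "of_nat (Suc (lookup \<gamma> i)) * ?t ?\<delta> i = y i * ?t \<gamma> i"
    by (simp add: lookup_add mult.left_commute del: of_nat_Suc fact_Suc of_nat_fact)
  then show ?thesis unfolding 1 2 by (simp only: mult.assoc[symmetric])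
qed

definition expT :: "(nat \<Rightarrow> scal) \<Rightarrow> funs" where
  "expT y = Abs_tps (exp_coeff y)"

lemma tcoeff_expT [simp]: "tcoeff (expT y) \<gamma> = exp_coeff y \<gamma>"
  by (simp add: expT_def)

lemma tderiv_expT: "tderiv i (expT y) = tconst (y i) * expT y"
  by (rule tps_eqI) (simp add: tderiv_def tcoeff_tconst_mult add.commute[of _ "Poly_Mapping.single i _"]
      exp_coeff_step[unfolded One_nat_def] del: of_nat_Suc)

lemma tderiv_tconst_mult: "tderiv i (tconst c * f) = tconst c * tderiv i f"
  by (rule tps_eqI) (simp add: tderiv_def tcoeff_tconst_mult mult.left_commute)

text \<open>The equations determine all coefficients from the constant one, since positive integers
  can be cancelled among the scalars. This yields \<open>expT_add\<close> without multinomial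
  sums.\<close>

lemma expT_unique:
  assumes "\<And>i. tderiv i F = tconst (y i) * F" "tcoeff F 0 = 1"
  shows "F = expT y"
proof (rule tps_eqI)
  fix \<gamma>
  show "tcoeff F \<gamma> = tcoeff (expT y) \<gamma>"
  proof (induction \<gamma> rule: expo_induct)
    case zero
    then show ?case by (simp add: assms)
  next
    case (step \<gamma> i)
    have "of_nat (Suc (lookup \<gamma> i)) * tcoeff F (Poly_Mapping.single i 1 + \<gamma>) = y i * tcoeff F \<gamma>"
      using arg_cong[OF assms(1)[of i], of "\<lambda>g. tcoeff g \<gamma>"]
      by (simp add: tderiv_def tcoeff_tconst_mult add.commute del: of_nat_Suc)
    also have "\<dots> = of_nat (Suc (lookup \<gamma> i)) * exp_coeff y (Poly_Mapping.single i 1 + \<gamma>)"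
      by (simp only: exp_coeff_step step tcoeff_expT)
    finally show ?case by (simp del: of_nat_Suc)
  qed
qed

lemma expT_add: "expT (\<lambda>i. x i + y i) = expT x * expT y"
  by (rule expT_unique[symmetric])
    (auto simp: tderiv_mult tderiv_expT tconst_simps algebra_simps tcoeff_zero_mult)

lemma expT_0: "expT (\<lambda>i. 0) = 1"
proof (rule expT_unique[symmetric])
  fix i :: nat
  have "Poly_Mapping.single i (Suc 0) \<noteq> 0"
    by (metis lookup_single_eq lookup_zero nat.distinct(1))
  then show "tderiv i 1 = tconst 0 * (1 :: funs)"
    by (auto intro!: tps_eqI simp: tderiv_def tcoeff_one tconst_simps expo_add_eq_0)
qed (simp add: tcoeff_one)

lemma tderivs_expT: "tderivs \<beta> (expT y) = tconst (mpow y \<beta>) * expT y"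
  by (induction \<beta> rule: expo_induct)
    (simp_all only: tderivs_zero tderivs_step tderiv_tconst_mult tderiv_expT mpow_step mpow_zero
       tconst_simps mult_1 mult.assoc mult.left_commute)

subsection \<open>Coefficients of the vertex operator\<close>

text \<open>
  A homogeneous series of degree \<open>d\<close> in $\lambda$ and $\mu - \lambda$ is
  $\lambda^d f((\mu - \lambda) / \lambda)$.
\<close>

definition homogenize :: "int \<Rightarrow> complex fps \<Rightarrow> complex fls fps" where
  "homogenize d f = Abs_fps (\<lambda>k. fls_const (fps_nth f k) * fls_X_intpow (d - int k))"

lemma homogenize_nth: "fls_nth (fps_nth (homogenize d f) k) r = (if r = d - int k then fps_nth f k else 0)"
  by (simp add: homogenize_def)

lemma homogenize_mult: "homogenize c f * homogenize d g = homogenize (c + d) (f * g)"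
proof (rule fps_ext)
  fix k
  have "fps_nth (homogenize c f * homogenize d g) k =
      (\<Sum>i=0..k. fls_const (fps_nth f i * fps_nth g (k - i)) * fls_X_intpow (c + d - int k))"
    unfolding fps_mult_nth
  proof (rule sum.cong)
    fix i assume "i \<in> {0..k}"
    then have "c - int i + (d - int (k - i)) = c + d - int k" by simp
    then have "fls_X_intpow (c + d - int k) =
        (fls_X_intpow (c - int i) * fls_X_intpow (d - int (k - i)) :: complex fls)"
      by (simp only: fls_X_intpow_times_fls_X_intpow)
    then show "fps_nth (homogenize c f) i * fps_nth (homogenize d g) (k - i) =
        fls_const (fps_nth f i * fps_nth g (k - i)) * fls_X_intpow (c + d - int k)"
      by (simp add: homogenize_def fls_const_mult_const[symmetric] mult_ac
          del: fls_const_mult_const fls_X_intpow_times_conv_shift)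
  qed simp
  also have "\<dots> = fps_nth (homogenize (c + d) (f * g)) k"
  proof -
    have "fls_const (sum F A) = (\<Sum>i\<in>A. fls_const (F i :: complex))" for F and A :: "nat set"
      by (induction A rule: infinite_finite_induct) (auto simp: fls_plus_const[symmetric])
    then show ?thesis by (simp add: homogenize_def fps_mult_nth sum_distrib_right)
  qed
  finally show "fps_nth (homogenize c f * homogenize d g) k = fps_nth (homogenize (c + d) (f * g)) k" .
qed

lemma homogenize_const: "homogenize 0 (fps_const c) = fps_const (fls_const c)"
  by (rule fps_ext) (simp add: homogenize_def)

lemma homogenize_one: "homogenize 0 1 = 1"
  using homogenize_const[of 1] by simp

lemma homogenize_power: "homogenize d f ^ n = homogenize (d * int n) (f ^ n)"
  by (induction n) (simp_all add: homogenize_one homogenize_mult algebra_simps)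

lemma homogenize_diff: "homogenize d f - homogenize d g = homogenize d (f - g)"
  by (rule fps_ext, rule fls_eqI) (simp add: homogenize_nth)

lemma homogenize_inverse_of_nat:
  "inverse (of_nat n) = homogenize 0 (inverse (of_nat n))"
proof -
  have "(inverse (of_nat n) :: complex fls fps) = fps_const (fls_const (inverse (of_nat n)))"
    by (metis fls_inverse_const fls_of_nat fps_const_inverse fps_of_nat)
  then show ?thesis by (simp only: inverse_of_nat_scal homogenize_const)
qed

lemma lam_homogenize: "lam = homogenize 1 1"
  by (rule fps_ext) (simp add: lam_def homogenize_def fls_X_conv_shift_1)

lemma mu_homogenize: "mu = homogenize 1 (1 + fps_X)"
  by (rule fps_ext) (auto simp: mu_def lam_def homogenize_def fls_X_conv_shift_1)

lemma inverse_homogenize: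
  assumes "f * g = 1"
  shows "inverse (homogenize d f) = homogenize (- d) g"
  by (rule fps_inverse_unique) (simp add: homogenize_mult assms homogenize_one)

lemma exp_coeff_homogenize:
  assumes "\<And>i. a i = homogenize (e * int (Suc i)) (b i)"
  shows "exp_coeff a \<alpha> = homogenize (e * int (weight \<alpha>)) (exp_coeff b \<alpha>)"
proof -
  have "(\<Prod>i\<in>A. a i ^ lookup \<alpha> i * inverse (of_nat (fact (lookup \<alpha> i)))) =
      homogenize (\<Sum>i\<in>A. e * int (Suc i) * int (lookup \<alpha> i))
        (\<Prod>i\<in>A. b i ^ lookup \<alpha> i * inverse (of_nat (fact (lookup \<alpha> i))))" if "finite A" for A
    using that
  proof (induction A)
    case (insert i A)
    have "a i ^ lookup \<alpha> i * inverse (of_nat (fact (lookup \<alpha> i))) =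
        homogenize (e * int (Suc i) * int (lookup \<alpha> i))
          (b i ^ lookup \<alpha> i * inverse (of_nat (fact (lookup \<alpha> i))))"
      by (simp only: assms homogenize_power homogenize_inverse_of_nat homogenize_mult add_0_right)
    with insert show ?case by (simp only: prod.insert sum.insert homogenize_mult not_False_eq_True)
  qed (simp add: homogenize_one)
  from this[of "keys \<alpha>"] show ?thesis
    unfolding exp_coeff_def weight_def by (simp add: sum_distrib_left algebra_simps)
qed

text \<open>
  With $\mu = \lambda + \epsilon$ and $u = 1 / \lambda$, these are
  $\lambda^{-i} (\mu^i - \lambda^i)$ and $\lambda^i (\lambda^{-i} - \mu^{-i}) / i$.
\<close>

definition up_part :: "complex \<Rightarrow> nat \<Rightarrow> scal" where
  "up_part \<epsilon> i = (1 + fps_const \<epsilon> * fps_X) ^ Suc i - 1"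

definition down_part :: "complex \<Rightarrow> nat \<Rightarrow> scal" where
  "down_part \<epsilon> i = (1 - inverse (1 + fps_const \<epsilon> * fps_X) ^ Suc i) * inverse (of_nat (Suc i))"

text \<open>By homogeneity the coefficient of (mu - lambda)^k carries a single power of lambda, with
  exponent \<open>weight \<alpha> - weight \<beta> - k\<close>. Requiring it to be
  \<open>- j - k\<close> is the condition on the weights; what remains is a coefficient of a series
  in (mu - lambda) / lambda.\<close>

lemma W_hat_coeff_eq:
  "W_hat_coeff k j \<alpha> \<beta> = (if int (weight \<beta>) = int (weight \<alpha>) + j
     then fact k * fps_nth (exp_coeff (up_part 1) \<alpha> * exp_coeff (down_part 1) \<beta>) k else 0)"
proof -
  have inv: "(1 + fps_X) * inverse (1 + fps_X) = (1 :: scal)"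
    by (rule inverse_mult_eq_1') simp
  have 1: "exp_coeff (\<lambda>i. mu ^ Suc i - lam ^ Suc i) \<alpha> =
      homogenize (1 * int (weight \<alpha>)) (exp_coeff (up_part 1) \<alpha>)"
    by (rule exp_coeff_homogenize)
      (simp only: mu_homogenize lam_homogenize homogenize_power homogenize_diff up_part_def
         fps_const_1_eq_1 mult_1 power_one)
  have 2: "exp_coeff (\<lambda>i. (inverse lam ^ Suc i - inverse mu ^ Suc i) * inverse (of_nat (Suc i))) \<beta> =
      homogenize ((-1) * int (weight \<beta>)) (exp_coeff (down_part 1) \<beta>)"
  proof (rule exp_coeff_homogenize)
    have "inverse lam = homogenize (-1) 1" "inverse mu = homogenize (-1) (inverse (1 + fps_X))"
      unfolding lam_homogenize mu_homogenize by (rule inverse_homogenize; simp add: inv)+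
    then show "(inverse lam ^ Suc i - inverse mu ^ Suc i) * inverse (of_nat (Suc i)) =
        homogenize ((-1) * int (Suc i)) (down_part 1 i)" for i
      by (simp only: homogenize_power homogenize_diff homogenize_inverse_of_nat homogenize_mult
         down_part_def fps_const_1_eq_1 mult_1 power_one add_0_right)
  qed
  show ?thesis
    unfolding W_hat_coeff_def X_coeff_def 1 2 homogenize_mult homogenize_nth by auto
qed

lemma exp_coeff_compose:
  fixes y :: "nat \<Rightarrow> scal"
  assumes "fps_nth c 0 = 0"
  shows "exp_coeff y \<beta> oo c = exp_coeff (\<lambda>i. y i oo c) \<beta>"
  using assms
  by (simp add: exp_coeff_def fps_compose_prod_distrib fps_compose_mult_distrib
      fps_compose_power inverse_of_nat_scal del: of_nat_fact)

text \<open>Substitution of \<epsilon> u for u. In \<open>L_op\<close> the factor l^p thus becomes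
  the choice mu = lambda + l, and the variable changes its meaning from (mu - lambda) / lambda to
  1/lambda.\<close>

lemma up_down_scale:
  "\<epsilon> ^ k * fps_nth (exp_coeff (up_part 1) \<alpha> * exp_coeff (down_part 1) \<beta>) k =
   fps_nth (exp_coeff (up_part \<epsilon>) \<alpha> * exp_coeff (down_part \<epsilon>) \<beta>) k"
proof -
  let ?c = "fps_const \<epsilon> * fps_X :: scal"
  have c0: "fps_nth ?c 0 = 0" by simp
  have "up_part 1 i oo ?c = up_part \<epsilon> i" for i
    by (simp add: up_part_def fps_compose_sub_distrib fps_compose_add_distrib
        fps_compose_power[OF c0, symmetric] fps_compose_mult_distrib[OF c0] del: power_Suc)
  moreover have "down_part 1 i oo ?c = down_part \<epsilon> i" for i
    by (simp add: down_part_def fps_compose_sub_distrib fps_compose_add_distrib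
        fps_inverse_compose inverse_of_nat_scal
        fps_compose_power[OF c0, symmetric] fps_compose_mult_distrib[OF c0] del: power_Suc of_nat_Suc)
  ultimately show ?thesis
    by (simp flip: fps_nth_compose_linear add: fps_compose_mult_distrib exp_coeff_compose)
qed

subsection \<open>Specialising all times to 1\<close>

text \<open>Index \<open>i\<close> belongs to the time of degree \<open>i + 1\<close>, so the order
  of \<open>y i\<close> is at least the degree of its time. Hence the coefficient at \<gamma>
  vanishes below order \<open>weight \<gamma>\<close>, and all times can formally be set to
  1.\<close>

definition small :: "(nat \<Rightarrow> scal) \<Rightarrow> bool" where
  "small y \<longleftrightarrow> (\<forall>i. \<forall>j\<le>i. fps_nth (y i) j = 0)"

lemma exp_coeff_small:
  assumes "small y" "j < weight \<gamma>"
  shows "fps_nth (exp_coeff y \<gamma>) j = 0"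
  using assms(2)
proof (induction \<gamma> arbitrary: j rule: expo_induct)
  case (step \<gamma> i)
  have "fps_nth (y i * exp_coeff y \<gamma>) j = 0"
    unfolding fps_mult_nth
  proof (rule sum.neutral, rule ballI)
    fix a assume "a \<in> {0..j}"
    then have "a \<le> i \<or> j - a < weight \<gamma>"
      using step.prems by (auto simp: weight_add weight_single)
    then show "fps_nth (y i) a * fps_nth (exp_coeff y \<gamma>) (j - a) = 0"
      using assms(1) step.IH by (auto simp: small_def)
  qed
  then have "fps_nth (of_nat (Suc (lookup \<gamma> i)) * exp_coeff y (Poly_Mapping.single i 1 + \<gamma>)) j = 0"
    by (simp only: exp_coeff_step)
  then show ?case
    by (simp flip: fps_of_nat del: of_nat_Suc)
qed simp

lemma small_add: "small x \<Longrightarrow> small y \<Longrightarrow> small (\<lambda>i. x i + y i)"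
  and small_uminus: "small y \<Longrightarrow> small (\<lambda>i. - y i)"
  by (auto simp: small_def)

lemma small_sum: "(\<And>a. a \<in> A \<Longrightarrow> small (y a)) \<Longrightarrow> small (\<lambda>i. \<Sum>a\<in>A. y a i)"
  by (auto simp: small_def fps_sum_nth)

text \<open>The exponential of the sum of all \<open>y i\<close>. For \<open>small y\<close>,
  exponents of weight above \<open>d\<close> do not reach the coefficient at \<open>d\<close>, hence
  the finite sum.\<close>

definition at_ones :: "(nat \<Rightarrow> scal) \<Rightarrow> scal" where
  "at_ones y = Abs_fps (\<lambda>d. \<Sum>\<gamma> | weight \<gamma> \<le> d. fps_nth (exp_coeff y \<gamma>) d)"

lemma at_ones_0: "at_ones (\<lambda>i. 0) = 1"
proof (rule fps_ext)
  fix d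
  have "exp_coeff (\<lambda>i. 0 :: scal) \<gamma> = (if \<gamma> = 0 then 1 else 0)" for \<gamma>
    using arg_cong[OF expT_0, of "\<lambda>f. tcoeff f \<gamma>"] by (simp add: tcoeff_one)
  then have "fps_nth (at_ones (\<lambda>i. 0)) d =
      (\<Sum>\<gamma> | weight \<gamma> \<le> d. if \<gamma> = 0 then fps_nth 1 d else 0)"
    by (auto simp: at_ones_def intro!: sum.cong)
  also have "\<dots> = fps_nth 1 d"
    by (subst sum.delta) (auto simp: finite_weight_le)
  finally show "fps_nth (at_ones (\<lambda>i. 0)) d = fps_nth 1 d" .
qed

lemma at_ones_add:
  assumes "small x" "small y"
  shows "at_ones (\<lambda>i. x i + y i) = at_ones x * at_ones y"
proof (rule fps_ext)
  fix d
  let ?W = "{\<gamma>. weight \<gamma> \<le> d}"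
  let ?t = "\<lambda>\<alpha> \<beta>. fps_nth (exp_coeff x \<alpha> * exp_coeff y \<beta>) d"
  have fin: "finite ?W" by (rule finite_weight_le)
  have "exp_coeff (\<lambda>i. x i + y i) \<gamma> = (\<Sum>(\<alpha>, \<beta>) | \<alpha> + \<beta> = \<gamma>. exp_coeff x \<alpha> * exp_coeff y \<beta>)" for \<gamma>
    using arg_cong[OF expT_add[of x y], of "\<lambda>f. tcoeff f \<gamma>"] by (simp add: tcoeff_mult)
  then have "fps_nth (at_ones (\<lambda>i. x i + y i)) d = (\<Sum>\<gamma>\<in>?W. \<Sum>(\<alpha>, \<beta>) | \<alpha> + \<beta> = \<gamma>. ?t \<alpha> \<beta>)"
    by (simp add: at_ones_def fps_sum_nth case_prod_unfold)
  also have "\<dots> = (\<Sum>(\<gamma>, \<alpha>, \<beta>)\<in>Sigma ?W (\<lambda>\<gamma>. {(\<alpha>, \<beta>). \<alpha> + \<beta> = \<gamma>}). ?t \<alpha> \<beta>)"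
    by (subst sum.Sigma) (auto simp: fin finite_antidiagonal[unfolded case_prod_unfold] case_prod_unfold)
  also have "\<dots> = (\<Sum>(\<alpha>, \<beta>)\<in>{(\<alpha>, \<beta>). weight (\<alpha> + \<beta>) \<le> d}. ?t \<alpha> \<beta>)"
    by (rule sum.reindex_bij_witness[of _ "\<lambda>(\<alpha>, \<beta>). (\<alpha> + \<beta>, \<alpha>, \<beta>)" "\<lambda>(\<gamma>, \<alpha>, \<beta>). (\<alpha>, \<beta>)"]) auto
  \<comment> \<open>Pairs of total weight above \<open>d\<close> may be added, as their products
    start beyond order \<open>d\<close>. The sum over a square then factors.\<close>
  also have "\<dots> = (\<Sum>(\<alpha>, \<beta>)\<in>?W \<times> ?W. ?t \<alpha> \<beta>)"
  proof (rule sum.mono_neutral_left)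
    show "\<forall>i\<in>?W \<times> ?W - {(\<alpha>, \<beta>). weight (\<alpha> + \<beta>) \<le> d}. (case i of (\<alpha>, \<beta>) \<Rightarrow> ?t \<alpha> \<beta>) = 0"
    proof
      fix p assume p: "p \<in> ?W \<times> ?W - {(\<alpha>, \<beta>). weight (\<alpha> + \<beta>) \<le> d}"
      obtain \<alpha> \<beta> where [simp]: "p = (\<alpha>, \<beta>)" by (cases p)
      from p have "\<not> weight (\<alpha> + \<beta>) \<le> d" by simp
      then have "a < weight \<alpha> \<or> d - a < weight \<beta>" if "a \<le> d" for a
        using that by (auto simp: weight_add)
      with assms have "?t \<alpha> \<beta> = 0"
        unfolding fps_mult_nth by (intro sum.neutral) (force dest: exp_coeff_small)
      then show "(case p of (\<alpha>, \<beta>) \<Rightarrow> ?t \<alpha> \<beta>) = 0" by simp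
    qed
  qed (auto simp: fin weight_add)
  also have "\<dots> = (\<Sum>a=0..d. \<Sum>(\<alpha>, \<beta>)\<in>?W \<times> ?W. fps_nth (exp_coeff x \<alpha>) a * fps_nth (exp_coeff y \<beta>) (d - a))"
    unfolding fps_mult_nth case_prod_unfold by (rule sum.swap)
  also have "\<dots> = (\<Sum>a=0..d. (\<Sum>\<alpha>\<in>?W. fps_nth (exp_coeff x \<alpha>) a) *
      (\<Sum>\<beta>\<in>?W. fps_nth (exp_coeff y \<beta>) (d - a)))"
    by (simp add: sum_product sum.cartesian_product)
  also have "\<dots> = (\<Sum>a=0..d. fps_nth (at_ones x) a * fps_nth (at_ones y) (d - a))"
  proof (rule sum.cong[OF refl])
    have "(\<Sum>\<alpha>\<in>?W. fps_nth (exp_coeff z \<alpha>) a) = fps_nth (at_ones z) a" if "small z" "a \<le> d" for z a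
      unfolding at_ones_def fps_nth_Abs_fps
      by (rule sum.mono_neutral_right) (use that exp_coeff_small fin in \<open>auto simp: not_le\<close>)
    with assms show "(\<Sum>\<alpha>\<in>?W. fps_nth (exp_coeff x \<alpha>) a) * (\<Sum>\<beta>\<in>?W. fps_nth (exp_coeff y \<beta>) (d - a)) =
        fps_nth (at_ones x) a * fps_nth (at_ones y) (d - a)" if "a \<in> {0..d}" for a
      using that by simp
  qed
  finally show "fps_nth (at_ones (\<lambda>i. x i + y i)) d = fps_nth (at_ones x * at_ones y) d"
    by (simp add: fps_mult_nth)
qed

lemma at_ones_uminus: "small y \<Longrightarrow> at_ones y * at_ones (\<lambda>i. - y i) = 1"
  using at_ones_add[of y "\<lambda>i. - y i"] by (simp add: small_uminus at_ones_0)

lemma at_ones_sum: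
  assumes "finite A" "\<And>a. a \<in> A \<Longrightarrow> small (y a)"
  shows "at_ones (\<lambda>i. \<Sum>a\<in>A. y a i) = (\<Prod>a\<in>A. at_ones (y a))"
  using assms
proof (induction A)
  case (insert a A)
  then show ?case by (simp add: at_ones_add small_sum)
qed (simp add: at_ones_0)

text \<open>
  The class function on permutations of \<open>d\<close> letters that is constantly 1 has mean 1; here
  \<open>\<beta>\<close> is a cycle type, with \<open>lookup \<beta> i\<close> cycles of length \<open>i + 1\<close>.
\<close>

lemma sum_cycle_types:
  "(\<Sum>\<beta> | weight \<beta> = d. exp_coeff (\<lambda>i. inverse (of_nat (Suc i)) :: scal) \<beta>) = 1"
proof (induction d rule: less_induct)
  case (less d)
  let ?z = "exp_coeff (\<lambda>i. inverse (of_nat (Suc i)) :: scal)"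
  have fin: "finite {\<beta>. weight \<beta> = d}" for d
    by (rule finite_subset[OF _ finite_weight_le[of d]]) auto
  show ?case
  proof (cases "d = 0")
    case True
    then have "{\<beta>. weight \<beta> = d} = {0}" by (auto simp: weight_eq_0)
    then show ?thesis by simp
  next
    case False
    \<comment> \<open>Newton's identity d h_d = sum_i p_i h_(d-i) with all power sums p_i and all
      h_j equal to 1: removing one cycle of length \<open>Suc i\<close> leaves a cycle type for
      \<open>d - Suc i\<close> letters.\<close>
    have part: "(\<Sum>\<beta> | weight \<beta> = d. of_nat (Suc i * lookup \<beta> i) * ?z \<beta>) = 1" if "i < d" for i
    proof -
      let ?e = "Poly_Mapping.single i (1::nat)"
      have "(\<Sum>\<beta> | weight \<beta> = d. of_nat (Suc i * lookup \<beta> i) * ?z \<beta>) =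
          (\<Sum>\<beta> | weight \<beta> = d \<and> lookup \<beta> i \<noteq> 0. of_nat (Suc i * lookup \<beta> i) * ?z \<beta>)"
        by (rule sum.mono_neutral_right) (auto simp: fin)
      also have "\<dots> = (\<Sum>\<beta> | weight \<beta> = d - Suc i. ?z \<beta>)"
      proof (rule sum.reindex_bij_witness[of _ "\<lambda>\<beta>. ?e + \<beta>" "\<lambda>\<beta>. \<beta> - ?e"])
        fix \<beta> assume b: "\<beta> \<in> {\<beta>. weight \<beta> = d \<and> lookup \<beta> i \<noteq> 0}"
        show *: "?e + (\<beta> - ?e) = \<beta>"
          using b by (intro poly_mapping_eqI) (auto simp: lookup_add lookup_minus lookup_single when_def)
        have "weight (?e + (\<beta> - ?e)) = d" unfolding * using b by simp
        then have "weight ?e + weight (\<beta> - ?e) = d" by (simp only: weight_add)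
        then show "\<beta> - ?e \<in> {\<beta>. weight \<beta> = d - Suc i}" by (auto simp: weight_single)
        have "(of_nat (Suc i) :: scal) * inverse (of_nat (Suc i)) = 1"
          by (rule inverse_mult_eq_1') (simp flip: fps_of_nat del: of_nat_Suc)
        moreover have "of_nat (lookup \<beta> i) * ?z \<beta> = inverse (of_nat (Suc i)) * ?z (\<beta> - ?e)"
          using exp_coeff_step[of "\<beta> - ?e" i "\<lambda>i. inverse (of_nat (Suc i)) :: scal"] b
          unfolding * by (simp add: lookup_minus)
        ultimately show "?z (\<beta> - ?e) = of_nat (Suc i * lookup \<beta> i) * ?z \<beta>"
          by (simp only: of_nat_mult mult.assoc) (simp only: mult.assoc[symmetric] mult_1)
      qed (use that in \<open>auto simp: weight_add weight_single lookup_add\<close>)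
      also have "\<dots> = 1" by (rule less.IH) (use that in auto)
      finally show ?thesis .
    qed
    have "of_nat d * (\<Sum>\<beta> | weight \<beta> = d. ?z \<beta>) =
        (\<Sum>\<beta> | weight \<beta> = d. \<Sum>i<d. of_nat (Suc i * lookup \<beta> i) * ?z \<beta>)"
      unfolding sum_distrib_left
    proof (rule sum.cong[OF refl])
      fix \<beta> assume b: "\<beta> \<in> {\<beta>. weight \<beta> = d}"
      have "keys \<beta> \<subseteq> {..<d}"
      proof
        fix i assume "i \<in> keys \<beta>"
        then have "Suc i * 1 \<le> Suc i * lookup \<beta> i" by (intro mult_le_mono2) (simp add: in_keys_iff)
        also have "\<dots> \<le> d" using weight_ge[of i \<beta>] b by simp
        finally show "i \<in> {..<d}" by simp
      qed
      then have "d = (\<Sum>i<d. Suc i * lookup \<beta> i)"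
        using b weight_superset[of "{..<d}" \<beta>] by simp
      then have "of_nat d = (\<Sum>i<d. of_nat (Suc i * lookup \<beta> i) :: scal)"
        by (metis of_nat_sum)
      then show "of_nat d * ?z \<beta> = (\<Sum>i<d. of_nat (Suc i * lookup \<beta> i) * ?z \<beta>)"
        by (simp only: sum_distrib_right)
    qed
    also have "\<dots> = (\<Sum>i<d. \<Sum>\<beta> | weight \<beta> = d. of_nat (Suc i * lookup \<beta> i) * ?z \<beta>)"
      by (rule sum.swap)
    also have "\<dots> = of_nat d * 1" using part by simp
    finally show ?thesis using False by (subst (asm) mult_left_cancel) auto
  qed
qed

text \<open>The formal identity exp(sum_i v^i / i) = 1 / (1 - v). Exponents of weight e contribute
  v^e times the mean 1 from \<open>sum_cycle_types\<close>, so the geometric series appears without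
  a logarithm.\<close>

lemma at_ones_geometric:
  assumes "fps_nth v 0 = 0"
  shows "at_ones (\<lambda>i. v ^ Suc i * inverse (of_nat (Suc i))) * (1 - v) = 1"
proof -
  let ?z = "exp_coeff (\<lambda>i. inverse (of_nat (Suc i)) :: scal)"
  have mp: "mpow (\<lambda>i. v ^ Suc i) \<beta> = v ^ weight \<beta>" for \<beta>
    by (simp add: mpow_def weight_def power_sum power_mult[symmetric] del: power_Suc)
  have "at_ones (\<lambda>i. v ^ Suc i * inverse (of_nat (Suc i))) = Abs_fps (\<lambda>_. 1) oo v"
  proof (rule fps_ext)
    fix d
    have fin: "finite {\<gamma>. weight \<gamma> \<le> d}" by (rule finite_weight_le)
    have "fps_nth (at_ones (\<lambda>i. v ^ Suc i * inverse (of_nat (Suc i)))) d =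
        fps_nth (\<Sum>\<gamma> | weight \<gamma> \<le> d. v ^ weight \<gamma> * ?z \<gamma>) d"
      by (simp only: at_ones_def fps_nth_Abs_fps exp_coeff_mult mp fps_sum_nth)
    also have "(\<Sum>\<gamma> | weight \<gamma> \<le> d. v ^ weight \<gamma> * ?z \<gamma>) =
        (\<Sum>e\<in>{0..d}. \<Sum>\<gamma> | \<gamma> \<in> {\<gamma>. weight \<gamma> \<le> d} \<and> weight \<gamma> = e. v ^ weight \<gamma> * ?z \<gamma>)"
      by (rule sum.group[symmetric]) (auto simp: fin)
    also have "\<dots> = (\<Sum>e\<in>{0..d}. v ^ e * (\<Sum>\<gamma> | weight \<gamma> = e. ?z \<gamma>))"
      unfolding sum_distrib_left by (intro sum.cong) auto
    also have "\<dots> = (\<Sum>e\<in>{0..d}. v ^ e)"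
      by (simp only: sum_cycle_types mult_1_right)
    finally show "fps_nth (at_ones (\<lambda>i. v ^ Suc i * inverse (of_nat (Suc i)))) d =
        fps_nth (Abs_fps (\<lambda>_. 1) oo v) d"
      by (simp add: fps_compose_nth fps_sum_nth)
  qed
  moreover have "Abs_fps (\<lambda>_. 1) * (1 - fps_X) = (1 :: scal)"
  proof (rule fps_ext)
    show "fps_nth (Abs_fps (\<lambda>_. 1) * (1 - fps_X)) n = fps_nth (1 :: scal) n" for n
      by (cases n) (simp_all add: algebra_simps)
  qed
  then have "(Abs_fps (\<lambda>_. 1) oo v) * (1 - v) = 1"
    using fps_compose_mult_distrib[OF assms, of "Abs_fps (\<lambda>_. 1)" "1 - fps_X"]
    by (simp add: fps_compose_sub_distrib fps_X_fps_compose_startby0[OF assms])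
  ultimately show ?thesis by simp
qed

subsection \<open>Partial fractions\<close>

text \<open>For distinct \<open>d j\<close>, the residue at x = \<open>d i\<close> of the product of
  all (x - \<open>n j\<close>) / (x - \<open>d j\<close>).\<close>

definition pf_coeff :: "('i \<Rightarrow> 'a::field) \<Rightarrow> ('i \<Rightarrow> 'a) \<Rightarrow> 'i set \<Rightarrow> 'i \<Rightarrow> 'a" where
  "pf_coeff n d I i = (d i - n i) * (\<Prod>j\<in>I - {i}. (d i - n j) / (d i - d j))"

lemma pf_coeff_insert:
  assumes "finite I" "inj_on d (insert k I)" "k \<notin> I" "i \<in> I"
  shows "pf_coeff n d (insert k I) i = pf_coeff n d I i * (1 + (d k - n k) / (d i - d k))"
proof -
  have ne: "d i - d k \<noteq> 0" using assms by (auto simp: inj_on_def)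
  have "insert k I - {i} = insert k (I - {i})" using assms by auto
  then have "(\<Prod>j\<in>insert k I - {i}. (d i - n j) / (d i - d j)) =
      (d i - n k) / (d i - d k) * (\<Prod>j\<in>I - {i}. (d i - n j) / (d i - d j))"
    using assms by simp
  moreover have "(d i - n k) / (d i - d k) = 1 + (d k - n k) / (d i - d k)"
    using ne by (simp add: field_simps)
  ultimately show ?thesis by (simp add: pf_coeff_def)
qed

text \<open>In the induction the coefficient at the new pole involves the old product at that pole,
  which is known from the induction hypothesis at \<open>d k\<close>; therefore \<open>x\<close> has
  to stay general.\<close>

lemma partial_fractions:
  assumes "finite I" "inj_on d I" "x \<notin> d ` I"
  shows "(\<Prod>i\<in>I. (x - n i) / (x - d i)) = 1 + (\<Sum>i\<in>I. pf_coeff n d I i / (x - d i))"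
  using assms
proof (induction I arbitrary: x)
  case (insert k I)
  have IH: "(\<Prod>i\<in>I. (x - n i) / (x - d i)) = 1 + (\<Sum>i\<in>I. pf_coeff n d I i / (x - d i))"
    if "x \<notin> d ` I" for x
    using that insert by auto
  have xk: "x - d k \<noteq> 0" using insert.prems by auto
  have "pf_coeff n d (insert k I) k = (d k - n k) * (\<Prod>i\<in>I. (d k - n i) / (d k - d i))"
    using insert.hyps by (simp add: pf_coeff_def)
  also have "\<dots> = (d k - n k) * (1 + (\<Sum>i\<in>I. pf_coeff n d I i / (d k - d i)))"
    by (subst IH) (use insert in \<open>auto simp: inj_on_def\<close>)
  finally have k: "pf_coeff n d (insert k I) k = \<dots>" .
  have i: "pf_coeff n d (insert k I) i / (x - d i) = pf_coeff n d I i / (x - d i) +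
      (d k - n k) / (x - d k) * (pf_coeff n d I i / (x - d i) - pf_coeff n d I i / (d k - d i))"
    if "i \<in> I" for i
  proof -
    have "d i - d k \<noteq> 0" "d k - d i \<noteq> 0" "x - d i \<noteq> 0" using that insert by (auto simp: inj_on_def)
    then show ?thesis
      unfolding pf_coeff_insert[OF insert.hyps(1) insert.prems(1) insert.hyps(2) that]
      using xk by (simp add: divide_simps) (simp add: algebra_simps)
  qed
  have "(\<Prod>i\<in>insert k I. (x - n i) / (x - d i)) =
      (1 + (d k - n k) / (x - d k)) * (1 + (\<Sum>i\<in>I. pf_coeff n d I i / (x - d i)))"
    using insert IH[of x] xk by (simp add: field_simps)
  also have "\<dots> = 1 + (d k - n k) / (x - d k) * (1 + (\<Sum>i\<in>I. pf_coeff n d I i / (d k - d i))) +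
      (\<Sum>i\<in>I. pf_coeff n d (insert k I) i / (x - d i))"
  proof -
    have "(\<Sum>i\<in>I. pf_coeff n d (insert k I) i / (x - d i)) =
        (\<Sum>i\<in>I. pf_coeff n d I i / (x - d i)) + (d k - n k) / (x - d k) *
        ((\<Sum>i\<in>I. pf_coeff n d I i / (x - d i)) - (\<Sum>i\<in>I. pf_coeff n d I i / (d k - d i)))"
      by (simp only: sum.cong[OF refl i] sum.distrib sum_distrib_left[symmetric] sum_subtractf)
    then show ?thesis by (simp only:) (simp add: algebra_simps)
  qed
  also have "\<dots> = 1 + (\<Sum>i\<in>insert k I. pf_coeff n d (insert k I) i / (x - d i))"
    using insert.hyps by (simp add: k)
  finally show ?case .
qed simp

text \<open>With u = 1/lambda as the variable, \<open>fps_X * geom d\<close> is 1 / (lambda - d)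
  expanded at infinity; \<open>geom_diff\<close> is then the resolvent identity.\<close>

definition geom :: "complex \<Rightarrow> scal" where
  "geom d = inverse (1 - fps_const d * fps_X)"

lemma geom_mult: "geom d * (1 - fps_const d * fps_X) = 1"
  unfolding geom_def by (rule inverse_mult_eq_1) simp

lemma geom_diff: "fps_const (c - d) * fps_X * geom c * geom d = geom c - geom d"
proof -
  have "fps_const (c - d) * fps_X = (1 - fps_const d * fps_X) - (1 - fps_const c * fps_X)"
    by (simp only: fps_const_sub[symmetric]) (simp add: algebra_simps del: fps_const_sub)
  moreover have "((1 - fps_const d * fps_X) - (1 - fps_const c * fps_X)) * geom c * geom d = geom c * (geom d * (1 - fps_const d * fps_X)) -
      geom d * (geom c * (1 - fps_const c * fps_X))"
    by (simp add: algebra_simps)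
  ultimately show ?thesis by (simp only: geom_mult mult_1_right)
qed

lemma geom_factor: "(1 - fps_const n * fps_X) * geom d = 1 + fps_const (d - n) * fps_X * geom d"
proof -
  have "1 - fps_const n * fps_X = (1 - fps_const d * fps_X) + fps_const (d - n) * fps_X"
    by (simp only: fps_const_sub[symmetric]) (simp add: algebra_simps del: fps_const_sub)
  then have "(1 - fps_const n * fps_X) * geom d =
      geom d * (1 - fps_const d * fps_X) + fps_const (d - n) * fps_X * geom d"
    by (simp only: distrib_right) (simp only: mult.commute)
  then show ?thesis by (simp only: geom_mult)
qed

text \<open>The expansion of \<open>partial_fractions\<close> at x = 1/u, as a formal series. The
  numerical version enters to evaluate the old product at the new pole \<open>d k\<close>.\<close>

lemma partial_fractions_fps:
  assumes "finite I" "inj_on d I"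
  shows "(\<Prod>i\<in>I. (1 - fps_const (n i) * fps_X) * geom (d i)) =
     1 + (\<Sum>i\<in>I. fps_const (pf_coeff n d I i) * fps_X * geom (d i))"
  using assms
proof (induction I)
  case (insert k I)
  let ?C = "pf_coeff n d I"
  have "pf_coeff n d (insert k I) k = (d k - n k) * (\<Prod>i\<in>I. (d k - n i) / (d k - d i))"
    using insert.hyps by (simp add: pf_coeff_def)
  also have "\<dots> = (d k - n k) * (1 + (\<Sum>i\<in>I. ?C i / (d k - d i)))"
    by (subst partial_fractions) (use insert in \<open>auto simp: inj_on_def\<close>)
  finally have "fps_const (pf_coeff n d (insert k I) k) =
      fps_const (d k - n k) * (1 + fps_const (\<Sum>i\<in>I. ?C i / (d k - d i)))"
    by (simp flip: fps_const_mult fps_const_add)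
  also have "fps_const (\<Sum>i\<in>I. ?C i / (d k - d i)) = (\<Sum>i\<in>I. fps_const (?C i / (d k - d i)))"
    by (rule fps_ext) (simp add: fps_sum_nth)
  finally have k: "fps_const (pf_coeff n d (insert k I) k) = fps_const (d k - n k) * (1 + \<dots>)" .
  let ?D = "fps_const (d k - n k)"
  have i: "fps_const (pf_coeff n d (insert k I) i) * fps_X * geom (d i) =
      fps_const (?C i) * fps_X * geom (d i) + ?D * fps_X * geom (d k) * (fps_const (?C i) * fps_X * geom (d i))
      - ?D * (fps_const (?C i / (d k - d i)) * fps_X * geom (d k))"
    if "i \<in> I" for i
  proof -
    have ne: "d i - d k \<noteq> 0" "d k - d i \<noteq> 0" using that insert by (auto simp: inj_on_def)
    have "(fps_const (1 / (d i - d k)) * fps_const (d i - d k)) * (fps_X * (fps_X * (geom (d i) * geom (d k)))) =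
        fps_const (1 / (d i - d k)) * (fps_X * (fps_const (d i - d k) * fps_X * geom (d i) * geom (d k)))"
      by (simp only: mult_ac)
    moreover have "fps_const (1 / (d i - d k)) * fps_const (d i - d k) = 1"
      using ne by simp
    ultimately have "fps_X * (fps_X * (geom (d i) * geom (d k))) =
        fps_const (1 / (d i - d k)) * (fps_X * (fps_const (d i - d k) * fps_X * geom (d i) * geom (d k)))"
      by (simp only: mult_1)
    also have "\<dots> = fps_const (1 / (d i - d k)) * (fps_X * (geom (d i) - geom (d k)))"
      by (simp only: geom_diff)
    finally have g: "fps_X * (fps_X * (geom (d i) * geom (d k))) = \<dots>" .
    have c: "fps_const (pf_coeff n d (insert k I) i) =
        fps_const (?C i) + ?D * (fps_const (?C i) * fps_const (1 / (d i - d k)))"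
      unfolding pf_coeff_insert[OF insert.hyps(1) insert.prems(1) insert.hyps(2) that]
      by (simp add: algebra_simps)
    have c': "fps_const (?C i / (d k - d i)) = - (fps_const (?C i) * fps_const (1 / (d i - d k)))"
      using ne by (simp add: field_simps)
    have "?D * fps_X * geom (d k) * (fps_const (?C i) * fps_X * geom (d i)) =
        ?D * fps_const (?C i) * (fps_X * (fps_X * (geom (d i) * geom (d k))))"
      by (simp only: mult_ac)
    then show ?thesis unfolding g c c'
      by (simp add: algebra_simps del: fps_const_mult fps_const_mult_left fps_const_mult_right)
  qed
  have "(\<Prod>i\<in>insert k I. (1 - fps_const (n i) * fps_X) * geom (d i)) =
      (1 + ?D * fps_X * geom (d k)) * (1 + (\<Sum>i\<in>I. fps_const (?C i) * fps_X * geom (d i)))"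
    using insert by (simp add: geom_factor)
  also have "\<dots> = 1 + fps_const (pf_coeff n d (insert k I) k) * fps_X * geom (d k) +
      (\<Sum>i\<in>I. fps_const (pf_coeff n d (insert k I) i) * fps_X * geom (d i))"
    by (simp add: i k sum.distrib sum_subtractf cong: sum.cong
        del: fps_const_mult fps_const_mult_left fps_const_mult_right)
      (simp add: algebra_simps sum_distrib_left sum_distrib_right sum.distrib
        del: fps_const_mult fps_const_mult_left fps_const_mult_right)
  finally show ?case using insert.hyps by (simp add: add.assoc)
qed simp

subsection \<open>The vertex operator on exponentials\<close>

text \<open>
  Of the \<open>2 * N\<close> points the first half has sign $+$, the second half sign $-$. The signs have
  to balance: otherwise $\lambda = 0$ or $\mu = 0$ would contribute a residue as well.
\<close>

definition sg :: "nat \<Rightarrow> nat \<Rightarrow> complex" where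
  "sg N a = (if a < N then 1 else - 1)"

definition psum :: "nat \<Rightarrow> (nat \<Rightarrow> complex) \<Rightarrow> nat \<Rightarrow> complex" where
  "psum N \<rho> i = (\<Sum>a<2 * N. sg N a * \<rho> a ^ Suc i)"

text \<open>With mu = lambda + \<epsilon>, a point r of sign + contributes the factor (1 - r/mu) /
  (1 - r/lambda), which is (lambda - (r - \<epsilon>)) / (lambda - r) up to the factor lambda/mu.
  Sign - inverts it, so pole and zero (\<open>numer_root\<close>) change places.\<close>

definition pole :: "nat \<Rightarrow> (nat \<Rightarrow> complex) \<Rightarrow> complex \<Rightarrow> nat \<Rightarrow> complex" where
  "pole N \<rho> \<epsilon> a = (if a < N then \<rho> a else \<rho> a - \<epsilon>)"

definition numer_root :: "nat \<Rightarrow> (nat \<Rightarrow> complex) \<Rightarrow> complex \<Rightarrow> nat \<Rightarrow> complex" where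
  "numer_root N \<rho> \<epsilon> a = (if a < N then \<rho> a - \<epsilon> else \<rho> a)"

text \<open>
  The operators move points by real amounts, so different imaginary parts keep the points apart.
\<close>

definition generic :: "nat \<Rightarrow> (nat \<Rightarrow> complex) \<Rightarrow> bool" where
  "generic N \<rho> \<longleftrightarrow> inj_on (\<lambda>a. Im (\<rho> a)) {..<2 * N}"

text \<open>
  With $u = 1/\lambda$ and $v = u / (1 + \epsilon u) = 1/\mu$, the part of
  $\sum_i (\lambda^{-i} - \mu^{-i}) x_i / i$ that comes from the point \<open>r\<close>.
\<close>

definition point_series :: "complex \<Rightarrow> complex \<Rightarrow> nat \<Rightarrow> scal" where
  "point_series \<epsilon> r i = fps_const (r ^ Suc i) * (fps_X ^ Suc i * down_part \<epsilon> i)"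

lemma small_power: "fps_nth v 0 = 0 \<Longrightarrow> small (\<lambda>i. v ^ Suc i * inverse (of_nat (Suc i)))"
  unfolding small_def inverse_of_nat_scal
  by (auto simp del: of_nat_Suc power_Suc intro: startsby_zero_power_prefix[rule_format])

text \<open>The series splits as the family of (u^i - v^i) / i with u = r/lambda and v = r/mu, so
  two geometric exponentials give (1 - v) / (1 - u). Here \<open>?K\<close> is mu/lambda, and
  \<open>geom (- \<epsilon>)\<close> is its inverse. The second value is the reciprocal of the
  first.\<close>

lemma at_ones_point_series:
  "at_ones (point_series \<epsilon> r) = (1 - fps_const (r - \<epsilon>) * fps_X) * geom r * geom (- \<epsilon>)"
  "at_ones (\<lambda>i. - point_series \<epsilon> r i) =
     (1 - fps_const r * fps_X) * geom (r - \<epsilon>) * (1 + fps_const \<epsilon> * fps_X)"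
  "small (point_series \<epsilon> r)"
proof -
  let ?K = "1 + fps_const \<epsilon> * fps_X :: scal"
  define u where "u = fps_const r * fps_X"
  define v where "v = u * inverse ?K"
  let ?g = "\<lambda>w i. w ^ Suc i * inverse (of_nat (Suc i) :: scal)"
  have K: "inverse ?K * ?K = 1" by (rule inverse_mult_eq_1) simp
  have u0: "fps_nth u 0 = 0" and v0: "fps_nth v 0 = 0" by (simp_all add: u_def v_def)
  have eq: "point_series \<epsilon> r i = ?g u i + - ?g v i" for i
  proof -
    have "c * (x * ((1 - k) * j)) = c * x * j + - (c * x * k * j)" for c x k j :: scal
      by (simp add: algebra_simps)
    then show ?thesis
      by (simp only: point_series_def down_part_def u_def v_def power_mult_distrib fps_const_power)
  qed
  then have ps: "point_series \<epsilon> r = (\<lambda>i. ?g u i + - ?g v i)" by blast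
  note su = small_power[OF u0] and sv = small_power[OF v0]
  show small: "small (point_series \<epsilon> r)"
    unfolding ps by (intro small_add small_uminus su sv)
  have "at_ones (\<lambda>i. - ?g v i) = at_ones (\<lambda>i. - ?g v i) * (at_ones (?g v) * (1 - v))"
    by (simp only: at_ones_geometric[OF v0] mult_1_right)
  also have "\<dots> = (at_ones (?g v) * at_ones (\<lambda>i. - ?g v i)) * (1 - v)"
    by (simp only: mult_ac)
  also have "\<dots> = 1 - v"
    by (simp only: at_ones_uminus[OF sv] mult_1)
  finally have "at_ones (point_series \<epsilon> r) = at_ones (?g u) * (1 - v)"
    unfolding ps using at_ones_add[OF su small_uminus[OF sv]] by simp
  moreover have "g * (1 - u * i) * k * (1 - u) = (g * (1 - u)) * (k - u * (i * k))" for g i k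
    by (simp add: algebra_simps)
  ultimately have "at_ones (point_series \<epsilon> r) * ?K * (1 - u) =
      (at_ones (?g u) * (1 - u)) * (?K - u * (inverse ?K * ?K))"
    by (simp only: v_def)
  then have *: "at_ones (point_series \<epsilon> r) * ?K * (1 - u) = ?K - u"
    by (simp only: K at_ones_geometric[OF u0] mult_1 mult_1_right)
  have Ku: "?K - u = 1 - fps_const (r - \<epsilon>) * fps_X"
    by (simp only: u_def fps_const_sub[symmetric]) (simp add: algebra_simps del: fps_const_sub)
  have gK: "geom (- \<epsilon>) * ?K = 1"
    using geom_mult[of "- \<epsilon>"] by (simp add: fps_const_neg[symmetric] del: fps_const_neg)
  have "at_ones (point_series \<epsilon> r) =
      at_ones (point_series \<epsilon> r) * (geom (- \<epsilon>) * ?K) * (geom r * (1 - u))"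
    unfolding gK u_def geom_mult by simp
  also have "\<dots> = (at_ones (point_series \<epsilon> r) * ?K * (1 - u)) * geom r * geom (- \<epsilon>)"
    by (simp only: mult_ac)
  finally show "at_ones (point_series \<epsilon> r) = (1 - fps_const (r - \<epsilon>) * fps_X) * geom r * geom (- \<epsilon>)"
    unfolding * Ku .
  have "at_ones (\<lambda>i. - point_series \<epsilon> r i) =
      at_ones (\<lambda>i. - point_series \<epsilon> r i) * (geom (r - \<epsilon>) * (1 - fps_const (r - \<epsilon>) * fps_X))"
    unfolding geom_mult by simp
  also have "\<dots> = (at_ones (point_series \<epsilon> r) * at_ones (\<lambda>i. - point_series \<epsilon> r i)) * (1 - u) * geom (r - \<epsilon>) * ?K"
    unfolding Ku[symmetric] *[symmetric] by (simp only: mult_ac)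
  finally show "at_ones (\<lambda>i. - point_series \<epsilon> r i) =
      (1 - fps_const r * fps_X) * geom (r - \<epsilon>) * ?K"
    unfolding at_ones_uminus[OF small] by (simp add: u_def)
qed

lemma sum_point_series:
  "fps_const (psum N \<rho> i) * (fps_X ^ Suc i * down_part \<epsilon> i) =
   (\<Sum>a<2 * N. if a < N then point_series \<epsilon> (\<rho> a) i else - point_series \<epsilon> (\<rho> a) i)"
proof -
  have "fps_const (psum N \<rho> i) = (\<Sum>a<2 * N. fps_const (sg N a * \<rho> a ^ Suc i))"
    unfolding psum_def by (rule fps_ext) (simp add: fps_sum_nth)
  then have "fps_const (psum N \<rho> i) * (fps_X ^ Suc i * down_part \<epsilon> i) =
      (\<Sum>a<2 * N. fps_const (sg N a * \<rho> a ^ Suc i) * (fps_X ^ Suc i * down_part \<epsilon> i))"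
    by (simp only: sum_distrib_right)
  also have "\<dots> = (\<Sum>a<2 * N. if a < N then point_series \<epsilon> (\<rho> a) i else - point_series \<epsilon> (\<rho> a) i)"
    by (rule sum.cong) (auto simp: sg_def point_series_def fps_const_neg[symmetric] simp del: fps_const_neg power_Suc)
  finally show ?thesis .
qed

lemma at_ones_psum:
  "at_ones (\<lambda>i. fps_const (psum N \<rho> i) * (fps_X ^ Suc i * down_part \<epsilon> i)) =
   (\<Prod>a<2 * N. (1 - fps_const (numer_root N \<rho> \<epsilon> a) * fps_X) * geom (pole N \<rho> \<epsilon> a))"
  "small (\<lambda>i. fps_const (psum N \<rho> i) * (fps_X ^ Suc i * down_part \<epsilon> i))"
proof -
  let ?K = "1 + fps_const \<epsilon> * fps_X :: scal"
  let ?y = "\<lambda>a i. if a < N then point_series \<epsilon> (\<rho> a) i else - point_series \<epsilon> (\<rho> a) i"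
  let ?f = "\<lambda>a. (1 - fps_const (numer_root N \<rho> \<epsilon> a) * fps_X) * geom (pole N \<rho> \<epsilon> a)"
  have small: "small (?y a)" for a
    by (cases "a < N") (simp_all add: at_ones_point_series(3) small_uminus)
  then show "small (\<lambda>i. fps_const (psum N \<rho> i) * (fps_X ^ Suc i * down_part \<epsilon> i))"
    unfolding sum_point_series by (intro small_sum)
  have gK: "geom (- \<epsilon>) * ?K = 1"
    using geom_mult[of "- \<epsilon>"] by (simp add: fps_const_neg[symmetric] del: fps_const_neg)
  have split: "{..<2 * N} \<inter> {a. a < N} = {..<N}" "{..<2 * N} \<inter> - {a. a < N} = {N..<2 * N}" by auto
  have "at_ones (\<lambda>i. fps_const (psum N \<rho> i) * (fps_X ^ Suc i * down_part \<epsilon> i)) = (\<Prod>a<2 * N. at_ones (?y a))"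
    unfolding sum_point_series by (rule at_ones_sum) (auto intro: small)
  also have "\<dots> = (\<Prod>a<2 * N. ?f a * (if a < N then geom (- \<epsilon>) else ?K))"
    by (rule prod.cong) (auto simp: at_ones_point_series numer_root_def pole_def)
  also have "\<dots> = (\<Prod>a<2 * N. ?f a) * (geom (- \<epsilon>) ^ N * ?K ^ N)"
    by (simp only: prod.distrib prod.If_cases[OF finite_lessThan] split prod_constant card_lessThan card_atLeastLessThan)
      simp
  \<comment> \<open>The factors lambda/mu of the N points of sign + cancel the factors mu/lambda of
    those of sign -.\<close>
  also have "geom (- \<epsilon>) ^ N * ?K ^ N = 1"
    by (simp only: power_mult_distrib[symmetric] gK power_one)
  finally show "at_ones (\<lambda>i. fps_const (psum N \<rho> i) * (fps_X ^ Suc i * down_part \<epsilon> i)) = (\<Prod>a<2 * N. ?f a)"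
    by simp
qed

text \<open>The ratio of the Cauchy products after and before moving the point \<open>a\<close> to
  \<open>x\<close>. The Cauchy product is, up to sign, the product of the differences over pairs of
  equal sign divided by that over pairs of opposite sign. Being such a ratio is the reason for
  \<open>wt_twice\<close> and \<open>wt_swap\<close>.\<close>

definition wt :: "nat \<Rightarrow> (nat \<Rightarrow> complex) \<Rightarrow> nat \<Rightarrow> complex \<Rightarrow> complex" where
  "wt N \<rho> a x = (\<Prod>b\<in>{..<2 * N} - {a}.
     if (a < N) = (b < N) then (x - \<rho> b) / (\<rho> a - \<rho> b) else (\<rho> a - \<rho> b) / (x - \<rho> b))"

lemma pf_coeff_wt:
  "pf_coeff (numer_root N \<rho> \<epsilon>) (pole N \<rho> \<epsilon>) {..<2 * N} a = sg N a * \<epsilon> * wt N \<rho> a (\<rho> a + sg N a * \<epsilon>)"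
  unfolding pf_coeff_def wt_def
  by (intro arg_cong2[where f = "(*)"] prod.cong)
    (auto simp: numer_root_def pole_def sg_def algebra_simps intro!: arg_cong2[where f = "(/)"])

section \<open>Residues as coefficients of power series in 1/lambda\<close>

text \<open>
  \<open>T\<close> is a polynomial of degree at most \<open>m\<close> in $u = 1/\lambda$, and \<open>A\<close> is the value of the
  polynomial $\lambda^m T(1/\lambda)$ at $\lambda = d$.
\<close>

definition homog_value :: "complex \<Rightarrow> nat \<Rightarrow> scal \<Rightarrow> complex \<Rightarrow> bool" where
  "homog_value d m T A \<longleftrightarrow> (\<exists>R. (\<forall>j\<ge>m. fps_nth R j = 0) \<and>
     T = fps_const A * fps_X ^ m + (1 - fps_const d * fps_X) * R)"

lemma homog_value_mult:
  assumes "homog_value d m T A" "homog_value d n U B"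
  shows "homog_value d (m + n) (T * U) (A * B)"
proof -
  let ?g = "1 - fps_const d * fps_X"
  obtain R where R: "\<forall>j\<ge>m. fps_nth R j = 0" "T = fps_const A * fps_X ^ m + ?g * R"
    using assms(1) by (auto simp: homog_value_def)
  obtain S where S: "\<forall>j\<ge>n. fps_nth S j = 0" "U = fps_const B * fps_X ^ n + ?g * S"
    using assms(2) by (auto simp: homog_value_def)
  let ?Z = "fps_const A * (fps_X ^ m * S) + fps_const B * (fps_X ^ n * R) + ?g * (R * S)"
  \<comment> \<open>The degrees of \<open>R\<close> and \<open>S\<close> are below \<open>m\<close>
    and \<open>n\<close>, so that of \<open>R * S\<close> is at most \<open>m + n - 2\<close>; the
    spare degree absorbs the factor \<open>?g\<close>.\<close>
  have RS: "fps_nth (R * S) j = 0" if "j \<ge> m + n - 1" "m > 0 \<or> n > 0" for j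
    unfolding fps_mult_nth
  proof (rule sum.neutral, rule ballI)
    fix i assume "i \<in> {0..j}"
    then have "i \<ge> m \<or> j - i \<ge> n" using that by auto
    then show "fps_nth R i * fps_nth S (j - i) = 0" using R(1) S(1) by auto
  qed
  have "fps_nth ?Z j = 0" if j: "j \<ge> m + n" for j
  proof (cases "m = 0 \<and> n = 0")
    case True
    then have "R = 0" "S = 0" using R(1) S(1) by (auto simp: fps_eq_iff)
    then show ?thesis by simp
  next
    case False
    then have "fps_nth (R * S) j = 0" "j > 0" "fps_nth (R * S) (j - 1) = 0"
      using j by (auto intro!: RS)
    moreover have "?g * (R * S) = R * S - fps_const d * (fps_X * (R * S))"
      by (simp only: left_diff_distrib mult_1 mult.assoc)
    ultimately have "fps_nth (?g * (R * S)) j = 0"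
      by simp
    moreover have "fps_nth (fps_X ^ m * S) j = 0" "fps_nth (fps_X ^ n * R) j = 0"
      using R(1) S(1) j by (auto simp: fps_X_power_mult_nth)
    ultimately show ?thesis by simp
  qed
  moreover have "T * U = fps_const (A * B) * fps_X ^ (m + n) + ?g * ?Z"
    unfolding R(2) S(2) fps_const_mult[symmetric] power_add
    by (simp add: algebra_simps del: fps_const_mult)
  ultimately show ?thesis unfolding homog_value_def by blast
qed

lemma homog_value_const: "homog_value d 0 (fps_const c) c"
  unfolding homog_value_def by (intro exI[of _ 0]) auto

lemma homog_value_diff:
  assumes "homog_value d m T A" "homog_value d m U B"
  shows "homog_value d m (T - U) (A - B)"
proof -
  let ?g = "1 - fps_const d * fps_X"
  obtain R where R: "\<forall>j\<ge>m. fps_nth R j = 0" "T = fps_const A * fps_X ^ m + ?g * R"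
    using assms(1) by (auto simp: homog_value_def)
  obtain S where S: "\<forall>j\<ge>m. fps_nth S j = 0" "U = fps_const B * fps_X ^ m + ?g * S"
    using assms(2) by (auto simp: homog_value_def)
  have "T - U = fps_const (A - B) * fps_X ^ m + ?g * (R - S)"
    unfolding R(2) S(2) fps_const_sub[symmetric]
    by (simp add: algebra_simps del: fps_const_sub)
  with R(1) S(1) show ?thesis unfolding homog_value_def by (intro exI[of _ "R - S"]) auto
qed

lemma homog_value_power: "homog_value d m T A \<Longrightarrow> homog_value d (m * n) (T ^ n) (A ^ n)"
proof (induction n)
  case 0
  then show ?case using homog_value_const[of d 1] by simp
next
  case (Suc n)
  then show ?case using homog_value_mult[of d m T A "m * n" "T ^ n" "A ^ n"] by simp
qed

lemma homog_value_up_part: "homog_value d (Suc i) (up_part \<epsilon> i) ((d + \<epsilon>) ^ Suc i - d ^ Suc i)"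
proof -
  have "homog_value d 1 (1 + fps_const \<epsilon> * fps_X) (d + \<epsilon>)" for \<epsilon>
    unfolding homog_value_def
    by (intro exI[of _ 1]) (auto simp: fps_const_add[symmetric] algebra_simps simp del: fps_const_add)
  note * = homog_value_power[OF this, of "Suc i"]
  \<comment> \<open>Here 1 counts as a polynomial of degree \<open>Suc i\<close> in u, so its
    homogenized value is \<open>d ^ Suc i\<close> and not 1.\<close>
  from *[of 0] have "homog_value d (Suc i) 1 (d ^ Suc i)" by (simp del: power_Suc)
  with *[of \<epsilon>] show ?thesis
    unfolding up_part_def by (intro homog_value_diff) (simp_all del: power_Suc)
qed

lemma homog_value_exp_coeff:
  "homog_value d (weight \<alpha>) (exp_coeff (up_part \<epsilon>) \<alpha>)
     (exp_coeff (\<lambda>i. (d + \<epsilon>) ^ Suc i - d ^ Suc i) \<alpha>)"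
proof -
  have "homog_value d (\<Sum>i\<in>A. Suc i * lookup \<alpha> i)
      (\<Prod>i\<in>A. up_part \<epsilon> i ^ lookup \<alpha> i * inverse (of_nat (fact (lookup \<alpha> i))))
      (\<Prod>i\<in>A. ((d + \<epsilon>) ^ Suc i - d ^ Suc i) ^ lookup \<alpha> i * inverse (of_nat (fact (lookup \<alpha> i))))"
    if "finite A" for A
    using that
  proof (induction A)
    case (insert i A)
    have "homog_value d (Suc i * lookup \<alpha> i + 0)
        (up_part \<epsilon> i ^ lookup \<alpha> i * inverse (of_nat (fact (lookup \<alpha> i))))
        (((d + \<epsilon>) ^ Suc i - d ^ Suc i) ^ lookup \<alpha> i * inverse (of_nat (fact (lookup \<alpha> i))))"
      unfolding inverse_of_nat_scal
      by (intro homog_value_mult homog_value_power homog_value_up_part homog_value_const)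
    from homog_value_mult[OF this insert.IH] insert.hyps show ?case
      by (simp del: of_nat_fact power_Suc)
  qed (use homog_value_const[of d 1] in simp)
  from this[of "keys \<alpha>"] show ?thesis
    unfolding exp_coeff_def weight_def by simp
qed

text \<open>The residue at lambda = d: T / (1 - d u) equals A u^m / (1 - d u) plus a polynomial of
  degree below m, so from order m on its coefficients form a geometric sequence.\<close>

lemma homog_value_nth:
  assumes "homog_value d m T A"
  shows "n > m \<Longrightarrow> fps_nth T n = 0" "n \<ge> m \<Longrightarrow> fps_nth (T * geom d) n = A * d ^ (n - m)"
proof -
  let ?g = "1 - fps_const d * fps_X"
  obtain R where R: "\<And>j. j \<ge> m \<Longrightarrow> fps_nth R j = 0" "T = fps_const A * fps_X ^ m + ?g * R"
    using assms by (auto simp: homog_value_def)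
  {
    assume "n > m"
    then show "fps_nth T n = 0"
      unfolding R(2) by (auto simp: R(1) algebra_simps)
  }
  assume n: "n \<ge> m"
  have "T * geom d = fps_X ^ m * (fps_const A * geom d) + R * (geom d * ?g)"
    unfolding R(2) by (simp only: algebra_simps)
  then have "T * geom d = fps_X ^ m * (fps_const A * geom d) + R"
    by (simp only: geom_mult mult_1_right)
  moreover have "geom d = Abs_fps (\<lambda>n. d ^ n)"
    unfolding geom_def
  proof (rule fps_inverse_unique, rule fps_ext)
    show "fps_nth ((1 - fps_const d * fps_X) * Abs_fps (\<lambda>n. d ^ n)) k = fps_nth 1 k" for k
      by (cases k) (simp_all add: algebra_simps)
  qed
  ultimately show "fps_nth (T * geom d) n = A * d ^ (n - m)"
    using n by (simp add: fps_X_power_mult_nth R(1))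
qed

lemma nth_mult_at_ones:
  assumes "small y"
  shows "fps_nth (T * at_ones y) n = (\<Sum>\<beta> | weight \<beta> \<le> n. fps_nth (T * exp_coeff y \<beta>) n)"
proof -
  let ?W = "{\<beta>. weight \<beta> \<le> n}"
  have "(\<Sum>\<beta>\<in>?W. fps_nth (exp_coeff y \<beta>) (n - i)) = fps_nth (at_ones y) (n - i)" for i
    unfolding at_ones_def fps_nth_Abs_fps
    by (rule sum.mono_neutral_right)
      (use exp_coeff_small[OF assms] finite_weight_le in \<open>auto simp: not_le\<close>)
  then have "fps_nth (T * at_ones y) n =
      (\<Sum>i=0..n. \<Sum>\<beta>\<in>?W. fps_nth T i * fps_nth (exp_coeff y \<beta>) (n - i))"
    by (simp add: fps_mult_nth sum_distrib_left[symmetric])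
  also have "\<dots> = (\<Sum>\<beta>\<in>?W. fps_nth (T * exp_coeff y \<beta>) n)"
    unfolding fps_mult_nth by (rule sum.swap)
  finally show ?thesis .
qed

lemma mpow_fps_const: "mpow (\<lambda>i. fps_const (c i)) \<beta> = fps_const (mpow c \<beta>)"
  by (induction \<beta> rule: expo_induct) (simp_all only: mpow_step mpow_zero fps_const_mult fps_const_1_eq_1)

lemma mpow_X: "mpow (\<lambda>i. c i * fps_X ^ Suc i) \<beta> = mpow c \<beta> * fps_X ^ weight \<beta>"
  by (induction \<beta> rule: expo_induct)
    (simp_all add: mpow_step[unfolded One_nat_def] weight_add weight_single power_add mult_ac)

lemma exp_coeff_fps_const: "exp_coeff (\<lambda>i. fps_const (c i :: complex)) \<beta> = fps_const (exp_coeff c \<beta>)"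
proof -
  have "fps_const (prod F A) = (\<Prod>i\<in>A. fps_const (F i :: complex))" for F and A :: "nat set"
    by (induction A rule: infinite_finite_induct) (simp_all flip: fps_const_mult)
  then show ?thesis by (simp only: exp_coeff_def inverse_of_nat_scal fps_const_power fps_const_mult)
qed

lemma down_part_0: "fps_nth (down_part \<epsilon> i) 0 = 0"
  by (simp add: down_part_def fps_nth_power_0 del: power_Suc)

lemma exp_coeff_down_part_0:
  assumes "\<beta> \<noteq> 0"
  shows "fps_nth (exp_coeff (down_part \<epsilon>) \<beta>) 0 = 0"
  using assms
proof (induction \<beta> rule: expo_induct)
  case (step \<gamma> i)
  have "of_nat (Suc (lookup \<gamma> i)) * fps_nth (exp_coeff (down_part \<epsilon>) (Poly_Mapping.single i 1 + \<gamma>)) 0 = 0"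
    using arg_cong[OF exp_coeff_step[of \<gamma> i "down_part \<epsilon>"], of "\<lambda>f. fps_nth f 0"]
    by (simp add: down_part_0 del: of_nat_Suc flip: fps_of_nat)
  then show ?case by (simp del: of_nat_Suc)
qed simp

section \<open>The coefficient of a monomial as a sum over poles\<close>

text \<open>
  Up to the factor $(k \log q)^s / s!$, the coefficient of $t^\alpha$ in \<open>L_op l k\<close> applied to
  an exponential, divided by the exponential. The number \<open>l\<close> is replaced by a complex \<open>\<epsilon>\<close>,
  because the case \<open>l = 0\<close> is obtained as a limit.
\<close>

definition symbol :: "nat \<Rightarrow> (nat \<Rightarrow> complex) \<Rightarrow> complex \<Rightarrow> expo \<Rightarrow> nat \<Rightarrow> complex" where
  "symbol N \<rho> \<epsilon> \<alpha> s = (\<Sum>\<beta> | weight \<beta> \<le> s + weight \<alpha>. \<epsilon> ^ (s + weight \<alpha> - weight \<beta>) *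
     fps_nth (exp_coeff (up_part 1) \<alpha> * exp_coeff (down_part 1) \<beta>) (Suc (s + weight \<alpha> - weight \<beta>)) *
     mpow (psum N \<rho>) \<beta>)"

text \<open>The sum of the residues. The \<open>exp_coeff\<close> factor is the coefficient of
  t^\<alpha> in exp(sum_i t_i (mu^i - lambda^i)) with lambda at the pole and mu = lambda +
  \<epsilon>; the last factor is lambda^s.\<close>

definition shift_sum :: "nat \<Rightarrow> (nat \<Rightarrow> complex) \<Rightarrow> complex \<Rightarrow> expo \<Rightarrow> nat \<Rightarrow> complex" where
  "shift_sum N \<rho> \<epsilon> \<alpha> s = (\<Sum>a<2 * N. sg N a * wt N \<rho> a (\<rho> a + sg N a * \<epsilon>) *
     exp_coeff (\<lambda>i. (pole N \<rho> \<epsilon> a + \<epsilon>) ^ Suc i - pole N \<rho> \<epsilon> a ^ Suc i) \<alpha> * pole N \<rho> \<epsilon> a ^ s)"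

text \<open>Multiplied by \<epsilon>, the left side is a single coefficient, that of u^(s +
  \<open>weight \<alpha>\<close> + 1), in a polynomial times a rational function of u whose partial
  fractions are known. The factor \<epsilon> is cancelled at the end.\<close>

lemma symbol_nonzero:
  assumes "inj_on (pole N \<rho> \<epsilon>) {..<2 * N}" "\<epsilon> \<noteq> 0"
  shows "symbol N \<rho> \<epsilon> \<alpha> s = shift_sum N \<rho> \<epsilon> \<alpha> s"
proof -
  let ?D = "s + weight \<alpha>"
  let ?U = "exp_coeff (up_part \<epsilon>) \<alpha>"
  let ?y = "\<lambda>i. fps_const (psum N \<rho> i) * (fps_X ^ Suc i * down_part \<epsilon> i)"
  have ey: "exp_coeff ?y \<beta> = fps_const (mpow (psum N \<rho>) \<beta>) * fps_X ^ weight \<beta> * exp_coeff (down_part \<epsilon>) \<beta>" for \<beta>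
    using exp_coeff_mult[of "\<lambda>i. fps_const (psum N \<rho> i) * fps_X ^ Suc i" "down_part \<epsilon>" \<beta>]
    by (simp only: mpow_X mpow_fps_const mult.assoc)
  have nth: "fps_nth (?U * exp_coeff ?y \<beta>) n = mpow (psum N \<rho>) \<beta> *
      fps_nth (?U * exp_coeff (down_part \<epsilon>) \<beta>) (n - weight \<beta>)" if "weight \<beta> \<le> n" for \<beta> n
  proof -
    have "?U * exp_coeff ?y \<beta> = fps_const (mpow (psum N \<rho>) \<beta>) *
        (fps_X ^ weight \<beta> * (?U * exp_coeff (down_part \<epsilon>) \<beta>))"
      unfolding ey by (simp only: mult_ac)
    moreover have "fps_nth (fps_const c * (fps_X ^ weight \<beta> * Z)) n = c * fps_nth Z (n - weight \<beta>)" for c Z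
      using that by (simp add: fps_X_power_mult_nth)
    ultimately show ?thesis by (simp only:)
  qed
  have "\<epsilon> * symbol N \<rho> \<epsilon> \<alpha> s = (\<Sum>\<beta> | weight \<beta> \<le> ?D. mpow (psum N \<rho>) \<beta> *
      (\<epsilon> ^ Suc (?D - weight \<beta>) *
        fps_nth (exp_coeff (up_part 1) \<alpha> * exp_coeff (down_part 1) \<beta>) (Suc (?D - weight \<beta>))))"
    unfolding symbol_def sum_distrib_left by (rule sum.cong) (simp_all add: mult_ac)
  also have "\<dots> = (\<Sum>\<beta> | weight \<beta> \<le> ?D. fps_nth (?U * exp_coeff ?y \<beta>) (Suc ?D))"
    unfolding up_down_scale by (rule sum.cong) (auto simp: nth Suc_diff_le simp del: power_Suc)
  \<comment> \<open>Exponents of weight \<open>Suc ?D\<close> may be included: their terms contain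
    the constant term of \<open>exp_coeff (down_part \<epsilon>) \<beta>\<close>, which is 0. This
    gives the range required by \<open>nth_mult_at_ones\<close>.\<close>
  also have "\<dots> = (\<Sum>\<beta> | weight \<beta> \<le> Suc ?D. fps_nth (?U * exp_coeff ?y \<beta>) (Suc ?D))"
  proof (rule sum.mono_neutral_left)
    show "\<forall>\<beta>\<in>{\<beta>. weight \<beta> \<le> Suc ?D} - {\<beta>. weight \<beta> \<le> ?D}. fps_nth (?U * exp_coeff ?y \<beta>) (Suc ?D) = 0"
    proof
      fix \<beta> assume "\<beta> \<in> {\<beta>. weight \<beta> \<le> Suc ?D} - {\<beta>. weight \<beta> \<le> ?D}"
      then have "weight \<beta> = Suc ?D" by auto
      moreover from this have "\<beta> \<noteq> 0" by auto
      ultimately show "fps_nth (?U * exp_coeff ?y \<beta>) (Suc ?D) = 0"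
        by (simp add: nth exp_coeff_down_part_0 del: power_Suc)
    qed
  qed (auto simp: finite_weight_le)
  also have "\<dots> = fps_nth (?U * at_ones ?y) (Suc ?D)"
    by (rule nth_mult_at_ones[symmetric]) (rule at_ones_psum)
  also have "at_ones ?y = 1 + (\<Sum>a<2 * N. fps_const (sg N a * \<epsilon> * wt N \<rho> a (\<rho> a + sg N a * \<epsilon>)) *
      fps_X * geom (pole N \<rho> \<epsilon> a))"
    unfolding at_ones_psum by (subst partial_fractions_fps) (simp_all only: assms finite_lessThan pf_coeff_wt)
  also have "?U * \<dots> = ?U + (\<Sum>a<2 * N. fps_const (sg N a * \<epsilon> * wt N \<rho> a (\<rho> a + sg N a * \<epsilon>)) *
      (fps_X * (?U * geom (pole N \<rho> \<epsilon> a))))"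
    by (simp only: distrib_left sum_distrib_left mult_1 mult_1_right mult_ac)
  also have "fps_nth \<dots> (Suc ?D) = \<epsilon> * shift_sum N \<rho> \<epsilon> \<alpha> s"
  proof -
    \<comment> \<open>The summand 1 of the partial fractions contributes nothing, since
      \<open>?U\<close> has degree at most \<open>weight \<alpha>\<close>.\<close>
    have "fps_nth ?U (Suc ?D) = 0"
      by (rule homog_value_nth(1)[OF homog_value_exp_coeff[of 0]]) simp
    moreover have "fps_nth (?U * geom d) ?D = exp_coeff (\<lambda>i. (d + \<epsilon>) ^ Suc i - d ^ Suc i) \<alpha> * d ^ s" for d
      using homog_value_nth(2)[OF homog_value_exp_coeff, of \<alpha> ?D \<epsilon> d] by simp
    ultimately show ?thesis
      unfolding shift_sum_def sum_distrib_left
      by (simp add: fps_sum_nth del: power_Suc) (simp only: mult_ac)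
  qed
  finally show ?thesis using assms(2) by simp
qed

lemma continuous_exp_coeff:
  fixes f :: "nat \<Rightarrow> real \<Rightarrow> complex"
  assumes "\<And>i. isCont (f i) t"
  shows "isCont (\<lambda>t. exp_coeff (\<lambda>i. f i t) \<alpha>) t"
  unfolding exp_coeff_def by (intro continuous_intros assms)

text \<open>The left side is polynomial in t and the right side continuous at 0, so equality for t
  \<noteq> 0 extends to t = 0. Real t leave the imaginary parts unchanged, which keeps the poles
  distinct.\<close>

lemma symbol_shift_sum:
  assumes "generic N \<rho>"
  shows "symbol N \<rho> (of_real t) \<alpha> s = shift_sum N \<rho> (of_real t) \<alpha> s"
proof -
  let ?f = "\<lambda>t. symbol N \<rho> (of_real t) \<alpha> s" and ?g = "\<lambda>t. shift_sum N \<rho> (of_real t) \<alpha> s"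
  have nz: "?f t = ?g t" if "t \<noteq> 0" for t
  proof (rule symbol_nonzero)
    show "inj_on (pole N \<rho> (of_real t)) {..<2 * N}"
    proof (rule inj_onI)
      fix a b assume ab: "a \<in> {..<2 * N}" "b \<in> {..<2 * N}" "pole N \<rho> (of_real t) a = pole N \<rho> (of_real t) b"
      have "Im (pole N \<rho> (of_real t) a) = Im (\<rho> a)" for a by (simp add: pole_def)
      with ab(3) have "Im (\<rho> a) = Im (\<rho> b)" by metis
      with assms ab(1,2) show "a = b" by (auto simp: generic_def inj_on_def)
    qed
  qed (use that in simp)
  have pole: "isCont (\<lambda>t. pole N \<rho> (of_real t) a) 0" for a
    unfolding pole_def by (cases "a < N") (auto intro!: continuous_intros)
  have wt: "isCont (\<lambda>t. wt N \<rho> a (\<rho> a + sg N a * of_real t)) 0" if "a \<in> {..<2 * N}" for a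
    unfolding wt_def
  proof (rule continuous_prod)
    fix b assume "b \<in> {..<2 * N} - {a}"
    with that have "\<rho> a \<noteq> \<rho> b" using assms by (auto simp: generic_def inj_on_def)
    then show "isCont (\<lambda>t. if (a < N) = (b < N)
        then (\<rho> a + sg N a * of_real t - \<rho> b) / (\<rho> a - \<rho> b)
        else (\<rho> a - \<rho> b) / (\<rho> a + sg N a * of_real t - \<rho> b)) 0"
      by (cases "(a < N) = (b < N)") (auto intro!: continuous_intros)
  qed
  have "isCont ?f 0"
    unfolding symbol_def by (intro continuous_intros)
  moreover have "isCont ?g 0"
    unfolding shift_sum_def by (intro continuous_intros continuous_exp_coeff pole wt)
  ultimately have "?f \<midarrow>0\<rightarrow> ?f 0" "?g \<midarrow>0\<rightarrow> ?g 0"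
    by (auto simp: isCont_def)
  moreover have "?f \<midarrow>0\<rightarrow> l \<longleftrightarrow> ?g \<midarrow>0\<rightarrow> l" for l
    by (rule LIM_cong) (auto simp: nz)
  ultimately have "?f 0 = ?g 0"
    using LIM_unique by blast
  with nz show ?thesis by (cases "t = 0") auto
qed

subsection \<open>Linearity and continuity of the operators\<close>

lemma tcoeff_cscale: "tcoeff (cscale c f) \<gamma> = fps_const c * tcoeff f \<gamma>"
  by (simp add: cscale_def tcoeff_tconst_mult)

lemma tcoeff_tmono_mult: "tcoeff (tmono \<alpha> * f) (\<alpha> + \<delta>) = tcoeff f \<delta>"
proof -
  have "tcoeff (tmono \<alpha> * f) (\<alpha> + \<delta>) =
      (\<Sum>x\<in>{(\<alpha>', \<beta>). \<alpha>' + \<beta> = \<alpha> + \<delta>}. if x = (\<alpha>, \<delta>) then tcoeff f \<delta> else 0)"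
    unfolding tcoeff_mult by (rule sum.cong) (auto simp: tmono_def split: if_splits)
  then show ?thesis by (simp add: sum.delta[OF finite_antidiagonal])
qed

lemma tcoeff_tmono_mult_0:
  assumes "\<And>\<delta>. \<gamma> \<noteq> \<alpha> + \<delta>"
  shows "tcoeff (tmono \<alpha> * f) \<gamma> = 0"
  unfolding tcoeff_mult by (rule sum.neutral) (use assms in \<open>auto simp: tmono_def\<close>)

lemma tmono_mult: "tmono \<alpha> * tmono \<beta> = tmono (\<alpha> + \<beta>)"
proof (rule tps_eqI)
  fix \<gamma>
  show "tcoeff (tmono \<alpha> * tmono \<beta>) \<gamma> = tcoeff (tmono (\<alpha> + \<beta>) :: 'a tps) \<gamma>"
  proof (cases "\<exists>\<delta>. \<gamma> = \<alpha> + \<delta>")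
    case True
    then show ?thesis by (auto simp: tcoeff_tmono_mult) (auto simp: tmono_def)
  next
    case False
    then show ?thesis by (subst tcoeff_tmono_mult_0) (auto simp: tmono_def)
  qed
qed

lemma sum_tmono_mult:
  "(\<Sum>\<alpha> | weight \<alpha> \<le> weight \<gamma>. c \<alpha> * tcoeff (tmono \<alpha> * f) \<gamma>) = tcoeff (Abs_tps c * f) \<gamma>"
proof -
  let ?P = "{(\<alpha>, \<delta>). \<alpha> + \<delta> = \<gamma>}"
  have inj: "inj_on fst ?P" by (auto simp: inj_on_def)
  have "(\<Sum>\<alpha> | weight \<alpha> \<le> weight \<gamma>. c \<alpha> * tcoeff (tmono \<alpha> * f) \<gamma>) =
      (\<Sum>\<alpha>\<in>fst ` ?P. c \<alpha> * tcoeff (tmono \<alpha> * f) \<gamma>)"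
  proof (rule sum.mono_neutral_right[OF finite_weight_le])
    show "fst ` ?P \<subseteq> {\<alpha>. weight \<alpha> \<le> weight \<gamma>}" by (auto simp: weight_add)
    show "\<forall>\<alpha>\<in>{\<alpha>. weight \<alpha> \<le> weight \<gamma>} - fst ` ?P. c \<alpha> * tcoeff (tmono \<alpha> * f) \<gamma> = 0"
    proof
      fix \<alpha> assume "\<alpha> \<in> {\<alpha>. weight \<alpha> \<le> weight \<gamma>} - fst ` ?P"
      then have "\<gamma> \<noteq> \<alpha> + \<delta>" for \<delta> by force
      then show "c \<alpha> * tcoeff (tmono \<alpha> * f) \<gamma> = 0" by (simp add: tcoeff_tmono_mult_0)
    qed
  qed
  also have "\<dots> = (\<Sum>(\<alpha>, \<delta>)\<in>?P. c \<alpha> * tcoeff f \<delta>)"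
    unfolding sum.reindex[OF inj] by (rule sum.cong) (auto simp: tcoeff_tmono_mult)
  finally show ?thesis by (simp add: tcoeff_mult)
qed

lemma tderivs_add: "tderivs \<beta> (f + g) = tderivs \<beta> f + tderivs \<beta> g"
  by (rule tps_eqI) (simp add: tderivs_def algebra_simps)

lemma tderivs_tconst: "tderivs \<beta> (tconst c * f) = tconst c * tderivs \<beta> f"
  by (rule tps_eqI) (simp add: tderivs_def tcoeff_tconst_mult mult.left_commute)

lemma fsum_add:
  assumes "fsummable F" "fsummable G"
  shows "fsum (\<lambda>i. F i + G i) = fsum F + fsum G"
  by (rule tps_eqI, rule fps_ext)
    (use assms in \<open>auto simp: fsum_def fsummable_def intro!: Sum_any.distrib\<close>)

lemma fsum_tconst:
  assumes "fsummable F"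
  shows "fsum (\<lambda>i. tconst c * F i) = tconst c * fsum F"
proof (rule tps_eqI, rule fps_ext)
  fix \<gamma> N
  \<comment> \<open>The scalar \<open>c\<close> is itself a series in log q, so the coefficient at
    \<open>N\<close> sees those of \<open>F i\<close> at all orders up to \<open>N\<close>.\<close>
  let ?A = "\<Union>M\<le>N. {i. fps_nth (tcoeff (F i) \<gamma>) M \<noteq> 0}"
  have fin: "finite ?A" using assms by (auto simp: fsummable_def)
  have F: "Sum_any (\<lambda>i. fps_nth (tcoeff (F i) \<gamma>) M) = (\<Sum>i\<in>?A. fps_nth (tcoeff (F i) \<gamma>) M)" if "M \<le> N" for M
    by (rule Sum_any.expand_superset[OF fin]) (use that in auto)
  have "fps_nth (tcoeff (fsum (\<lambda>i. tconst c * F i)) \<gamma>) N =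
      Sum_any (\<lambda>i. \<Sum>M=0..N. fps_nth c M * fps_nth (tcoeff (F i) \<gamma>) (N - M))"
    by (simp add: fsum_def tcoeff_tconst_mult fps_mult_nth)
  also have "\<dots> = (\<Sum>i\<in>?A. \<Sum>M=0..N. fps_nth c M * fps_nth (tcoeff (F i) \<gamma>) (N - M))"
    by (rule Sum_any.expand_superset[OF fin])
      (force elim: sum.not_neutral_contains_not_neutral)
  also have "\<dots> = (\<Sum>M=0..N. fps_nth c M * (\<Sum>i\<in>?A. fps_nth (tcoeff (F i) \<gamma>) (N - M)))"
    by (subst sum.swap) (simp add: sum_distrib_left)
  also have "\<dots> = (\<Sum>M=0..N. fps_nth c M * Sum_any (\<lambda>i. fps_nth (tcoeff (F i) \<gamma>) (N - M)))"
    by (rule sum.cong) (simp_all add: F)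
  finally show "fps_nth (tcoeff (fsum (\<lambda>i. tconst c * F i)) \<gamma>) N = fps_nth (tcoeff (tconst c * fsum F) \<gamma>) N"
    by (simp add: fsum_def tcoeff_tconst_mult fps_mult_nth)
qed

lemma W_gen_add: "W_gen p s (f + g) = W_gen p s f + W_gen p s g"
  unfolding W_gen_def W_hat_def fsum_add[OF W_hat_summable W_hat_summable, symmetric]
  by (simp add: case_prod_unfold tderivs_add cscale_def algebra_simps)

lemma W_gen_tconst: "W_gen p s (tconst c * f) = tconst c * W_gen p s f"
  unfolding W_gen_def W_hat_def fsum_tconst[OF W_hat_summable, symmetric]
  by (simp add: case_prod_unfold tderivs_tconst cscale_def mult.left_commute)

definition low :: "nat \<Rightarrow> funs \<Rightarrow> bool" where
  "low D f \<longleftrightarrow> (\<forall>\<gamma> N. weight \<gamma> + N \<le> D \<longrightarrow> fps_nth (tcoeff f \<gamma>) N = 0)"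

text \<open>
  The filtration by weight in the times plus order in $\log q$ is preserved, since the term of
  $W_s^{(p+1)}$ that comes with $(\log q)^s$ lowers the weight by at most \<open>s\<close>.
\<close>

definition filtered_linear :: "(funs \<Rightarrow> funs) \<Rightarrow> bool" where
  "filtered_linear A \<longleftrightarrow> (\<forall>f g. A (f + g) = A f + A g) \<and>
     (\<forall>c f. A (tconst c * f) = tconst c * A f) \<and> (\<forall>D f. low D f \<longrightarrow> low D (A f))"

lemma L_term_nth:
  "fps_nth (tcoeff (L_term l k p s f) \<gamma>) N = (if s \<le> N then of_nat l ^ p * of_nat k ^ s /
     (fact p * fact s * of_nat (Suc p)) * fps_nth (tcoeff (W_gen p s f) \<gamma>) (N - s) else 0)"
proof -
  have "tcoeff (L_term l k p s f) \<gamma> = fps_X ^ s * (fps_const (of_nat l ^ p * of_nat k ^ s *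
      (1 / (fact p * fact s)) * (1 / of_nat (p + 1))) * tcoeff (W_gen p s f) \<gamma>)"
    unfolding L_term_def cscale_def tcoeff_tconst_mult fps_const_mult[symmetric] fps_const_power[symmetric]
    by (simp add: log_q_def power_mult_distrib mult_ac fps_of_nat del: fps_const_mult fps_const_power)
  then show ?thesis by (simp add: fps_X_power_mult_nth)
qed

lemma low_L_op:
  assumes "low D f"
  shows "low D (L_op l k f)"
  unfolding low_def
proof (intro allI impI)
  fix \<gamma> N assume D: "weight \<gamma> + N \<le> D"
  have "fps_nth (tcoeff (cscale (W_hat_coeff (Suc p) (int s - int p) \<alpha> \<beta>) (tmono \<alpha> * tderivs \<beta> f)) \<gamma>) (N - s) = 0"
    if "s \<le> N" for p s \<alpha> \<beta>
  proof (cases "W_hat_coeff (Suc p) (int s - int p) \<alpha> \<beta> = 0 \<or> (\<forall>\<delta>. \<gamma> \<noteq> \<alpha> + \<delta>)")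
    case True
    then show ?thesis by (auto simp: tcoeff_cscale tcoeff_tmono_mult_0)
  next
    case False
    then obtain \<delta> where \<delta>: "\<gamma> = \<alpha> + \<delta>" by blast
    have "int (weight \<beta>) = int (weight \<alpha>) + (int s - int p)"
      using False W_hat_coeff_nonzero by blast
    then have "weight (\<delta> + \<beta>) + (N - s) \<le> D"
      using D that by (auto simp: \<delta> weight_add)
    with assms have z: "fps_nth (tcoeff f (\<delta> + \<beta>)) (N - s) = 0" by (simp add: low_def)
    have "fps_nth (tcoeff (tderivs \<beta> f) \<delta>) (N - s) = 0"
      unfolding tderivs_def tcoeff_Abs_tps by (simp only: fps_of_nat[symmetric] fps_mult_left_const_nth z mult_zero_right)
    then show ?thesis by (simp add: \<delta> tcoeff_cscale tcoeff_tmono_mult)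
  qed
  then have "fps_nth (tcoeff (W_gen p s f) \<gamma>) (N - s) = 0" if "s \<le> N" for p s
    using that by (simp add: W_gen_def W_hat_def fsum_def case_prod_unfold)
  then show "fps_nth (tcoeff (L_op l k f) \<gamma>) N = 0"
    by (simp add: L_op_def fsum_def case_prod_unfold L_term_nth cong: if_cong)
qed

lemma filtered_linear_L_op: "filtered_linear (L_op l k)"
  unfolding filtered_linear_def
proof (intro conjI allI impI)
  show "L_op l k (f + g) = L_op l k f + L_op l k g" for f g
    unfolding L_op_def fsum_add[OF L_op_summable L_op_summable, symmetric]
    by (simp add: case_prod_unfold L_term_def W_gen_add cscale_def algebra_simps)
  show "L_op l k (tconst c * f) = tconst c * L_op l k f" for c f
    unfolding L_op_def fsum_tconst[OF L_op_summable, symmetric]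
    by (simp add: case_prod_unfold L_term_def W_gen_tconst cscale_def mult.left_commute)
qed (rule low_L_op)

subsection \<open>The action on exponentials\<close>

definition exp_points :: "nat \<Rightarrow> (nat \<Rightarrow> complex) \<Rightarrow> funs" where
  "exp_points N \<rho> = expT (\<lambda>i. fps_const (psum N \<rho> i))"

lemma tcoeff_E: "tcoeff (exp_points N \<rho>) \<gamma> = fps_const (exp_coeff (psum N \<rho>) \<gamma>)"
  by (simp add: exp_points_def exp_coeff_fps_const)

lemma tcoeff_tmono_E: "\<exists>c. tcoeff (tmono \<alpha> * exp_points N \<rho>) \<gamma> = fps_const c"
proof (cases "\<exists>\<delta>. \<gamma> = \<alpha> + \<delta>")
  case False
  then have "tcoeff (tmono \<alpha> * exp_points N \<rho>) \<gamma> = fps_const 0" by (simp add: tcoeff_tmono_mult_0)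
  then show ?thesis by blast
qed (auto simp: tcoeff_tmono_mult tcoeff_E)

text \<open>The coefficients of an exponential are constant in log q, so only order 0 survives. At
  order M of \<open>L_op\<close> this leaves the terms with s = M.\<close>

lemma W_gen_E_nth:
  fixes \<rho> :: "nat \<Rightarrow> complex" and N :: nat
  defines "e \<equiv> \<lambda>\<alpha> \<gamma>. fps_nth (tcoeff (tmono \<alpha> * exp_points N \<rho>) \<gamma>) 0"
  shows "fps_nth (tcoeff (W_gen p s (exp_points N \<rho>)) \<gamma>) M = (if M = 0 then
      \<Sum>\<alpha> | weight \<alpha> \<le> weight \<gamma>. \<Sum>\<beta> | weight \<beta> \<le> s + weight \<gamma>.
        W_hat_coeff (Suc p) (int s - int p) \<alpha> \<beta> * mpow (psum N \<rho>) \<beta> * e \<alpha> \<gamma> else 0)"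
proof -
  let ?w = "\<lambda>\<alpha> \<beta>. W_hat_coeff (Suc p) (int s - int p) \<alpha> \<beta>"
  let ?S = "{\<alpha>. weight \<alpha> \<le> weight \<gamma>} \<times> {\<beta>. weight \<beta> \<le> s + weight \<gamma>}"
  have t: "fps_nth (tcoeff (cscale (?w \<alpha> \<beta>) (tmono \<alpha> * tderivs \<beta> (exp_points N \<rho>))) \<gamma>) M =
      (if M = 0 then ?w \<alpha> \<beta> * mpow (psum N \<rho>) \<beta> * e \<alpha> \<gamma> else 0)" for \<alpha> \<beta>
  proof -
    obtain c where c: "tcoeff (tmono \<alpha> * exp_points N \<rho>) \<gamma> = fps_const c" using tcoeff_tmono_E by blast
    have "tmono \<alpha> * tderivs \<beta> (exp_points N \<rho>) = tconst (fps_const (mpow (psum N \<rho>) \<beta>)) * (tmono \<alpha> * exp_points N \<rho>)"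
      by (simp add: exp_points_def tderivs_expT mpow_fps_const mult_ac)
    then show ?thesis by (simp only: tcoeff_cscale tcoeff_tconst_mult c e_def) simp
  qed
  have fin: "finite ?S" by (intro finite_cartesian_product finite_weight_le)
  have "fps_nth (tcoeff (W_gen p s (exp_points N \<rho>)) \<gamma>) M =
      Sum_any (\<lambda>(\<alpha>, \<beta>). fps_nth (tcoeff (cscale (?w \<alpha> \<beta>) (tmono \<alpha> * tderivs \<beta> (exp_points N \<rho>))) \<gamma>) M)"
    by (simp add: W_gen_def W_hat_def fsum_def case_prod_unfold)
  also have "\<dots> = (\<Sum>(\<alpha>, \<beta>)\<in>?S. fps_nth (tcoeff (cscale (?w \<alpha> \<beta>) (tmono \<alpha> * tderivs \<beta> (exp_points N \<rho>))) \<gamma>) M)"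
  proof -
    have "weight \<alpha> \<le> weight \<gamma> \<and> weight \<beta> \<le> s + weight \<gamma>"
      if "fps_nth (tcoeff (cscale (?w \<alpha> \<beta>) (tmono \<alpha> * tderivs \<beta> (exp_points N \<rho>))) \<gamma>) M \<noteq> 0" for \<alpha> \<beta>
    proof -
      from that have "tcoeff (cscale (?w \<alpha> \<beta>) (tmono \<alpha> * tderivs \<beta> (exp_points N \<rho>))) \<gamma> \<noteq> 0" by auto
      from W_hat_term_nonzero[OF this] show ?thesis by auto
    qed
    then show ?thesis by (intro Sum_any.expand_superset[OF fin]) auto
  qed
  finally show ?thesis by (auto simp: t sum.cartesian_product)
qed

text \<open>For sign +, \<open>pole\<close> and \<open>pole + \<epsilon>\<close> are the old and the
  new position. For sign - they are the new and the old one, and \<open>sg\<close> reverses the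
  difference.\<close>

lemma psum_update:
  assumes "a < 2 * N"
  shows "psum N (\<rho>(a := \<rho> a + sg N a * \<epsilon>)) i =
    ((pole N \<rho> \<epsilon> a + \<epsilon>) ^ Suc i - pole N \<rho> \<epsilon> a ^ Suc i) + psum N \<rho> i"
proof -
  have "psum N \<rho>' i = sg N a * \<rho>' a ^ Suc i + (\<Sum>b\<in>{..<2 * N} - {a}. sg N b * \<rho>' b ^ Suc i)" for \<rho>'
    unfolding psum_def by (rule sum.remove) (use assms in auto)
  note this[of \<rho>] this[of "\<rho>(a := \<rho> a + sg N a * \<epsilon>)"]
  moreover have "(\<Sum>b\<in>{..<2 * N} - {a}. sg N b * (\<rho>(a := \<rho> a + sg N a * \<epsilon>)) b ^ Suc i) =
      (\<Sum>b\<in>{..<2 * N} - {a}. sg N b * \<rho> b ^ Suc i)"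
    by (rule sum.cong) auto
  ultimately show ?thesis by (simp add: sg_def pole_def del: power_Suc)
qed

lemma E_update:
  assumes "a < 2 * N"
  shows "exp_points N (\<rho>(a := \<rho> a + sg N a * \<epsilon>)) =
    expT (\<lambda>i. fps_const ((pole N \<rho> \<epsilon> a + \<epsilon>) ^ Suc i - pole N \<rho> \<epsilon> a ^ Suc i)) * exp_points N \<rho>"
  unfolding exp_points_def psum_update[OF assms] expT_add[symmetric] by simp

text \<open>At order M in log q the residue at a pole d comes with k^M d^M / M!, and these are the
  coefficients of \<open>fps_exp (k * d)\<close>, that is, of q^(k d).\<close>

lemma L_op_E:
  assumes "generic N \<rho>"
  shows "L_op l k (exp_points N \<rho>) = (\<Sum>a<2 * N.
    tconst (fps_const (sg N a * wt N \<rho> a (\<rho> a + sg N a * of_nat l)) *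
      fps_exp (of_nat k * pole N \<rho> (of_nat l) a)) * exp_points N (\<rho>(a := \<rho> a + sg N a * of_nat l)))"
proof (rule tps_eqI, rule fps_ext)
  fix \<gamma> M
  let ?l = "of_nat l :: complex"
  let ?e = "\<lambda>\<alpha>. fps_nth (tcoeff (tmono \<alpha> * exp_points N \<rho>) \<gamma>) 0"
  let ?c = "\<lambda>\<alpha> \<beta> p. fps_nth (exp_coeff (up_part 1) \<alpha> * exp_coeff (down_part 1) \<beta>) (Suc p)"
  let ?x = "\<lambda>a i. (pole N \<rho> ?l a + ?l) ^ Suc i - pole N \<rho> ?l a ^ Suc i"
  let ?P = "{..M + weight \<gamma>}" and ?W = "{\<alpha>. weight \<alpha> \<le> weight \<gamma>}"
  let ?V = "{\<beta>. weight \<beta> \<le> M + weight \<gamma>}"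
  let ?T = "\<lambda>p s. fps_nth (tcoeff (L_term l k p s (exp_points N \<rho>)) \<gamma>) M"
  have supp: "s = M \<and> p \<le> M + weight \<gamma>" if "?T p s \<noteq> 0" for p s
  proof -
    from that have "s \<le> M" and nz: "fps_nth (tcoeff (W_gen p s (exp_points N \<rho>)) \<gamma>) (M - s) \<noteq> 0"
      by (auto simp: L_term_nth split: if_splits)
    then have "s = M" using W_gen_E_nth[of p s N \<rho> \<gamma> "M - s"] by (auto split: if_splits)
    moreover have "tcoeff (W_gen p s (exp_points N \<rho>)) \<gamma> \<noteq> 0" using nz by auto
    then have "p \<le> s + weight \<gamma>" by (rule W_gen_nonzero)
    ultimately show ?thesis by simp
  qed
  have "fps_nth (tcoeff (L_op l k (exp_points N \<rho>)) \<gamma>) M = Sum_any (\<lambda>(p, s). ?T p s)"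
    by (simp add: L_op_def fsum_def case_prod_unfold)
  also have "\<dots> = (\<Sum>(p, s)\<in>?P \<times> {M}. ?T p s)"
    by (rule Sum_any.expand_superset) (use supp in auto)
  also have "\<dots> = (\<Sum>p\<in>?P. ?T p M)"
    by (simp flip: sum.cartesian_product)
  also have "\<dots> = (\<Sum>p\<in>?P. of_nat k ^ M / fact M * (\<Sum>\<alpha>\<in>?W. \<Sum>\<beta>\<in>?V.
      if weight \<beta> + p = M + weight \<alpha> then ?l ^ p * ?c \<alpha> \<beta> p * mpow (psum N \<rho>) \<beta> * ?e \<alpha> else 0))"
  proof (rule sum.cong[OF refl])
    fix p
    have w: "W_hat_coeff (Suc p) (int M - int p) \<alpha> \<beta> =
        (if weight \<beta> + p = M + weight \<alpha> then fact (Suc p) * ?c \<alpha> \<beta> p else 0)" for \<alpha> \<beta>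
      by (auto simp: W_hat_coeff_eq simp del: fact_Suc)
    have "?T p M = of_nat l ^ p * of_nat k ^ M / (fact p * fact M * of_nat (Suc p)) *
        (\<Sum>\<alpha>\<in>?W. \<Sum>\<beta>\<in>?V. (if weight \<beta> + p = M + weight \<alpha> then fact (Suc p) * ?c \<alpha> \<beta> p else 0) *
          mpow (psum N \<rho>) \<beta> * ?e \<alpha>)"
      unfolding L_term_nth w[symmetric] by (simp add: W_gen_E_nth)
    \<comment> \<open>The factor (p+1)! of \<open>W_hat_coeff\<close> cancels p! and the denominator
      p + 1, so that only l^p is left.\<close>
    also have "\<dots> = of_nat k ^ M / fact M * (\<Sum>\<alpha>\<in>?W. \<Sum>\<beta>\<in>?V.
        if weight \<beta> + p = M + weight \<alpha> then ?l ^ p * ?c \<alpha> \<beta> p * mpow (psum N \<rho>) \<beta> * ?e \<alpha> else 0)"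
      unfolding sum_distrib_left
      by (intro sum.cong refl) (auto simp: field_simps simp del: of_nat_Suc)
    finally show "?T p M = \<dots>" .
  qed
  also have "\<dots> = of_nat k ^ M / fact M * (\<Sum>\<alpha>\<in>?W. \<Sum>\<beta>\<in>?V. \<Sum>p\<in>?P.
      if weight \<beta> + p = M + weight \<alpha> then ?l ^ p * ?c \<alpha> \<beta> p * mpow (psum N \<rho>) \<beta> * ?e \<alpha> else 0)"
    unfolding sum_distrib_left[symmetric]
    by (subst sum.swap, subst (2) sum.swap) simp
  also have "\<dots> = of_nat k ^ M / fact M * (\<Sum>\<alpha>\<in>?W. symbol N \<rho> (of_real (real l)) \<alpha> M * ?e \<alpha>)"
  proof (intro arg_cong2[where f = "(*)"] refl sum.cong)
    fix \<alpha> assume \<alpha>: "\<alpha> \<in> ?W"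
    \<comment> \<open>The weights determine p from \<alpha> and \<beta>, so the sum over p collapses
      and \<open>symbol\<close> appears.\<close>
    have "(\<Sum>\<beta>\<in>?V. \<Sum>p\<in>?P. if weight \<beta> + p = M + weight \<alpha>
          then ?l ^ p * ?c \<alpha> \<beta> p * mpow (psum N \<rho>) \<beta> * ?e \<alpha> else 0) =
        (\<Sum>\<beta>\<in>?V. if weight \<beta> \<le> M + weight \<alpha> then
          ?l ^ (M + weight \<alpha> - weight \<beta>) * ?c \<alpha> \<beta> (M + weight \<alpha> - weight \<beta>) * mpow (psum N \<rho>) \<beta> * ?e \<alpha>
          else 0)"
    proof (rule sum.cong[OF refl])
      fix \<beta>
      have "(weight \<beta> + p = M + weight \<alpha>) = (p = M + weight \<alpha> - weight \<beta> \<and> weight \<beta> \<le> M + weight \<alpha>)" for p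
        by auto
      then show "(\<Sum>p\<in>?P. if weight \<beta> + p = M + weight \<alpha>
            then ?l ^ p * ?c \<alpha> \<beta> p * mpow (psum N \<rho>) \<beta> * ?e \<alpha> else 0) =
          (if weight \<beta> \<le> M + weight \<alpha> then
            ?l ^ (M + weight \<alpha> - weight \<beta>) * ?c \<alpha> \<beta> (M + weight \<alpha> - weight \<beta>) * mpow (psum N \<rho>) \<beta> * ?e \<alpha>
            else 0)"
        using \<alpha> by (cases "weight \<beta> \<le> M + weight \<alpha>") (auto simp: sum.delta)
    qed
    also have "\<dots> = (\<Sum>\<beta> | weight \<beta> \<le> M + weight \<alpha>.
        ?l ^ (M + weight \<alpha> - weight \<beta>) * ?c \<alpha> \<beta> (M + weight \<alpha> - weight \<beta>) * mpow (psum N \<rho>) \<beta> * ?e \<alpha>)"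
      by (rule sum.mono_neutral_cong_right) (use \<alpha> finite_weight_le in auto)
    finally show "(\<Sum>\<beta>\<in>?V. \<Sum>p\<in>?P. if weight \<beta> + p = M + weight \<alpha>
          then ?l ^ p * ?c \<alpha> \<beta> p * mpow (psum N \<rho>) \<beta> * ?e \<alpha> else 0) =
        symbol N \<rho> (of_real (real l)) \<alpha> M * ?e \<alpha>"
      by (simp add: symbol_def sum_distrib_right)
  qed
  also have "\<dots> = of_nat k ^ M / fact M * (\<Sum>\<alpha>\<in>?W. shift_sum N \<rho> ?l \<alpha> M * ?e \<alpha>)"
    unfolding symbol_shift_sum[OF assms] by simp
  also have "\<dots> = of_nat k ^ M / fact M * (\<Sum>a<2 * N. sg N a * wt N \<rho> a (\<rho> a + sg N a * ?l) *
      pole N \<rho> ?l a ^ M * (\<Sum>\<alpha>\<in>?W. exp_coeff (?x a) \<alpha> * ?e \<alpha>))"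
    unfolding shift_sum_def sum_distrib_left sum_distrib_right
    by (subst sum.swap) (simp only: mult_ac)
  also have "\<dots> = of_nat k ^ M / fact M * (\<Sum>a<2 * N. sg N a * wt N \<rho> a (\<rho> a + sg N a * ?l) *
      pole N \<rho> ?l a ^ M * fps_nth (tcoeff (exp_points N (\<rho>(a := \<rho> a + sg N a * ?l))) \<gamma>) 0)"
  proof (intro arg_cong2[where f = "(*)"] refl sum.cong)
    fix a assume "a \<in> {..<2 * N}"
    then have "exp_points N (\<rho>(a := \<rho> a + sg N a * ?l)) = Abs_tps (\<lambda>\<alpha>. fps_const (exp_coeff (?x a) \<alpha>)) * exp_points N \<rho>"
      by (simp add: E_update expT_def flip: exp_coeff_fps_const)
    then show "(\<Sum>\<alpha>\<in>?W. exp_coeff (?x a) \<alpha> * ?e \<alpha>) = fps_nth (tcoeff (exp_points N (\<rho>(a := \<rho> a + sg N a * ?l))) \<gamma>) 0"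
      by (simp only: sum_tmono_mult[symmetric] fps_sum_nth fps_mult_left_const_nth)
  qed
  also have "\<dots> = fps_nth (tcoeff (\<Sum>a<2 * N.
    tconst (fps_const (sg N a * wt N \<rho> a (\<rho> a + sg N a * ?l)) *
      fps_exp (of_nat k * pole N \<rho> ?l a)) * exp_points N (\<rho>(a := \<rho> a + sg N a * ?l))) \<gamma>) M"
    unfolding tcoeff_sum fps_sum_nth sum_distrib_left
    by (rule sum.cong[OF refl]) (simp add: tcoeff_tconst_mult tcoeff_E power_mult_distrib)
  finally show "fps_nth (tcoeff (L_op l k (exp_points N \<rho>)) \<gamma>) M = \<dots>" .
qed

subsection \<open>Exponentials separate the operators\<close>

lemma low_mult: "low D f \<Longrightarrow> low D (g * f)"
  unfolding low_def
proof (intro allI impI)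
  fix \<gamma> N assume f: "\<forall>\<gamma> N. weight \<gamma> + N \<le> D \<longrightarrow> fps_nth (tcoeff f \<gamma>) N = 0" and D: "weight \<gamma> + N \<le> D"
  have "fps_nth (tcoeff g \<alpha> * tcoeff f \<beta>) N = 0" if "\<alpha> + \<beta> = \<gamma>" for \<alpha> \<beta>
    unfolding fps_mult_nth
    by (rule sum.neutral) (use f D that in \<open>auto simp: weight_add[of \<alpha> \<beta>, unfolded that]\<close>)
  then show "fps_nth (tcoeff (g * f) \<gamma>) N = 0"
    by (auto simp: tcoeff_mult fps_sum_nth intro!: sum.neutral)
qed

lemma low_diff: "low D f \<Longrightarrow> low D g \<Longrightarrow> low D (f - g)"
  by (simp add: low_def)

lemma filtered_linearD:
  assumes "filtered_linear A"
  shows "A (f + g) = A f + A g" "A (tconst c * f) = tconst c * A f" "low D f \<Longrightarrow> low D (A f)"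
    "A 0 = 0" "A (f - g) = A f - A g" "A (sum F I) = (\<Sum>i\<in>I. A (F i))"
proof -
  show add: "A (f + g) = A f + A g" for f g using assms by (simp add: filtered_linear_def)
  show "A (tconst c * f) = tconst c * A f" "low D f \<Longrightarrow> low D (A f)"
    using assms by (simp_all add: filtered_linear_def)
  show 0: "A 0 = 0" by (metis add add.right_neutral add_left_cancel)
  show "A (f - g) = A f - A g" using add[of "f - g" g] by simp
  show "A (sum F I) = (\<Sum>i\<in>I. A (F i))"
    by (induction I rule: infinite_finite_induct) (simp_all add: 0 add)
qed

lemma filtered_linear_comp:
  "filtered_linear A \<Longrightarrow> filtered_linear B \<Longrightarrow> filtered_linear (\<lambda>f. A (B f))"
  by (simp add: filtered_linear_def)

lemma filtered_linear_diff:
  "filtered_linear A \<Longrightarrow> filtered_linear B \<Longrightarrow> filtered_linear (\<lambda>f. A f - B f)"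
  by (simp add: filtered_linear_def low_diff algebra_simps)

lemma filtered_linear_tconst: "filtered_linear A \<Longrightarrow> filtered_linear (\<lambda>f. tconst c * A f)"
  by (simp add: filtered_linear_def low_mult distrib_left mult.left_commute)

definition point_exp :: "complex \<Rightarrow> complex \<Rightarrow> funs" where
  "point_exp \<sigma> r = expT (\<lambda>i. fps_const (\<sigma> * r ^ Suc i))"

text \<open>The coefficient of r^j in \<open>point_exp \<sigma> r\<close>. For \<sigma> = 1 it is
  the elementary Schur polynomial in the times, which is the complete homogeneous function when each
  time is a power sum divided by its index.\<close>

definition hs :: "complex \<Rightarrow> nat \<Rightarrow> funs" where
  "hs \<sigma> j = Abs_tps (\<lambda>\<gamma>. if weight \<gamma> = j then fps_const (exp_coeff (\<lambda>_. \<sigma>) \<gamma>) else 0)"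

lemma hs_0: "hs \<sigma> 0 = 1"
  by (rule tps_eqI) (auto simp: hs_def tcoeff_one weight_eq_0)

lemma expT_sum: "expT (\<lambda>i. \<Sum>a\<in>A. y a i) = (\<Prod>a\<in>A. expT (y a))"
  by (induction A rule: infinite_finite_induct) (simp_all add: expT_0 expT_add)

lemma E_prod: "exp_points N \<rho> = (\<Prod>a<2 * N. point_exp (sg N a) (\<rho> a))"
proof -
  have "fps_const (psum N \<rho> i) = (\<Sum>a<2 * N. fps_const (sg N a * \<rho> a ^ Suc i))" for i
    unfolding psum_def by (rule fps_ext) (simp add: fps_sum_nth)
  then show ?thesis unfolding exp_points_def point_exp_def by (simp only: expT_sum)
qed

lemma point_exp_tail: "low D (point_exp \<sigma> r - (\<Sum>j\<le>D. tconst (fps_const (r ^ j)) * hs \<sigma> j))"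
proof -
  have ec: "exp_coeff (\<lambda>i. \<sigma> * r ^ Suc i) \<gamma> = r ^ weight \<gamma> * exp_coeff (\<lambda>_. \<sigma>) \<gamma>" for \<gamma>
    using exp_coeff_mult[of "\<lambda>i. r ^ Suc i" "\<lambda>_. \<sigma>" \<gamma>]
    by (simp only: mpow_def weight_def power_sum power_mult mult.commute[of \<sigma>])
  have "tcoeff (point_exp \<sigma> r) \<gamma> = tcoeff (\<Sum>j\<le>D. tconst (fps_const (r ^ j)) * hs \<sigma> j) \<gamma>" if "weight \<gamma> \<le> D" for \<gamma>
  proof -
    have "tcoeff (\<Sum>j\<le>D. tconst (fps_const (r ^ j)) * hs \<sigma> j) \<gamma> =
        (\<Sum>j\<le>D. if j = weight \<gamma> then fps_const (r ^ weight \<gamma>) * fps_const (exp_coeff (\<lambda>_. \<sigma>) \<gamma>) else 0)"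
      unfolding tcoeff_sum by (rule sum.cong) (auto simp: tcoeff_tconst_mult hs_def)
    with that show ?thesis by (simp add: point_exp_def exp_coeff_fps_const ec del: power_Suc)
  qed
  then show ?thesis by (simp add: low_def)
qed

text \<open>Modulo the filtration \<open>point_exp\<close> is a polynomial in r, hence so is any
  fixed coefficient of the image under \<open>A\<close>. With infinitely many roots it has only zero
  coefficients.\<close>

lemma point_exp_coeffs_vanish:
  assumes A: "filtered_linear A" and "infinite S" and 0: "\<And>r. r \<in> S \<Longrightarrow> A (point_exp \<sigma> r * G) = 0"
  shows "A (hs \<sigma> j * G) = 0"
proof (rule tps_eqI, rule fps_ext)
  fix \<gamma> N
  \<comment> \<open>The summand \<open>j\<close> puts the wanted index into the range of the
    truncation.\<close>
  define D where "D = weight \<gamma> + N + j"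
  let ?c = "\<lambda>i. fps_nth (tcoeff (A (hs \<sigma> i * G)) \<gamma>) N"
  have "(\<Sum>i\<le>D. ?c i * r ^ i) = 0" if "r \<in> S" for r
  proof -
    let ?t = "point_exp \<sigma> r - (\<Sum>j\<le>D. tconst (fps_const (r ^ j)) * hs \<sigma> j)"
    have "point_exp \<sigma> r * G = (\<Sum>i\<le>D. tconst (fps_const (r ^ i)) * (hs \<sigma> i * G)) + G * ?t"
      by (simp add: algebra_simps sum_distrib_left)
    then have "0 = A ((\<Sum>i\<le>D. tconst (fps_const (r ^ i)) * (hs \<sigma> i * G)) + G * ?t)"
      using 0[OF that] by simp
    also have "\<dots> = (\<Sum>i\<le>D. tconst (fps_const (r ^ i)) * A (hs \<sigma> i * G)) + A (G * ?t)"
      by (simp only: filtered_linearD[OF A])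
    finally have "fps_nth (tcoeff ((\<Sum>i\<le>D. tconst (fps_const (r ^ i)) * A (hs \<sigma> i * G)) + A (G * ?t)) \<gamma>) N = 0"
      by (metis fps_zero_nth tcoeff_zero)
    moreover have "low D (A (G * ?t))"
      by (intro filtered_linearD[OF A] low_mult point_exp_tail)
    then have "fps_nth (tcoeff (A (G * ?t)) \<gamma>) N = 0" by (simp add: low_def D_def)
    ultimately show ?thesis by (simp add: fps_sum_nth tcoeff_tconst_mult mult.commute)
  qed
  then have "S \<subseteq> {r. (\<Sum>i\<le>D. ?c i * r ^ i) = 0}" by auto
  with \<open>infinite S\<close> have "infinite {r. (\<Sum>i\<le>D. ?c i * r ^ i) = 0}" using finite_subset by blast
  then have "\<forall>i\<le>D. ?c i = 0" using polyfun_finite_roots[of ?c D] by blast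
  then show "fps_nth (tcoeff (A (hs \<sigma> j * G)) \<gamma>) N = fps_nth (tcoeff 0 \<gamma>) N"
    by (simp add: D_def)
qed

lemma infinite_avoiding_Im:
  assumes "finite F"
  shows "infinite {r. Im r \<notin> F}"
proof
  assume "finite {r. Im r \<notin> F}"
  moreover have "- F \<subseteq> Im ` {r. Im r \<notin> F}"
  proof
    fix x assume "x \<in> - F"
    then show "x \<in> Im ` {r. Im r \<notin> F}" by (intro image_eqI[of _ _ "Complex 0 x"]) auto
  qed
  ultimately have "finite (- F)" by (metis finite_imageI finite_subset)
  with assms have "finite (UNIV :: real set)" by (metis finite_Un Compl_partition)
  then show False by (simp add: infinite_UNIV_char_0)
qed

text \<open>The points are traded for factors \<open>hs\<close> one at a time. The point being
  traded only has to avoid the imaginary parts of those still present, so infinitely many positions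
  are available.\<close>

lemma hs_products_vanish:
  fixes N :: nat
  assumes A: "filtered_linear A" and 0: "\<And>N \<rho>. generic N \<rho> \<Longrightarrow> A (exp_points N \<rho>) = 0"
  shows "A (\<Prod>a<N. hs 1 (js a)) = 0"
proof -
  have main: "A ((\<Prod>a<m. hs (sg N a) (js a)) * (\<Prod>a\<in>{m..<2 * N}. point_exp (sg N a) (\<rho> a))) = 0"
    if "m \<le> 2 * N" "inj_on (\<lambda>a. Im (\<rho> a)) {m..<2 * N}" for m js \<rho>
    using that
  proof (induction m arbitrary: \<rho>)
    case 0
    then have "generic N \<rho>" by (simp add: generic_def lessThan_atLeast0)
    from assms(2)[OF this] show ?case by (simp add: E_prod lessThan_atLeast0)
  next
    case (Suc m)
    let ?rest = "\<Prod>a\<in>{Suc m..<2 * N}. point_exp (sg N a) (\<rho> a)"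
    let ?G = "(\<Prod>a<m. hs (sg N a) (js a)) * ?rest"
    let ?S = "{r. Im r \<notin> (\<lambda>a. Im (\<rho> a)) ` {Suc m..<2 * N}}"
    have split: "{m..<2 * N} = insert m {Suc m..<2 * N}" using Suc.prems by auto
    have "A (hs (sg N m) (js m) * ?G) = 0"
    proof (rule point_exp_coeffs_vanish[OF A])
      show "infinite ?S" by (rule infinite_avoiding_Im) simp
      fix r assume r: "r \<in> ?S"
      have "inj_on (\<lambda>a. Im ((\<rho>(m := r)) a)) {m..<2 * N}"
        using Suc.prems(2) r unfolding split by (force simp: inj_on_def image_iff)
      with Suc have "A ((\<Prod>a<m. hs (sg N a) (js a)) *
          (\<Prod>a\<in>{m..<2 * N}. point_exp (sg N a) ((\<rho>(m := r)) a))) = 0" by simp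
      moreover have "(\<Prod>a\<in>{m..<2 * N}. point_exp (sg N a) ((\<rho>(m := r)) a)) = point_exp (sg N m) r * ?rest"
        unfolding split by (subst prod.insert) (auto intro!: prod.cong)
      ultimately show "A (point_exp (sg N m) r * ?G) = 0" by (simp add: mult.left_commute)
    qed
    then show ?case by (simp add: mult_ac)
  qed
  \<comment> \<open>The points of sign - get index 0, where \<open>hs\<close> is 1.\<close>
  let ?js = "\<lambda>a. if a < N then js a else 0"
  have "A (\<Prod>a<2 * N. hs (sg N a) (?js a)) = 0"
    using main[of "2 * N" "\<lambda>_. 0" ?js] by simp
  moreover have "(\<Prod>a<2 * N. hs (sg N a) (?js a)) = (\<Prod>a<N. hs 1 (js a))"
    by (rule prod.mono_neutral_cong_right) (auto simp: hs_0 sg_def)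
  ultimately show ?thesis by simp
qed

section \<open>From complete homogeneous functions to monomials in the times\<close>

definition deg :: "expo \<Rightarrow> nat" where
  "deg \<alpha> = (\<Sum>i\<in>keys \<alpha>. lookup \<alpha> i)"

lemma deg_add: "deg (\<alpha> + \<beta>) = deg \<alpha> + deg \<beta>"
proof -
  have sup: "deg \<delta> = (\<Sum>i\<in>keys \<alpha> \<union> keys \<beta>. lookup \<delta> i)" if "keys \<delta> \<subseteq> keys \<alpha> \<union> keys \<beta>" for \<delta>
    unfolding deg_def by (rule sum.mono_neutral_left) (use that in \<open>auto simp: in_keys_iff\<close>)
  show ?thesis
    by (subst (1 2 3) sup) (auto simp: in_keys_iff lookup_add sum.distrib)
qed

lemma deg_single: "deg (Poly_Mapping.single i 1) = 1"
  by (simp add: deg_def)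

lemma deg_le_weight: "deg \<alpha> \<le> weight \<alpha>"
  unfolding deg_def weight_def by (rule sum_mono) simp

lemma deg_eq_0: "deg \<alpha> = 0 \<longleftrightarrow> \<alpha> = 0"
  by (auto simp: deg_def in_keys_iff intro!: poly_mapping_eqI)

lemma tmono_zero: "tmono 0 = 1"
  by (simp add: tmono_def one_tps_def)

text \<open>The linear term of \<open>hs 1 (Suc i)\<close> is a single time, and all other monomials
  of that weight have degree at least 2. This allows solving for the time.\<close>

lemma hs_expand:
  "hs 1 (Suc i) = tmono (Poly_Mapping.single i 1) +
     (\<Sum>\<beta>\<in>{\<beta>. weight \<beta> = Suc i} - {Poly_Mapping.single i 1}.
        tconst (fps_const (exp_coeff (\<lambda>_. 1) \<beta>)) * tmono \<beta>)"
proof -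
  let ?e = "Poly_Mapping.single i (1::nat)" and ?W = "{\<beta>. weight \<beta> = Suc i}"
  have fin: "finite ?W"
    by (rule finite_subset[OF _ finite_weight_le[of "Suc i"]]) auto
  let ?T = "\<lambda>\<beta>. tconst (fps_const (exp_coeff (\<lambda>_. 1) \<beta>)) * tmono \<beta> :: funs"
  have "hs 1 (Suc i) = sum ?T ?W"
  proof (rule tps_eqI)
    fix \<gamma>
    have "tcoeff (sum ?T ?W) \<gamma> =
        (\<Sum>\<beta>\<in>?W. if \<beta> = \<gamma> then fps_const (exp_coeff (\<lambda>_. 1) \<gamma>) else 0)"
      unfolding tcoeff_sum by (rule sum.cong) (auto simp: tcoeff_tconst_mult tmono_def)
    then show "tcoeff (hs 1 (Suc i)) \<gamma> = tcoeff (sum ?T ?W) \<gamma>"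
      by (simp add: hs_def fin)
  qed
  also have "\<dots> = ?T ?e + sum ?T (?W - {?e})"
    by (rule sum.remove[OF fin]) (simp add: weight_single)
  also have "exp_coeff (\<lambda>_. 1) ?e = (1 :: complex)" by (simp add: exp_coeff_def)
  finally show ?thesis by (simp add: tconst_simps)
qed

text \<open>A time in \<delta> is replaced by \<open>hs 1 (Suc i)\<close> minus the other monomials
  of the same weight. The former lowers the weight; the latter keep it and raise the degree. The
  factor 2 in the measure ensures descent also for i = 0, where weight and degree both drop by
  1.\<close>

lemma monomials_vanish:
  fixes N :: nat
  assumes A: "filtered_linear A" and 0: "\<And>(N :: nat) js. A (\<Prod>a<N. hs 1 (js a)) = 0"
  shows "A (tmono \<delta> * (\<Prod>a<N. hs 1 (js a))) = 0"
proof (induction "2 * weight \<delta> - deg \<delta>" arbitrary: \<delta> N js rule: less_induct)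
  case less
  show ?case
  proof (cases "\<delta> = 0")
    case True
    then show ?thesis by (simp add: tmono_zero 0)
  next
    case False
    then obtain i where i: "lookup \<delta> i \<noteq> 0"
      by (metis lookup_zero poly_mapping_eqI)
    let ?e = "Poly_Mapping.single i (1::nat)" and ?H = "\<Prod>a<N. hs 1 (js a)"
    let ?W = "{\<beta>. weight \<beta> = Suc i} - {?e}"
    let ?c = "\<lambda>\<beta>. tconst (fps_const (exp_coeff (\<lambda>_. 1) \<beta>))"
    define \<delta>' where "\<delta>' = \<delta> - ?e"
    have \<delta>: "\<delta> = ?e + \<delta>'"
      using i by (intro poly_mapping_eqI)
        (auto simp: \<delta>'_def lookup_add lookup_minus lookup_single when_def)
    have w: "weight \<delta> = Suc i + weight \<delta>'" "deg \<delta> = 1 + deg \<delta>'"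
      unfolding \<delta> by (simp_all add: weight_add weight_single deg_add deg_single del: One_nat_def)
    note le = deg_le_weight[of \<delta>']
    have "?H * hs 1 (Suc i) = (\<Prod>a<Suc N. hs 1 ((js(N := Suc i)) a))" by simp
    then have 1: "A (tmono \<delta>' * (?H * hs 1 (Suc i))) = 0"
      using less[where \<delta> = \<delta>' and N = "Suc N" and js = "js(N := Suc i)"] w le by (simp del: prod.lessThan_Suc)
    have 2: "A (tmono (\<beta> + \<delta>') * ?H) = 0" if \<beta>: "\<beta> \<in> ?W" for \<beta>
    proof (rule less)
      have "deg \<beta> \<noteq> 0" using \<beta> by (auto simp: deg_eq_0)
      moreover have "deg \<beta> \<noteq> 1"
      proof
        assume d1: "deg \<beta> = 1"
        then obtain j where j: "lookup \<beta> j \<noteq> 0"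
          by (metis deg_eq_0 lookup_zero poly_mapping_eqI zero_neq_one)
        define \<beta>' where "\<beta>' = \<beta> - Poly_Mapping.single j 1"
        have b: "\<beta> = Poly_Mapping.single j 1 + \<beta>'"
          using j by (intro poly_mapping_eqI)
            (auto simp: \<beta>'_def lookup_add lookup_minus lookup_single when_def)
        with d1 have "\<beta>' = 0" by (simp add: deg_add deg_single[unfolded One_nat_def] deg_eq_0)
        with b \<beta> show False by (auto simp: weight_single)
      qed
      ultimately show "2 * weight (\<beta> + \<delta>') - deg (\<beta> + \<delta>') < 2 * weight \<delta> - deg \<delta>"
        using \<beta> w le deg_le_weight[of \<beta>] by (auto simp: weight_add deg_add)
    qed
    have "tmono \<delta> = tmono \<delta>' * hs 1 (Suc i) - (\<Sum>\<beta>\<in>?W. ?c \<beta> * tmono (\<beta> + \<delta>'))"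
      unfolding hs_expand \<delta> tmono_mult[symmetric]
      by (simp add: algebra_simps sum_distrib_left)
    then have "tmono \<delta> * ?H = (tmono \<delta>' * hs 1 (Suc i) - (\<Sum>\<beta>\<in>?W. ?c \<beta> * tmono (\<beta> + \<delta>'))) * ?H"
      by (simp only:)
    also have "\<dots> = tmono \<delta>' * (?H * hs 1 (Suc i)) - (\<Sum>\<beta>\<in>?W. ?c \<beta> * (tmono (\<beta> + \<delta>') * ?H))"
      by (simp add: algebra_simps sum_distrib_left)
    finally have "tmono \<delta> * ?H = \<dots>" .
    then show ?thesis by (simp add: filtered_linearD[OF A] 1 2)
  qed
qed

text \<open>Up to order D, \<open>f\<close> agrees with a polynomial in the times, on which
  \<open>A\<close> vanishes by linearity; the remainder does not reach the coefficient considered,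
  as \<open>A\<close> respects the filtration.\<close>

proposition filtered_linear_eq_0:
  assumes A: "filtered_linear A" and 0: "\<And>N \<rho>. generic N \<rho> \<Longrightarrow> A (exp_points N \<rho>) = 0"
  shows "A f = 0"
proof (rule tps_eqI, rule fps_ext)
  fix \<gamma> N
  define D where "D = weight \<gamma> + N"
  define g where "g = (\<Sum>\<delta> | weight \<delta> \<le> D. tconst (tcoeff f \<delta>) * tmono \<delta>)"
  have "A (tmono \<delta>) = 0" for \<delta>
    using monomials_vanish[OF A hs_products_vanish[OF A 0], where N = 0] by simp
  then have g0: "A g = 0" by (simp add: g_def filtered_linearD[OF A])
  have "tcoeff g \<delta> = tcoeff f \<delta>" if "weight \<delta> \<le> D" for \<delta>
  proof -
    have "tcoeff g \<delta> = (\<Sum>\<delta>' | weight \<delta>' \<le> D. if \<delta>' = \<delta> then tcoeff f \<delta> else 0)"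
      unfolding g_def tcoeff_sum by (rule sum.cong) (auto simp: tcoeff_tconst_mult tmono_def)
    with that show ?thesis by (simp add: finite_weight_le)
  qed
  then have "low D (f - g)" by (simp add: low_def)
  then have "low D (A f - A g)" by (metis filtered_linearD(3,5)[OF A])
  then show "fps_nth (tcoeff (A f) \<gamma>) N = fps_nth (tcoeff 0 \<gamma>) N"
    by (simp add: g0 low_def D_def)
qed

subsection \<open>The commutator on exponentials\<close>

definition shift :: "nat \<Rightarrow> (nat \<Rightarrow> complex) \<Rightarrow> nat \<Rightarrow> nat \<Rightarrow> nat \<Rightarrow> complex" where
  "shift N \<rho> a l = \<rho>(a := \<rho> a + sg N a * of_nat l)"

definition amp :: "nat \<Rightarrow> (nat \<Rightarrow> complex) \<Rightarrow> nat \<Rightarrow> nat \<Rightarrow> nat \<Rightarrow> scal" where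
  "amp N \<rho> a l k = fps_const (sg N a * wt N \<rho> a (\<rho> a + sg N a * of_nat l)) *
     fps_exp (of_nat k * pole N \<rho> (of_nat l) a)"

lemma L_op_E_amp:
  "generic N \<rho> \<Longrightarrow> L_op l k (exp_points N \<rho>) = (\<Sum>a<2 * N. tconst (amp N \<rho> a l k) * exp_points N (shift N \<rho> a l))"
  by (simp add: L_op_E amp_def shift_def)

lemma Im_shift: "Im (shift N \<rho> a l b) = Im (\<rho> b)"
  by (simp add: shift_def sg_def)

lemma generic_shift: "generic N \<rho> \<Longrightarrow> generic N (shift N \<rho> a l)"
  by (simp add: generic_def Im_shift)

lemma generic_neq:
  assumes "generic N \<rho>" "a < 2 * N" "b < 2 * N" "a \<noteq> b"
  shows "shift N \<rho> a l a - shift N \<rho> b k b \<noteq> 0" "shift N \<rho> a l a - \<rho> b \<noteq> 0"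
    "\<rho> a - shift N \<rho> b k b \<noteq> 0" "\<rho> a - \<rho> b \<noteq> 0"
proof -
  have "Im (\<rho> a) \<noteq> Im (\<rho> b)" using assms by (auto simp: generic_def inj_on_def)
  then have "Im (shift N \<rho> a l a - shift N \<rho> b k b) \<noteq> 0" "Im (shift N \<rho> a l a - \<rho> b) \<noteq> 0"
    "Im (\<rho> a - shift N \<rho> b k b) \<noteq> 0" "Im (\<rho> a - \<rho> b) \<noteq> 0"
    by (simp_all add: Im_shift)
  then show "shift N \<rho> a l a - shift N \<rho> b k b \<noteq> 0" "shift N \<rho> a l a - \<rho> b \<noteq> 0"
    "\<rho> a - shift N \<rho> b k b \<noteq> 0" "\<rho> a - \<rho> b \<noteq> 0"
    by (metis zero_complex.sel(2))+
qed

lemma L_op_L_op_E: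
  assumes "generic N \<rho>"
  shows "L_op n m (L_op l k (exp_points N \<rho>)) = (\<Sum>a<2 * N. \<Sum>b<2 * N.
    tconst (amp N \<rho> a l k * amp N (shift N \<rho> a l) b n m) * exp_points N (shift N (shift N \<rho> a l) b n))"
proof -
  note L = filtered_linearD[OF filtered_linear_L_op]
  have "L_op n m (L_op l k (exp_points N \<rho>)) =
      (\<Sum>a<2 * N. tconst (amp N \<rho> a l k) * L_op n m (exp_points N (shift N \<rho> a l)))"
    by (simp add: L_op_E_amp[OF assms] L)
  then show ?thesis
    by (simp add: L_op_E_amp generic_shift assms sum_distrib_left tconst_simps mult.assoc)
qed

text \<open>The intermediate Cauchy product cancels, its factors containing \<open>x\<close> being
  nonzero by assumption.\<close>

lemma wt_twice:
  assumes "\<And>b. b < 2 * N \<Longrightarrow> b \<noteq> a \<Longrightarrow> x - \<rho> b \<noteq> 0"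
  shows "wt N \<rho> a x * wt N (\<rho>(a := x)) a y = wt N \<rho> a y"
  unfolding wt_def prod.distrib[symmetric]
proof (rule prod.cong[OF refl])
  fix b assume "b \<in> {..<2 * N} - {a}"
  with assms have "x - \<rho> b \<noteq> 0" "b \<noteq> a" by auto
  then show "(if (a < N) = (b < N) then (x - \<rho> b) / (\<rho> a - \<rho> b) else (\<rho> a - \<rho> b) / (x - \<rho> b)) *
      (if (a < N) = (b < N) then (y - (\<rho>(a := x)) b) / ((\<rho>(a := x)) a - (\<rho>(a := x)) b)
       else ((\<rho>(a := x)) a - (\<rho>(a := x)) b) / (y - (\<rho>(a := x)) b)) =
      (if (a < N) = (b < N) then (y - \<rho> b) / (\<rho> a - \<rho> b) else (\<rho> a - \<rho> b) / (y - \<rho> b))"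
    by simp
qed

text \<open>Both sides are the Cauchy ratio for moving both points. Factors with a third point do
  not notice the other move, so only those between \<open>a\<close> and \<open>b\<close> have to be
  compared.\<close>

lemma wt_swap:
  assumes "a < 2 * N" "b < 2 * N" "a \<noteq> b"
    and ne: "x - y \<noteq> 0" "x - \<rho> b \<noteq> 0" "\<rho> a - y \<noteq> 0" "\<rho> a - \<rho> b \<noteq> 0"
  shows "wt N \<rho> a x * wt N (\<rho>(a := x)) b y = wt N \<rho> b y * wt N (\<rho>(b := y)) a x"
proof -
  define t :: "nat \<Rightarrow> nat \<Rightarrow> complex \<Rightarrow> complex \<Rightarrow> complex" where
    "t = (\<lambda>a b u v. if (a < N) = (b < N) then u / v else v / u)"
  let ?R = "\<lambda>c z. \<Prod>e\<in>{..<2 * N} - {a, b}. t c e (z - \<rho> e) (\<rho> c - \<rho> e)"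
  have wt: "wt N \<rho>' c z = t c d (z - \<rho>' d) (\<rho>' c - \<rho>' d) *
      (\<Prod>e\<in>{..<2 * N} - {c, d}. t c e (z - \<rho>' e) (\<rho>' c - \<rho>' e))"
    if "c < 2 * N" "d < 2 * N" "c \<noteq> d" for c d \<rho>' z
  proof -
    have "{..<2 * N} - {c} - {d} = {..<2 * N} - {c, d}" by auto
    then show ?thesis using that unfolding wt_def t_def
      by (subst prod.remove[of _ d]) auto
  qed
  have set: "{..<2 * N} - {b, a} = {..<2 * N} - {a, b}" by auto
  have e1: "wt N \<rho> a x = t a b (x - \<rho> b) (\<rho> a - \<rho> b) * ?R a x"
    using assms by (simp add: wt[of a b])
  have e2: "wt N (\<rho>(a := x)) b y = t b a (y - x) (\<rho> b - x) * ?R b y"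
  proof -
    have "(\<Prod>e\<in>{..<2 * N} - {a, b}. t b e (y - (\<rho>(a := x)) e) ((\<rho>(a := x)) b - (\<rho>(a := x)) e)) = ?R b y"
      using assms(3) by (intro prod.cong) auto
    then show ?thesis using wt[of b a "\<rho>(a := x)" y] assms(1-3) by (simp add: set)
  qed
  have e3: "wt N \<rho> b y = t b a (y - \<rho> a) (\<rho> b - \<rho> a) * ?R b y"
    using assms by (simp add: wt[of b a] set)
  have e4: "wt N (\<rho>(b := y)) a x = t a b (x - y) (\<rho> a - y) * ?R a x"
  proof -
    have "(\<Prod>e\<in>{..<2 * N} - {a, b}. t a e (x - (\<rho>(b := y)) e) ((\<rho>(b := y)) a - (\<rho>(b := y)) e)) = ?R a x"
      using assms(3) by (intro prod.cong) auto
    then show ?thesis using wt[of a b "\<rho>(b := y)" x] assms(1-3) by simp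
  qed
  have "t a b (x - \<rho> b) (\<rho> a - \<rho> b) * t b a (y - x) (\<rho> b - x) =
      t b a (y - \<rho> a) (\<rho> b - \<rho> a) * t a b (x - y) (\<rho> a - y)"
  proof -
    \<comment> \<open>All differences get the same orientation; the minus signs then cancel in
      pairs, whether the two points have equal or opposite sign.\<close>
    have "\<rho> b - x = - (x - \<rho> b)" "y - x = - (x - y)" "y - \<rho> a = - (\<rho> a - y)" "\<rho> b - \<rho> a = - (\<rho> a - \<rho> b)"
      by simp_all
    note eqs = this
    have "A / B * (- C / - A) = - D / - B * (C / D)" "B / A * (- A / - C) = - B / - D * (D / C)"
      if "A \<noteq> 0" "B \<noteq> 0" "C \<noteq> 0" "D \<noteq> 0" for A B C D :: complex
      using that by simp_all
    note * = this(1)[OF ne(2,4,1,3)] this(2)[OF ne(2,4,1,3)]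
    obtain c where "t a b u v = (if c then u / v else v / u)" "t b a u v = (if c then u / v else v / u)" for u v
      by (rule that[of "(a < N) = (b < N)"]) (auto simp: t_def)
    then show ?thesis
      unfolding eqs by (cases c) (simp_all only: * if_True if_False)
  qed
  moreover have "(p * R) * (p' * S) = (r * S) * (r' * R)" if "p * p' = r * r'" for p p' r r' R S :: complex
    using that by algebra
  ultimately show ?thesis unfolding e1 e2 e3 e4 by blast
qed

lemma amp_product:
  "(fps_const (s * w) * e) * (fps_const (s' * w') * e') = fps_const (s * s' * (w * w')) * (e * e')"
  for w :: complex
  by (simp only: fps_const_mult[symmetric] mult_ac)

text \<open>The pole of a point depends on the position of that point alone, so the exponential
  factors agree in both orders and \<open>wt_swap\<close> settles the rest.\<close>

lemma amp_swap:
  assumes "generic N \<rho>" "a < 2 * N" "b < 2 * N" "a \<noteq> b"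
  shows "amp N \<rho> a l k * amp N (shift N \<rho> a l) b n m = amp N \<rho> b n m * amp N (shift N \<rho> b n) a l k"
proof -
  let ?x = "\<rho> a + sg N a * of_nat l" and ?y = "\<rho> b + sg N b * of_nat n"
  have "wt N \<rho> a ?x * wt N (\<rho>(a := ?x)) b ?y = wt N \<rho> b ?y * wt N (\<rho>(b := ?y)) a ?x"
    using assms generic_neq(1)[OF assms, of l n] generic_neq(2)[OF assms, of l]
      generic_neq(3)[OF assms, of n] generic_neq(4)[OF assms] by (intro wt_swap) (simp_all add: shift_def)
  moreover have "pole N (shift N \<rho> a l) x b = pole N \<rho> x b" "pole N (shift N \<rho> b n) x a = pole N \<rho> x a" for x
    using assms by (simp_all add: pole_def shift_def)
  moreover have "amp N \<rho> a l k * amp N (shift N \<rho> a l) b n m =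
      fps_const (sg N a * sg N b * (wt N \<rho> a ?x * wt N (\<rho>(a := ?x)) b ?y)) *
      (fps_exp (of_nat k * pole N \<rho> (of_nat l) a) * fps_exp (of_nat m * pole N (shift N \<rho> a l) (of_nat n) b))"
    unfolding amp_def amp_product using assms by (simp add: shift_def)
  moreover have "amp N \<rho> b n m * amp N (shift N \<rho> b n) a l k =
      fps_const (sg N a * sg N b * (wt N \<rho> b ?y * wt N (\<rho>(b := ?y)) a ?x)) *
      (fps_exp (of_nat k * pole N (shift N \<rho> b n) (of_nat l) a) * fps_exp (of_nat m * pole N \<rho> (of_nat n) b))"
    unfolding amp_def amp_product using assms by (simp add: shift_def mult.commute)
  ultimately show ?thesis by simp
qed

text \<open>The origin of the powers of q. For sign + the second move starts at x + l: k x + m (x +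
  l) = (k + m) x + m l. For sign - the poles are y - l and y - l - n: k (y - l) + m (y - l - n) = (k
  + m) (y - l - n) + n k. The extra \<open>sg N a\<close> appears because two moves carry two signs
  and one move only one.\<close>

lemma amp_twice:
  assumes "generic N \<rho>" "a < 2 * N"
  shows "amp N \<rho> a l k * amp N (shift N \<rho> a l) a n m =
    fps_exp (if a < N then of_nat (m * l) else of_nat (n * k)) * (fps_const (sg N a) * amp N \<rho> a (l + n) (k + m))"
proof -
  let ?x = "\<rho> a + sg N a * of_nat l" and ?y = "\<rho> a + sg N a * of_nat (l + n)"
  have y: "?x + sg N a * of_nat n = ?y" by (simp add: algebra_simps)
  have "wt N \<rho> a ?x * wt N (\<rho>(a := ?x)) a ?y = wt N \<rho> a ?y"
    using generic_neq(2)[OF assms(1,2), of _ l] by (intro wt_twice) (auto simp: shift_def)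
  then have "amp N \<rho> a l k * amp N (shift N \<rho> a l) a n m = fps_const (sg N a * sg N a * wt N \<rho> a ?y) *
      (fps_exp (of_nat k * pole N \<rho> (of_nat l) a) * fps_exp (of_nat m * pole N (\<rho>(a := ?x)) (of_nat n) a))"
    unfolding amp_def amp_product shift_def fun_upd_same y by (simp only:)
  also have "fps_exp (of_nat k * pole N \<rho> (of_nat l) a) * fps_exp (of_nat m * pole N (\<rho>(a := ?x)) (of_nat n) a) =
      fps_exp ((if a < N then of_nat (m * l) else of_nat (n * k)) + of_nat (k + m) * pole N \<rho> (of_nat (l + n)) a)"
    unfolding fps_exp_add_mult[symmetric]
    by (rule arg_cong[of _ _ fps_exp]) (simp add: pole_def sg_def algebra_simps)
  finally show ?thesis
    unfolding amp_def fps_exp_add_mult by (simp only: fps_const_mult[symmetric] mult_ac)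
qed

lemma shift_shift: "shift N (shift N \<rho> a l) a n = shift N \<rho> a (l + n)"
  by (simp add: shift_def algebra_simps)

lemma shift_swap: "a \<noteq> b \<Longrightarrow> shift N (shift N \<rho> a l) b n = shift N (shift N \<rho> b n) a l"
  by (auto simp: shift_def)

lemma commutator_E:
  assumes "generic N \<rho>"
  shows "commutator (L_op n m) (L_op l k) (exp_points N \<rho>) =
    tconst (q ^ (m * l) - q ^ (n * k)) * L_op (n + l) (m + k) (exp_points N \<rho>)"
proof -
  let ?S = "{..<2 * N}"
  let ?f = "\<lambda>a b. tconst (amp N \<rho> a l k * amp N (shift N \<rho> a l) b n m) * exp_points N (shift N (shift N \<rho> a l) b n)"
  let ?g = "\<lambda>a b. tconst (amp N \<rho> b n m * amp N (shift N \<rho> b n) a l k) * exp_points N (shift N (shift N \<rho> b n) a l)"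
  let ?Q = "q ^ (m * l) - q ^ (n * k)"
  have pow: "q ^ j = fps_exp (of_nat j)" for j by (simp add: q_def fps_exp_power_mult)
  have "L_op l k (L_op n m (exp_points N \<rho>)) = (\<Sum>a\<in>?S. \<Sum>b\<in>?S. ?g a b)"
    unfolding L_op_L_op_E[OF assms] by (rule sum.swap)
  then have "commutator (L_op n m) (L_op l k) (exp_points N \<rho>) = (\<Sum>a\<in>?S. \<Sum>b\<in>?S. ?f a b) - (\<Sum>a\<in>?S. \<Sum>b\<in>?S. ?g a b)"
    unfolding commutator_def L_op_L_op_E[OF assms, of n m l k] by (simp only:)
  also have "\<dots> = (\<Sum>a\<in>?S. \<Sum>b\<in>?S. ?f a b - ?g a b)"
    by (simp only: sum_subtractf)
  also have "\<dots> = (\<Sum>a\<in>?S. tconst ?Q * (tconst (amp N \<rho> a (n + l) (m + k)) * exp_points N (shift N \<rho> a (n + l))))"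
  proof (rule sum.cong[OF refl])
    fix a assume a: "a \<in> ?S"
    have "?f a b - ?g a b = 0" if "b \<in> ?S" "b \<noteq> a" for b
      unfolding amp_swap[OF assms lessThan_iff[THEN iffD1, OF a] lessThan_iff[THEN iffD1, OF that(1)] that(2)[symmetric]]
        shift_swap[OF that(2)[symmetric]] by (rule diff_self)
    then have "(\<Sum>b\<in>?S. ?f a b - ?g a b) = (\<Sum>b\<in>?S. if b = a then ?f a a - ?g a a else 0)"
      by (intro sum.cong) auto
    also have "\<dots> = ?f a a - ?g a a" using a by simp
    also have "\<dots> = tconst (amp N \<rho> a l k * amp N (shift N \<rho> a l) a n m -
        amp N \<rho> a n m * amp N (shift N \<rho> a n) a l k) * exp_points N (shift N \<rho> a (n + l))"
      by (simp only: shift_shift add.commute[of l n] tconst_simps(4) left_diff_distrib)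
    also have "amp N \<rho> a l k * amp N (shift N \<rho> a l) a n m -
        amp N \<rho> a n m * amp N (shift N \<rho> a n) a l k = ?Q * amp N \<rho> a (n + l) (m + k)"
    proof -
      let ?z = "amp N \<rho> a (n + l) (m + k)"
      have sg: "fps_const (sg N a) = (if a < N then 1 else - 1)"
        by (rule fps_ext) (simp add: sg_def)
      have "amp N \<rho> a l k * amp N (shift N \<rho> a l) a n m =
          fps_exp (if a < N then of_nat (m * l) else of_nat (n * k)) * (fps_const (sg N a) * ?z)"
        using amp_twice[OF assms, of a l k n m] a by (simp only: lessThan_iff add.commute[of l n] add.commute[of k m])
      moreover have "amp N \<rho> a n m * amp N (shift N \<rho> a n) a l k =
          fps_exp (if a < N then of_nat (n * k) else of_nat (m * l)) * (fps_const (sg N a) * ?z)"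
        using amp_twice[OF assms, of a n m l k] a by (simp only: lessThan_iff mult.commute[of l m] mult.commute[of k n])
      \<comment> \<open>For sign - the two powers of q are exchanged and the prefactor is -1, so
        both kinds of points give the same factor.\<close>
      moreover have "(if c then x else y) * ((if c then 1 else - 1) * z) -
          (if c then y else x) * ((if c then 1 else - 1) * z) = (x - y) * z" for c and x y z :: scal
        by (simp add: algebra_simps)
      ultimately show ?thesis by (simp only: pow sg if_distrib[of fps_exp])
    qed
    finally show "(\<Sum>b\<in>?S. ?f a b - ?g a b) =
        tconst ?Q * (tconst (amp N \<rho> a (n + l) (m + k)) * exp_points N (shift N \<rho> a (n + l)))"
      by (simp only: tconst_simps(5) mult.assoc)
  qed
  also have "\<dots> = tconst ?Q * L_op (n + l) (m + k) (exp_points N \<rho>)"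
    by (simp add: L_op_E_amp[OF assms] sum_distrib_left)
  finally show ?thesis .
qed

theorem mainTheorem4:
  fixes n m l k :: nat
  shows "(\<forall>\<tau>. KP_tau \<tau> \<longrightarrow>
            commutator (L_op n m) (L_op l k) \<tau> =
            tconst (q ^ (m * l) - q ^ (n * k)) * L_op (n + l) (m + k) \<tau>) \<and>
         commutator (L_op n m) (L_op l k) =
           (\<lambda>f. tconst (q ^ (m * l) - q ^ (n * k)) * L_op (n + l) (m + k) f)"
proof -
  let ?A = "\<lambda>f. commutator (L_op n m) (L_op l k) f -
    tconst (q ^ (m * l) - q ^ (n * k)) * L_op (n + l) (m + k) f"
  have lin: "filtered_linear ?A"
    unfolding commutator_def
    by (intro filtered_linear_diff filtered_linear_tconst filtered_linear_L_op
        filtered_linear_comp[OF filtered_linear_L_op filtered_linear_L_op])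
  have "?A (exp_points N \<rho>) = 0" if "generic N \<rho>" for N \<rho>
    unfolding commutator_E[OF that] by (rule diff_self)
  then have "?A f = 0" for f
    by (rule filtered_linear_eq_0[OF lin])
  then have "commutator (L_op n m) (L_op l k) f =
      tconst (q ^ (m * l) - q ^ (n * k)) * L_op (n + l) (m + k) f" for f
    by (rule right_minus_eq[THEN iffD1])
  then show ?thesis by (intro conjI allI impI ext)
qed

end
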